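(* There is an algorithm which, given a finite simple graph $G=(V,E)$, enumerates all inclusion-wise minimal edge dominating sets of $G$, each exactly once, with polynomial delay and using polynomial space.
   Context: For an edge $e=xy$ of $G$, let $N[e]$ be the set of edges sharing at least one endpoint with $e$ (including $e$ itself). A set $D\subseteq E$ is an edge dominating set if $N[e]\cap D\neq\emptyset$ for every $e\in E$; it is minimal if no proper subset of it is an edge dominating set. The size of the input is $|V|+|E|$ (equivalently, polynomially related to it). An enumeration algorithm has polynomial delay if, after a preprocessing phase taking time polynomial in the input size, it outputs the elements of the required family without repetition such that the time between any two consecutive outputs, and between the last output and termination, is bounded by a polynomial in the input size. It uses polynomial space if the total memory used is bounded by a polynomial in the input size. *)

theory Defs
  imports "HOL-Computational_Algebra.Polynomial"
begin

section \<open>Minimal edge dominating sets\<close>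

definition fin_simple_graph :: "'a set \<Rightarrow> 'a set set \<Rightarrow> bool" where
  "fin_simple_graph V E \<longleftrightarrow> finite V \<and> (\<forall>e\<in>E. e \<subseteq> V \<and> card e = 2)"

definition closed_edge_nbhd :: "'a set set \<Rightarrow> 'a set \<Rightarrow> 'a set set" where
  "closed_edge_nbhd E e = {f \<in> E. f \<inter> e \<noteq> {}}"

definition edge_dominating :: "'a set set \<Rightarrow> 'a set set \<Rightarrow> bool" where
  "edge_dominating E D \<longleftrightarrow> D \<subseteq> E \<and> (\<forall>e\<in>E. closed_edge_nbhd E e \<inter> D \<noteq> {})"

definition minimal_edge_dominating :: "'a set set \<Rightarrow> 'a set set \<Rightarrow> bool" where
  "minimal_edge_dominating E D \<longleftrightarrow>
     edge_dominating E D \<and> (\<forall>D'. D' \<subset> D \<longrightarrow> \<not> edge_dominating E D')"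


section \<open>Model of computation\<close>

text \<open>
  Algorithms are deterministic while-programs whose variables hold binary trees (the
  WHILE language of Jones, with an additional output command). Trees are taken to be
  stored without sharing: the space of a variable is the \<^const>\<open>size\<close> of its value, i.e.
  its number of \<open>Node\<close> cells, and reading a variable costs time proportional to that
  size. Therefore time and space agree, up to polynomials, with those of Turing machines.
\<close>

datatype tree = Leaf | Node tree tree

datatype exp =
    Var nat
  | LeafE
  | NodeE exp exp
  | Left exp
  | Right exp
  | Equal exp exp

datatype com =
    Skip
  | Assign nat exp
  | Seq com com
  | Cond exp com com
  | While exp com
  | Output exp

type_synonym store = "nat \<Rightarrow> tree"

fun left :: "tree \<Rightarrow> tree" where
  "left Leaf = Leaf"
| "left (Node l r) = l"

fun right :: "tree \<Rightarrow> tree" where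
  "right Leaf = Leaf"
| "right (Node l r) = r"

text \<open>\<^const>\<open>Leaf\<close> is the truth value false; every other tree counts as true.\<close>

fun eval :: "exp \<Rightarrow> store \<Rightarrow> tree" where
  "eval (Var x) s = s x"
| "eval LeafE s = Leaf"
| "eval (NodeE a b) s = Node (eval a s) (eval b s)"
| "eval (Left a) s = left (eval a s)"
| "eval (Right a) s = right (eval a s)"
| "eval (Equal a b) s = (if eval a s = eval b s then Node Leaf Leaf else Leaf)"

text \<open>
  The cost of an expression exceeds the size of all the values that occur in its
  evaluation, so copying and comparing trees is paid for.
\<close>

fun eval_cost :: "exp \<Rightarrow> store \<Rightarrow> nat" where
  "eval_cost (Var x) s = 1 + size (s x)"
| "eval_cost LeafE s = 1"
| "eval_cost (NodeE a b) s = 1 + eval_cost a s + eval_cost b s"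
| "eval_cost (Left a) s = 1 + eval_cost a s"
| "eval_cost (Right a) s = 1 + eval_cost a s"
| "eval_cost (Equal a b) s = 1 + eval_cost a s + eval_cost b s"

fun step :: "com \<Rightarrow> store \<Rightarrow> com \<times> store" where
  "step Skip s = (Skip, s)"
| "step (Assign x e) s = (Skip, s(x := eval e s))"
| "step (Seq c d) s =
     (if c = Skip then (d, s) else (case step c s of (c', s') \<Rightarrow> (Seq c' d, s')))"
| "step (Cond e c d) s = (if eval e s \<noteq> Leaf then c else d, s)"
| "step (While e c) s = (Cond e (Seq c (While e c)) Skip, s)"
| "step (Output e) s = (Skip, s)"

fun step_cost :: "com \<Rightarrow> store \<Rightarrow> nat" where
  "step_cost Skip s = 0"
| "step_cost (Assign x e) s = 1 + eval_cost e s"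
| "step_cost (Seq c d) s = (if c = Skip then 1 else step_cost c s)"
| "step_cost (Cond e c d) s = 1 + eval_cost e s"
| "step_cost (While e c) s = 1"
| "step_cost (Output e) s = 1 + eval_cost e s"

fun step_output :: "com \<Rightarrow> store \<Rightarrow> tree option" where
  "step_output (Output e) s = Some (eval e s)"
| "step_output (Seq c d) s = step_output c s"
| "step_output _ s = None"

fun exp_vars :: "exp \<Rightarrow> nat set" where
  "exp_vars (Var x) = {x}"
| "exp_vars LeafE = {}"
| "exp_vars (NodeE a b) = exp_vars a \<union> exp_vars b"
| "exp_vars (Left a) = exp_vars a"
| "exp_vars (Right a) = exp_vars a"
| "exp_vars (Equal a b) = exp_vars a \<union> exp_vars b"

fun com_vars :: "com \<Rightarrow> nat set" where
  "com_vars Skip = {}"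
| "com_vars (Assign x e) = insert x (exp_vars e)"
| "com_vars (Seq c d) = com_vars c \<union> com_vars d"
| "com_vars (Cond e c d) = exp_vars e \<union> com_vars c \<union> com_vars d"
| "com_vars (While e c) = exp_vars e \<union> com_vars c"
| "com_vars (Output e) = exp_vars e"

text \<open>The input is placed in variable 0; all other variables start as \<^const>\<open>Leaf\<close>.\<close>

definition config :: "com \<Rightarrow> tree \<Rightarrow> nat \<Rightarrow> com \<times> store" where
  "config c inp i = ((\<lambda>(c', s). step c' s) ^^ i) (c, (\<lambda>_. Leaf)(0 := inp))"

definition elapsed :: "com \<Rightarrow> tree \<Rightarrow> nat \<Rightarrow> nat" where
  "elapsed c inp i = (\<Sum>k<i. case config c inp k of (c', s) \<Rightarrow> step_cost c' s)"

definition output_at :: "com \<Rightarrow> tree \<Rightarrow> nat \<Rightarrow> tree option" where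
  "output_at c inp i = (case config c inp i of (c', s) \<Rightarrow> step_output c' s)"

definition space_at :: "com \<Rightarrow> tree \<Rightarrow> nat \<Rightarrow> nat" where
  "space_at c inp i = (\<Sum>x \<in> insert 0 (com_vars c). size (snd (config c inp i) x))"

definition outputs :: "com \<Rightarrow> tree \<Rightarrow> nat \<Rightarrow> tree list" where
  "outputs c inp N = List.map_filter (output_at c inp) [0..<N]"

text \<open>The start, the times at which outputs are completed, and the end of the run.\<close>

definition milestones :: "com \<Rightarrow> tree \<Rightarrow> nat \<Rightarrow> nat list" where
  "milestones c inp N =
     0 # map (\<lambda>i. elapsed c inp (Suc i)) (filter (\<lambda>i. output_at c inp i \<noteq> None) [0..<N])
       @ [elapsed c inp N]"

text \<open>
  On input \<open>inp\<close> the program halts after emitting exactly the sequence \<open>outs\<close>; at most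
  \<open>d\<close> time units pass before the first output (preprocessing), between consecutive outputs,
  and from the last output to termination; and at most \<open>m\<close> cells are in use at any moment
  (outputs are written to a write-only medium that is not counted).
  Halted configurations emit nothing and cost nothing, so the choice of \<open>N\<close> is immaterial.
\<close>

definition enumerates_within :: "com \<Rightarrow> tree \<Rightarrow> tree list \<Rightarrow> nat \<Rightarrow> nat \<Rightarrow> bool" where
  "enumerates_within c inp outs d m \<longleftrightarrow>
     (\<exists>N. fst (config c inp N) = Skip \<and>
          outputs c inp N = outs \<and>
          successively (\<lambda>t t'. t' \<le> t + d) (milestones c inp N) \<and>
          (\<forall>i\<le>N. space_at c inp i \<le> m))"


section \<open>Representation of graphs and edge sets\<close>

text \<open>
  Relative to an enumeration \<open>vs\<close> of the vertex set, a vertex is represented by its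
  index. Indices are below the number of vertices, so writing them in unary keeps the code
  of a graph polynomial in the number of vertices and edges.
\<close>

fun enc_nat :: "nat \<Rightarrow> tree" where
  "enc_nat 0 = Leaf"
| "enc_nat (Suc n) = Node Leaf (enc_nat n)"

fun enc_edges :: "(nat \<times> nat) list \<Rightarrow> tree" where
  "enc_edges [] = Leaf"
| "enc_edges ((i, j) # es) = Node (Node (enc_nat i) (enc_nat j)) (enc_edges es)"

definition enc_graph :: "nat \<Rightarrow> (nat \<times> nat) list \<Rightarrow> tree" where
  "enc_graph n es = Node (enc_nat n) (enc_edges es)"

text \<open>\<open>es\<close> lists every edge in \<open>F\<close> exactly once, in any order and orientation.\<close>

definition lists_edges :: "'a list \<Rightarrow> 'a set set \<Rightarrow> (nat \<times> nat) list \<Rightarrow> bool" where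
  "lists_edges vs F es \<longleftrightarrow>
     (\<forall>(i, j) \<in> set es. i < length vs \<and> j < length vs) \<and>
     distinct (map (\<lambda>(i, j). {vs ! i, vs ! j}) es) \<and>
     set (map (\<lambda>(i, j). {vs ! i, vs ! j}) es) = F"

definition represents_edges :: "'a list \<Rightarrow> 'a set set \<Rightarrow> tree \<Rightarrow> bool" where
  "represents_edges vs F t \<longleftrightarrow> (\<exists>es. lists_edges vs F es \<and> t = enc_edges es)"

definition represents_graph :: "'a list \<Rightarrow> 'a set \<Rightarrow> 'a set set \<Rightarrow> tree \<Rightarrow> bool" where
  "represents_graph vs V E t \<longleftrightarrow>
     distinct vs \<and> set vs = V \<and> (\<exists>es. lists_edges vs E es \<and> t = enc_graph (length vs) es)"

end

theory Submission imports Defs begin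

text \<open>
  Fix an order of the edges. A level is a suffix \<open>B\<close> of the edge list, and its solutions are the sets
  \<open>T\<close> that are minimal with \<open>B \<union> T\<close> edge dominating. The full list has the single solution \<open>{}\<close>, and
  the solutions of the empty list are the minimal edge dominating sets. Every solution \<open>T\<close> of \<open>B\<close> has one
  parent among the solutions of \<open>e # B\<close>: it is \<open>T - {e}\<close> if that set is one. Conversely, \<open>T\<close> or
  \<open>T \<union> {e}\<close> is a child of every solution \<open>T\<close> of \<open>e # B\<close>, so the resulting tree has no dead ends.
  The other solutions \<open>T\<close> of \<open>B\<close> are born at \<open>B\<close>. If they cover both ends of \<open>e\<close>, the parent is a greedy
  reduction of \<open>T\<close>; it drops at most two edges, so trying all pairs finds these children.

  If a born \<open>T\<close> leaves an end \<open>y\<close> of \<open>e\<close> uncovered, a solution may have exponentially many such children.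
  They are grouped by the set \<open>I\<close> of uncovered vertices and a set \<open>N\<close> of representative edges of \<open>T\<close>.
  All members of a group get the same parent, from which only polynomially many groups can be
  recovered, and a group consists exactly of the minimal covers \<open>S\<close> with \<open>N \<subseteq> S \<subseteq> N \<union> W\<close>
  of the vertices covered by \<open>T\<close> but not by \<open>B\<close>. These are
  enumerated by branching on the one or two first edges at a vertex that is not yet covered; whether a branch
  contains a born solution can be decided in polynomial time, because two edges suffice as a witness.
  Depth-first search of the whole tree, whose depth and degrees are polynomial and all of whose nodes
  lead to outputs, has polynomial delay, and its stack needs only polynomial space.
\<close>

section \<open>Runs of while-programs\<close>

text \<open>The obstacle is dead ends: in a minimal solution every edge needs a vertex that it alone
  covers, and later choices may take this vertex away. An edge is therefore fixed only together with
  a vertex reserved for it, which no edge still available meets (\<open>inv\<close>). Every cover in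
  the range then shrinks to a minimal one that keeps the fixed edges, and whether a branch is
  inhabited is a mere question of coverage. For representatives the far end is reserved. In the
  branching, an edge that covers the chosen vertex alone has this vertex; if several edges cover it,
  each has its far end, and two of them are fixed because only a second edge forces the far end of
  the first to be private. A group needs a parent that depends on its common data alone and from
  which these data can be read off; \<open>prc\<close>, \<open>N0k\<close> and \<open>W0k\<close>
  are made for this. The delay then amounts to one descent: pending nodes wait on a stack, so after
  an output the search continues at once with the next node, and below every node there is an output
  at a depth bounded by its \<open>rank\<close>.\<close>

inductive run :: "com \<Rightarrow> store \<Rightarrow> (nat \<times> tree option) list \<Rightarrow> com \<Rightarrow> store \<Rightarrow> bool" where
  run_refl: "run c s [] c s"
| run_step: "\<lbrakk>c \<noteq> Skip; step c s = (c', s'); run c' s' tr c'' s''\<rbrakk>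
    \<Longrightarrow> run c s ((step_cost c s, step_output c s) # tr) c'' s''"

lemma run_trans: "run c s tr c' s' \<Longrightarrow> run c' s' tr' c'' s'' \<Longrightarrow> run c s (tr @ tr') c'' s''"
  by (induction rule: run.induct) (simp_all add: run_step)

lemma run_single:
  "c \<noteq> Skip \<Longrightarrow> step c s = (c', s') \<Longrightarrow> run c s [(step_cost c s, step_output c s)] c' s'"
  by (rule run_step[OF _ _ run_refl])

lemma run_Seq: "run c s tr c' s' \<Longrightarrow> run (Seq c d) s tr (Seq c' d) s'"
proof (induction rule: run.induct)
  case (run_step c s c' s' tr c'' s'')
  then show ?case using run.run_step[of "Seq c d" s "Seq c' d" s' tr "Seq c'' d" s''] by simp
qed (rule run_refl)

lemma run_Seq_Skip:
  assumes "run c s tr Skip s'"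
  shows "run (Seq c d) s (tr @ [(1, None)]) d s'"
proof -
  have "run (Seq Skip d) s' [(1, None)] d s'" using run_single[of "Seq Skip d" s' d s'] by auto
  with run_Seq[OF assms] run_trans show ?thesis by blast
qed

lemma size_eval: "size (eval e s) \<le> eval_cost e s"
proof (induction e)
  case (Left e) then show ?case by (cases "eval e s") auto
next
  case (Right e) then show ?case by (cases "eval e s") auto
qed auto

lemma size_step: "step c s = (c', s') \<Longrightarrow> size (s' x) \<le> max (size (s x)) (step_cost c s)"
proof (induction c arbitrary: c' s')
  case (Assign y e)
  then show ?case using size_eval[of e s] by auto
qed (auto split: if_splits prod.splits)

text \<open>A tree found in a variable was either there before or paid for by the assignment that
  wrote it, so memory cannot outgrow time.\<close>

lemma run_size: "run c s tr c' s' \<Longrightarrow> size (s' x) \<le> max (size (s x)) (sum_list (map fst tr))"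
proof (induction rule: run.induct)
  case (run_step c s c' s' tr c'' s'')
  then show ?case using size_step[of c s c' s' x] by auto
qed auto

text \<open>It is enough that no single step is expensive. This version yields polynomial space even
  for runs that are exponentially long.\<close>

lemma run_size_max:
  "run c s tr c' s' \<Longrightarrow> \<forall>z\<in>set tr. fst z \<le> d \<Longrightarrow> size (s x) \<le> d \<Longrightarrow> size (s' x) \<le> d"
proof (induction rule: run.induct)
  case (run_step c s c' s' tr c'' s'')
  then show ?case using size_step[of c s c' s' x] by auto
qed auto

subsection \<open>Silent runs on the single variable 0\<close>

text \<open>Only variable 0 is specified, before and after; the other variables are arbitrary on
  both sides, so silent programs compose without side conditions.\<close>

definition ex :: "com \<Rightarrow> tree \<Rightarrow> nat \<Rightarrow> tree \<Rightarrow> bool" where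
  "ex c t K t' \<longleftrightarrow> (\<forall>s. s 0 = t \<longrightarrow> (\<exists>tr s'. run c s tr Skip s' \<and> s' 0 = t' \<and>
     (\<forall>z\<in>set tr. snd z = None) \<and> sum_list (map fst tr) \<le> K))"

lemma exI0:
  assumes "\<And>s. s 0 = t \<Longrightarrow> \<exists>tr s'. run c s tr Skip s' \<and> s' 0 = t' \<and>
     (\<forall>z\<in>set tr. snd z = None) \<and> sum_list (map fst tr) \<le> K"
  shows "ex c t K t'"
  using assms by (simp add: ex_def)

lemma exD:
  assumes "ex c t K t'" "s 0 = t"
  obtains tr s' where "run c s tr Skip s'" "s' 0 = t'" "\<forall>z\<in>set tr. snd z = None"
    "sum_list (map fst tr) \<le> K"
proof -
  from assms have "\<exists>tr s'. run c s tr Skip s' \<and> s' 0 = t' \<and>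
     (\<forall>z\<in>set tr. snd z = None) \<and> sum_list (map fst tr) \<le> K"
    by (simp add: ex_def)
  with that show ?thesis by (elim exE conjE)
qed

lemma ex_mono:
  assumes "ex c t K t'" "K \<le> K'"
  shows "ex c t K' t'"
proof (rule exI0)
  fix s :: store assume "s 0 = t"
  with assms(1) obtain tr s' where "run c s tr Skip s'" "s' 0 = t'" "\<forall>z\<in>set tr. snd z = None"
    "sum_list (map fst tr) \<le> K" by (rule exD)
  with assms(2) show "\<exists>tr s'. run c s tr Skip s' \<and> s' 0 = t' \<and>
     (\<forall>z\<in>set tr. snd z = None) \<and> sum_list (map fst tr) \<le> K'"
    by (intro exI[of _ tr] exI[of _ s']) simp
qed

lemma ex_Skip: "ex Skip t 0 t"
proof (rule exI0)
  fix s :: store assume "s 0 = t"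
  then show "\<exists>tr s'. run Skip s tr Skip s' \<and> s' 0 = t \<and>
     (\<forall>z\<in>set tr. snd z = None) \<and> sum_list (map fst tr) \<le> 0"
    by (intro exI[of _ "[]"] exI[of _ s]) (simp add: run_refl)
qed

lemma ex_Seq:
  assumes "ex c t K t'" "ex d t' K' t''"
  shows "ex (Seq c d) t (K + K' + 1) t''"
proof (rule exI0)
  fix s :: store assume "s 0 = t"
  with assms(1) obtain tr s' where 1: "run c s tr Skip s'" "s' 0 = t'" "\<forall>z\<in>set tr. snd z = None"
    "sum_list (map fst tr) \<le> K" by (rule exD)
  from assms(2) 1(2) obtain tr' s'' where 2: "run d s' tr' Skip s''" "s'' 0 = t''"
    "\<forall>z\<in>set tr'. snd z = None" "sum_list (map fst tr') \<le> K'" by (rule exD)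
  have "run (Seq c d) s ((tr @ [(1, None)]) @ tr') Skip s''"
    using run_Seq_Skip[OF 1(1)] 2(1) run_trans by blast
  with 1 2 show "\<exists>tr s'. run (Seq c d) s tr Skip s' \<and> s' 0 = t'' \<and> (\<forall>z\<in>set tr. snd z = None)
      \<and> sum_list (map fst tr) \<le> K + K' + 1"
    by (intro exI[of _ "(tr @ [(1, None)]) @ tr'"] exI[of _ s'']) auto
qed

fun exp0 :: "exp \<Rightarrow> bool" where
  "exp0 (Var x) = (x = 0)"
| "exp0 LeafE = True"
| "exp0 (NodeE a b) = (exp0 a \<and> exp0 b)"
| "exp0 (Left a) = exp0 a"
| "exp0 (Right a) = exp0 a"
| "exp0 (Equal a b) = (exp0 a \<and> exp0 b)"

lemma exp0_eval: "exp0 e \<Longrightarrow> eval e s = eval e (\<lambda>_. s 0)"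
  by (induction e) auto

text \<open>Linear in the size \<open>n\<close> of the tree in variable 0, with factors that depend
  on \<open>e\<close> only. It also pays for the command that evaluates \<open>e\<close>.\<close>

definition ec :: "exp \<Rightarrow> nat \<Rightarrow> nat" where
  "ec e n = (2 * size e + 1) * (n + 2) + 1"

lemma ec_mono: "n \<le> m \<Longrightarrow> ec e n \<le> ec e m"
  unfolding ec_def by (intro add_mono mult_le_mono) auto

lemma exp0_cost: "exp0 e \<Longrightarrow> eval_cost e s + 1 \<le> ec e (size (s 0))"
  by (induction e) (auto simp: ec_def algebra_simps)

lemma ex_Assign:
  assumes "exp0 e"
  shows "ex (Assign 0 e) t (ec e (size t)) (eval e (\<lambda>_. t))"
proof (rule exI0)
  fix s :: store assume s: "s 0 = t"
  have "run (Assign 0 e) s [(1 + eval_cost e s, None)] Skip (s(0 := eval e s))"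
    using run_single[of "Assign 0 e" s] by auto
  then show "\<exists>tr s'. run (Assign 0 e) s tr Skip s' \<and> s' 0 = eval e (\<lambda>_. t) \<and>
     (\<forall>z\<in>set tr. snd z = None) \<and> sum_list (map fst tr) \<le> ec e (size t)"
    using exp0_cost[OF assms, of s] exp0_eval[OF assms, of s] s
    by (intro exI[of _ "[(1 + eval_cost e s, None)]"] exI[of _ "s(0 := eval e s)"]) auto
qed

lemma ex_pre_step:
  assumes "\<And>s. s 0 = t \<Longrightarrow> c \<noteq> Skip \<and> step c s = (c', s) \<and> step_output c s = None \<and> step_cost c s \<le> k"
    and "ex c' t K t'"
  shows "ex c t (K + k) t'"
proof (rule exI0)
  fix s :: store assume s: "s 0 = t"
  with assms(2) obtain tr s' where 1: "run c' s tr Skip s'" "s' 0 = t'"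
    "\<forall>z\<in>set tr. snd z = None" "sum_list (map fst tr) \<le> K" by (rule exD)
  have a: "c \<noteq> Skip \<and> step c s = (c', s) \<and> step_output c s = None \<and> step_cost c s \<le> k"
    using s by (rule assms(1))
  then have "run c s ((step_cost c s, step_output c s) # tr) Skip s'"
    using 1(1) run_step[of c s c' s tr Skip s'] by simp
  with 1 a show "\<exists>tr s'. run c s tr Skip s' \<and> s' 0 = t' \<and>
     (\<forall>z\<in>set tr. snd z = None) \<and> sum_list (map fst tr) \<le> K + k"
    by (intro exI[of _ "(step_cost c s, step_output c s) # tr"] exI[of _ s']) auto
qed

lemma ex_Cond:
  assumes "exp0 e" "ex (if eval e (\<lambda>_. t) \<noteq> Leaf then c else d) t K t'"
  shows "ex (Cond e c d) t (K + (ec e (size t))) t'"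
proof (rule ex_pre_step[OF _ assms(2)])
  fix s :: store assume "s 0 = t"
  then show "Cond e c d \<noteq> Skip \<and> step (Cond e c d) s = (if eval e (\<lambda>_. t) \<noteq> Leaf then c else d, s) \<and>
      step_output (Cond e c d) s = None \<and> step_cost (Cond e c d) s \<le> ec e (size t)"
    using exp0_cost[OF assms(1), of s] exp0_eval[OF assms(1), of s] by auto
qed

lemma ex_While_False:
  assumes "exp0 e" "eval e (\<lambda>_. t) = Leaf"
  shows "ex (While e c) t (ec e (size t) + 1) t"
proof -
  have "ex (Cond e (Seq c (While e c)) Skip) t (0 + (ec e (size t))) t"
    using assms by (intro ex_Cond) (auto intro: ex_Skip)
  from ex_pre_step[OF _ this, of "While e c" 1] show ?thesis by (simp add: add.commute)
qed

lemma ex_While_True: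
  assumes "exp0 e" "eval e (\<lambda>_. t) \<noteq> Leaf" "ex c t K t'" "ex (While e c) t' K' t''"
  shows "ex (While e c) t (K + K' + ec e (size t) + 2) t''"
proof -
  have "ex (Seq c (While e c)) t (K + K' + 1) t''" using assms(3,4) by (rule ex_Seq)
  then have "ex (Cond e (Seq c (While e c)) Skip) t ((K + K' + 1) + ec e (size t)) t''"
    using assms by (intro ex_Cond) auto
  then have "ex (While e c) t (K + K' + 1 + ec e (size t) + 1) t''"
    by (rule ex_pre_step[rotated]) auto
  then show ?thesis by simp
qed

lemma ex_size: "ex c t K t' \<Longrightarrow> size t' \<le> max (size t) K"
proof -
  assume a: "ex c t K t'"
  obtain tr s' where "run c (\<lambda>_. t) tr Skip s'" "s' 0 = t'" "sum_list (map fst tr) \<le> K"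
    by (rule exD[OF a, of "\<lambda>_. t"]) auto
  with run_size[of c "\<lambda>_. t" tr Skip s' 0] show ?thesis by auto
qed

section \<open>Polynomial-time functions on encodable types\<close>

text \<open>Injectivity is what lets the comparison of trees by \<open>Equal\<close> decide equality
  of values (\<open>PT_eq\<close>).\<close>

class tree_enc =
  fixes enc :: "'a \<Rightarrow> tree"
  assumes enc_inj: "enc a = enc b \<Longrightarrow> a = b"

lemma enc_eq_iff [simp]: "enc a = enc b \<longleftrightarrow> a = (b :: 'a :: tree_enc)"
  using enc_inj by blast

instantiation nat :: tree_enc
begin
definition "enc = enc_nat"
instance
proof
  fix a b :: nat
  have "enc_nat a = enc_nat b \<Longrightarrow> a = b"
  proof (induction a arbitrary: b)
    case 0 then show ?case by (cases b) auto
  next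
    case (Suc a) then show ?case by (cases b) auto
  qed
  then show "enc a = enc b \<Longrightarrow> a = b" by (simp add: enc_nat_def)
qed
end

instantiation bool :: tree_enc
begin
text \<open>Agrees with the truth values of the programs, so that a computed Boolean serves directly
  as a test.\<close>

definition "enc b = (if b then Node Leaf Leaf else Leaf)"
instance by standard (auto simp: enc_bool_def split: if_splits)
end

instantiation prod :: (tree_enc, tree_enc) tree_enc
begin
definition "enc p = Node (enc (fst p)) (enc (snd p))"
instance by standard (auto simp: enc_prod_def prod_eq_iff)
end

instantiation list :: (tree_enc) tree_enc
begin
primrec enc_list where
  "enc_list [] = Leaf"
| "enc_list (x # xs) = Node (enc x) (enc_list xs)"
instance
proof
  fix a b :: "'a list"
  show "enc a = enc b \<Longrightarrow> a = b"
  proof (induction a arbitrary: b)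
    case Nil then show ?case by (cases b) auto
  next
    case (Cons x a) then show ?case by (cases b) auto
  qed
qed
end

lemma enc_pair [simp]: "enc (a, b) = Node (enc a) (enc b)"
  by (simp add: enc_prod_def)

lemma enc_True [simp]: "enc True = Node Leaf Leaf" and enc_False [simp]: "enc False = Leaf"
  by (auto simp: enc_bool_def)

lemma enc_edges_eq: "enc_edges es = enc es"
  by (induction es rule: enc_edges.induct) (auto simp: enc_nat_def)

text \<open>The coefficients are natural numbers. Time bounds may therefore be estimated by
  enlarging their arguments.\<close>

lemma poly_nat_mono: "a \<le> b \<Longrightarrow> poly p a \<le> poly (p :: nat poly) b"
  by (induction p) (auto intro!: add_mono mult_mono)

definition pb :: "(nat \<Rightarrow> nat) \<Rightarrow> bool" where
  "pb B \<longleftrightarrow> (\<exists>p. B = poly p)"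

lemma pb_mono: "pb B \<Longrightarrow> a \<le> b \<Longrightarrow> B a \<le> B b"
  by (auto simp: pb_def poly_nat_mono)

lemma pb_const: "pb (\<lambda>n. c)"
  unfolding pb_def by (rule exI[of _ "[:c:]"]) auto

lemma pb_id: "pb (\<lambda>n. n)"
  unfolding pb_def by (rule exI[of _ "[:0, 1:]"]) auto

lemma pb_add: "pb f \<Longrightarrow> pb g \<Longrightarrow> pb (\<lambda>n. f n + g n)"
  unfolding pb_def by (elim exE, rule_tac x = "p + pa" in exI) (simp add: fun_eq_iff)

lemma pb_mult: "pb f \<Longrightarrow> pb g \<Longrightarrow> pb (\<lambda>n. f n * g n)"
  unfolding pb_def by (elim exE, rule_tac x = "p * pa" in exI) (simp add: fun_eq_iff)

lemma pb_comp: "pb f \<Longrightarrow> pb g \<Longrightarrow> pb (\<lambda>n. f (g n))"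
  unfolding pb_def by (elim exE, rule_tac x = "pcompose p pa" in exI) (simp add: fun_eq_iff poly_pcompose)

lemma pb_Suc: "pb f \<Longrightarrow> pb (\<lambda>n. Suc (f n))"
  using pb_add[OF _ pb_const[of 1]] by simp

lemma pb_ec: "pb f \<Longrightarrow> pb (\<lambda>n. ec e (f n))"
  unfolding ec_def by (intro pb_add pb_mult pb_const)

lemmas pb_intros = pb_const pb_id pb_add pb_mult pb_Suc pb_ec

text \<open>
  The argument of a function sits on top of a stack of saved values that the program must leave
  alone; composing programs then needs no renaming of variables.
\<close>

definition PT :: "('a :: tree_enc \<Rightarrow> 'b :: tree_enc) \<Rightarrow> bool" where
  "PT f \<longleftrightarrow> (\<exists>c B. pb B \<and>
     (\<forall>a k. ex c (Node (enc a) k) (B (size (enc a) + size k)) (Node (enc (f a)) k)))"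

lemma PTI:
  assumes "pb B" "\<And>a k. ex c (Node (enc a) k) (B (size (enc a) + size k)) (Node (enc (f a)) k)"
  shows "PT f"
  unfolding PT_def using assms by blast

lemma PTE:
  assumes "PT f"
  obtains B c where "pb B"
    "\<forall>a k. ex c (Node (enc a) k) (B (size (enc a) + size k)) (Node (enc (f a)) k)"
proof -
  from assms obtain c B where "pb B"
    "\<forall>a k. ex c (Node (enc a) k) (B (size (enc a) + size k)) (Node (enc (f a)) k)"
    unfolding PT_def by (elim exE conjE)
  then show ?thesis by (rule that)
qed

text \<open>A result is either part of the input or was paid for when it was written. Composition
  needs this bound for the intermediate value.\<close>

lemma PT_size:
  assumes "PT f"
  obtains q where "pb q" "\<forall>a. size (enc (f a)) \<le> q (size (enc a))"
proof -
  from assms obtain B c where B: "pb B"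
    "\<forall>a k. ex c (Node (enc a) k) (B (size (enc a) + size k)) (Node (enc (f a)) k)" by (rule PTE)
  have "size (enc (f a)) \<le> size (enc a) + 1 + B (size (enc a))" for a
    using ex_size[OF B(2)[rule_format, of a Leaf]] by auto
  moreover have "pb (\<lambda>n. n + 1 + B n)" using B(1) by (intro pb_intros)
  ultimately show ?thesis using that by blast
qed

lemma PT_Assign:
  assumes "exp0 e" "\<And>a k. eval e (\<lambda>_. Node (enc a) k) = Node (enc (f a)) k"
  shows "PT f"
proof (rule PTI)
  show "pb (\<lambda>n. ec e (n + 1))" by (intro pb_intros)
  show "ex (Assign 0 e) (Node (enc a) k) (ec e (size (enc a) + size k + 1)) (Node (enc (f a)) k)"
    for a k using ex_Assign[OF assms(1), of "Node (enc a) k"] assms(2)[of a k] by simp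
qed

lemma PT_id: "PT (\<lambda>x. x)"
  by (rule PT_Assign[of "Var 0"]) auto

fun quote :: "tree \<Rightarrow> exp" where
  "quote Leaf = LeafE"
| "quote (Node l r) = NodeE (quote l) (quote r)"

lemma quote_simps [simp]: "exp0 (quote t)" "eval (quote t) s = t"
  by (induction t) auto

lemma PT_const: "PT (\<lambda>x. c)"
  by (rule PT_Assign[of "NodeE (quote (enc c)) (Right (Var 0))"]) auto

lemma PT_comp:
  fixes f :: "'b :: tree_enc \<Rightarrow> 'c :: tree_enc" and g :: "'a :: tree_enc \<Rightarrow> 'b"
  assumes "PT f" "PT g"
  shows "PT (\<lambda>x. f (g x))"
proof -
  from assms(1) obtain B c where B: "pb B"
    "\<forall>a k. ex c (Node (enc a) k) (B (size (enc a) + size k)) (Node (enc (f a)) k)" by (rule PTE)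
  from assms(2) obtain C d where C: "pb C"
    "\<forall>a k. ex d (Node (enc a) k) (C (size (enc a) + size k)) (Node (enc (g a)) k)" by (rule PTE)
  from assms(2) obtain q where q: "pb q" "\<forall>a. size (enc (g a)) \<le> q (size (enc a))" by (rule PT_size)
  show ?thesis
  proof (rule PTI)
    show "pb (\<lambda>n. C n + B (q n + n) + 1)"
      by (intro pb_intros pb_comp[OF B(1)] pb_comp[OF C(1)] pb_comp[OF q(1)])
    fix a :: 'a and k :: tree
    have "size (enc (g a)) + size k \<le> q (size (enc a) + size k) + (size (enc a) + size k)"
      using q(2)[rule_format, of a] pb_mono[OF q(1), of "size (enc a)" "size (enc a) + size k"] by linarith
    then have "B (size (enc (g a)) + size k) \<le> B (q (size (enc a) + size k) + (size (enc a) + size k))"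
      by (rule pb_mono[OF B(1)])
    then show "ex (Seq d c) (Node (enc a) k) (C (size (enc a) + size k) +
        B (q (size (enc a) + size k) + (size (enc a) + size k)) + 1) (Node (enc (f (g a))) k)"
      by (intro ex_mono[OF ex_Seq[OF C(2)[rule_format, of a k] B(2)[rule_format, of "g a" k]]]) linarith
  qed
qed

lemma ex_Seq_Assign:
  assumes "exp0 e" "eval e (\<lambda>_. t) = t'" "ex d t' K t''"
  shows "ex (Seq (Assign 0 e) d) t (ec e (size t) + K + 1) t''"
  using ex_Seq[OF ex_Assign[OF assms(1), of t]] assms(2,3) by auto

text \<open>The argument is duplicated, and \<open>f\<close> works on the upper copy while the lower
  one belongs to the protected stack. A swap brings the lower copy up for \<open>g\<close>, with the
  result of \<open>f\<close> saved beneath it.\<close>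

lemma PT_pair:
  fixes f :: "'a :: tree_enc \<Rightarrow> 'c :: tree_enc" and g :: "'a :: tree_enc \<Rightarrow> 'b :: tree_enc"
  assumes "PT f" "PT g"
  shows "PT (\<lambda>x. (f x, g x))"
proof -
  from assms(1) obtain B c where B: "pb B"
    "\<forall>a k. ex c (Node (enc a) k) (B (size (enc a) + size k)) (Node (enc (f a)) k)" by (rule PTE)
  from assms(2) obtain C d where C: "pb C"
    "\<forall>a k. ex d (Node (enc a) k) (C (size (enc a) + size k)) (Node (enc (g a)) k)" by (rule PTE)
  from assms(1) obtain q where q: "pb q" "\<forall>a. size (enc (f a)) \<le> q (size (enc a))" by (rule PT_size)
  from assms(2) obtain q' where q': "pb q'" "\<forall>a. size (enc (g a)) \<le> q' (size (enc a))" by (rule PT_size)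
  define dup where "dup = NodeE (Left (Var 0)) (Var 0)"
  define swap where "swap = NodeE (Left (Right (Var 0))) (NodeE (Left (Var 0)) (Right (Right (Var 0))))"
  define join where "join = NodeE (NodeE (Left (Right (Var 0))) (Left (Var 0))) (Right (Right (Var 0)))"
  let ?K = "\<lambda>n. ec dup (n + 1) + (B (2 * n + 1) + (ec swap (q n + n + 2) +
      (C (n + q n + 1) + ec join (q n + q' n + n + 2) + 1) + 1) + 1) + 1"
  show ?thesis
  proof (rule PTI)
    show "pb ?K"
      by (intro pb_intros pb_comp[OF B(1)] pb_comp[OF C(1)] pb_comp[OF q(1)] pb_comp[OF q'(1)])
    fix a :: 'a and k :: tree
    define n where "n = size (enc a) + size k"
    have m: "size (enc (f a)) \<le> q n" "size (enc (g a)) \<le> q' n" "size (enc a) \<le> n" "size k \<le> n"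
      using q(2)[rule_format, of a] pb_mono[OF q(1), of "size (enc a)" n] q'(2)[rule_format, of a] pb_mono[OF q'(1), of "size (enc a)" n]
      unfolding n_def by linarith+
    have 5: "ex (Assign 0 join) (Node (enc (g a)) (Node (enc (f a)) k)) (ec join (q n + q' n + n + 2)) (Node (enc (f a, g a)) k)"
      using ex_Assign[of join "Node (enc (g a)) (Node (enc (f a)) k)"] ec_mono[of "size (Node (enc (g a)) (Node (enc (f a)) k))" "q n + q' n + n + 2" join] m
      by (auto elim!: ex_mono simp: join_def)
    have "size (enc a) + size (Node (enc (f a)) k) \<le> n + q n + 1" using m unfolding n_def by simp
    from ex_mono[OF C(2)[rule_format, of a "Node (enc (f a)) k"] pb_mono[OF C(1) this]]
    have 4: "ex d (Node (enc a) (Node (enc (f a)) k)) (C (n + q n + 1)) (Node (enc (g a)) (Node (enc (f a)) k))" .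
    have e: "ec swap (size (Node (enc (f a)) (Node (enc a) k))) \<le> ec swap (q n + n + 2)"
      by (rule ec_mono) (use m in \<open>simp add: n_def\<close>)
    have 3: "ex (Seq (Assign 0 swap) (Seq d (Assign 0 join))) (Node (enc (f a)) (Node (enc a) k))
        (ec swap (q n + n + 2) + (C (n + q n + 1) + ec join (q n + q' n + n + 2) + 1) + 1) (Node (enc (f a, g a)) k)"
      by (rule ex_mono[OF ex_Seq_Assign[OF _ _ ex_Seq[OF 4 5]]]) (use e in \<open>simp_all add: swap_def\<close>)
    have "size (enc a) + size (Node (enc a) k) \<le> 2 * n + 1" unfolding n_def by simp
    from ex_mono[OF B(2)[rule_format, of a "Node (enc a) k"] pb_mono[OF B(1) this]]
    have 2: "ex c (Node (enc a) (Node (enc a) k)) (B (2 * n + 1)) (Node (enc (f a)) (Node (enc a) k))" .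
    show "ex (Seq (Assign 0 dup) (Seq c (Seq (Assign 0 swap) (Seq d (Assign 0 join))))) (Node (enc a) k)
      (?K (size (enc a) + size k)) (Node (enc (f a, g a)) k)"
      unfolding n_def[symmetric]
      by (rule ex_mono[OF ex_Seq_Assign[OF _ _ ex_Seq[OF 2 3]]]) (simp_all add: dup_def n_def)
  qed
qed

lemma PT_fst0: "PT fst"
  by (rule PT_Assign[of "NodeE (Left (Left (Var 0))) (Right (Var 0))"]) (auto simp: enc_prod_def)

lemma PT_snd0: "PT snd"
  by (rule PT_Assign[of "NodeE (Right (Left (Var 0))) (Right (Var 0))"]) (auto simp: enc_prod_def)

lemma PT_comp2:
  assumes "PT (\<lambda>x. f (fst x) (snd x))" "PT a" "PT b"
  shows "PT (\<lambda>x. f (a x) (b x))"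
  using PT_comp[OF assms(1) PT_pair[OF assms(2,3)]] by simp

lemma PT_fst: "PT f \<Longrightarrow> PT (\<lambda>x. fst (f x))" and PT_snd: "PT f \<Longrightarrow> PT (\<lambda>x. snd (f x))"
  using PT_comp[OF PT_fst0] PT_comp[OF PT_snd0] by auto

lemma PT_eq:
  fixes f g :: "'a :: tree_enc \<Rightarrow> 'b :: tree_enc"
  assumes "PT f" "PT g"
  shows "PT (\<lambda>x. f x = g x)"
proof (rule PT_comp2[of "(=)", OF _ assms])
  show "PT (\<lambda>x :: 'b \<times> 'b. fst x = snd x)"
    by (rule PT_Assign[of "NodeE (Equal (Left (Left (Var 0))) (Right (Left (Var 0)))) (Right (Var 0))"])
      (auto simp: enc_prod_def)
qed

lemma PT_Cons:
  fixes f :: "'a :: tree_enc \<Rightarrow> 'b :: tree_enc"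
  assumes "PT f" "PT g"
  shows "PT (\<lambda>x. f x # g x)"
proof (rule PT_comp2[of "(#)", OF _ assms])
  show "PT (\<lambda>x :: 'b \<times> 'b list. fst x # snd x)"
    by (rule PT_Assign[of "Var 0"]) (auto simp: enc_prod_def)
qed

lemma PT_if:
  fixes f :: "'a :: tree_enc \<Rightarrow> 'c :: tree_enc"
  assumes "PT b" "PT f" "PT g"
  shows "PT (\<lambda>x. if b x then f x else g x)"
proof -
  from assms(2) obtain B c where B: "pb B"
    "\<forall>a k. ex c (Node (enc a) k) (B (size (enc a) + size k)) (Node (enc (f a)) k)" by (rule PTE)
  from assms(3) obtain C d where C: "pb C"
    "\<forall>a k. ex d (Node (enc a) k) (C (size (enc a) + size k)) (Node (enc (g a)) k)" by (rule PTE)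
  define pop where "pop = NodeE (Right (Left (Var 0))) (Right (Var 0))"
  define tst where "tst = Left (Left (Var 0))"
  let ?h = "\<lambda>z :: bool \<times> 'a. if fst z then f (snd z) else g (snd z)"
  let ?K = "\<lambda>n. (ec pop (n + 1) + (B n + C n) + 1) + ec tst (n + 1)"
  let ?c = "Cond tst (Seq (Assign 0 pop) c) (Seq (Assign 0 pop) d)"
  have "PT ?h"
  proof (rule PTI)
    show "pb ?K" by (intro pb_intros pb_comp[OF B(1)] pb_comp[OF C(1)])
    fix z :: "bool \<times> 'a" and k :: tree
    obtain b a where z: "z = (b, a)" by (cases z)
    define n where "n = size (enc z) + size k"
    have "ex (if b then c else d) (Node (enc a) k) (B n + C n) (Node (enc (?h z)) k)"
    proof (cases b)
      case True
      then show ?thesis using B(2)[rule_format, of a k] pb_mono[OF B(1), of "size (enc a) + size k" n] z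
        by (auto elim!: ex_mono simp: n_def)
    next
      case False
      then show ?thesis using C(2)[rule_format, of a k] pb_mono[OF C(1), of "size (enc a) + size k" n] z
        by (auto elim!: ex_mono simp: n_def)
    qed
    from ex_Seq_Assign[OF _ _ this, of pop "Node (enc z) k"]
    have "ex (if b then Seq (Assign 0 pop) c else Seq (Assign 0 pop) d) (Node (enc z) k)
      (ec pop (n + 1) + (B n + C n) + 1) (Node (enc (?h z)) k)" by (cases b) (simp_all add: z pop_def n_def)
    then have "ex (if eval tst (\<lambda>_. Node (enc z) k) \<noteq> Leaf then Seq (Assign 0 pop) c else Seq (Assign 0 pop) d) (Node (enc z) k)
      (ec pop (n + 1) + (B n + C n) + 1) (Node (enc (?h z)) k)"
      by (cases b) (simp_all add: z tst_def)
    then have "ex ?c (Node (enc z) k) ((ec pop (n + 1) + (B n + C n) + 1) + ec tst (size (Node (enc z) k)))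
      (Node (enc (?h z)) k)" by (rule ex_Cond[rotated]) (simp add: tst_def)
    then show "ex ?c (Node (enc z) k) (?K (size (enc z) + size k)) (Node (enc (?h z)) k)"
      by (simp add: n_def)
  qed
  from PT_comp[OF this PT_pair[OF assms(1) PT_id]] show ?thesis by (simp only: fst_conv snd_conv)
qed

lemma PT_case_list:
  fixes l :: "'a :: tree_enc \<Rightarrow> 'b :: tree_enc list" and a :: "'a \<Rightarrow> 'c :: tree_enc"
  assumes "PT l" "PT a" "PT (\<lambda>z. b (fst z) (fst (snd z)) (snd (snd z)))"
  shows "PT (\<lambda>x. case l x of [] \<Rightarrow> a x | y # ys \<Rightarrow> b x y ys)"
proof -
  from assms(2) obtain B c where B: "pb B"
    "\<forall>x k. ex c (Node (enc x) k) (B (size (enc x) + size k)) (Node (enc (a x)) k)" by (rule PTE)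
  from assms(3) obtain C d where C: "pb C"
    "\<forall>z k. ex d (Node (enc z) k) (C (size (enc z) + size k)) (Node (enc (b (fst z) (fst (snd z)) (snd (snd z)))) k)"
    by (rule PTE)
  define pop where "pop = NodeE (Left (Left (Var 0))) (Right (Var 0))"
  define tst where "tst = Right (Left (Var 0))"
  let ?h = "\<lambda>z. case snd z of [] \<Rightarrow> a (fst z) | y # ys \<Rightarrow> b (fst z) y ys"
  let ?K = "\<lambda>n. (ec pop (n + 1) + (B n + C n) + 1) + ec tst (n + 1)"
  let ?c = "Cond tst d (Seq (Assign 0 pop) c)"
  have "PT ?h"
  proof (rule PTI)
    show "pb ?K" by (intro pb_intros pb_comp[OF B(1)] pb_comp[OF C(1)])
    fix z :: "'a \<times> 'b list" and k :: tree
    obtain x l where z: "z = (x, l)" by (cases z)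
    define n where "n = size (enc z) + size k"
    have "ex (if l \<noteq> [] then d else Seq (Assign 0 pop) c) (Node (enc z) k)
      (ec pop (n + 1) + (B n + C n) + 1) (Node (enc (?h z)) k)"
    proof (cases l)
      case Nil
      have "ex c (Node (enc x) k) (B n + C n) (Node (enc (?h z)) k)"
        using B(2)[rule_format, of x k] pb_mono[OF B(1), of "size (enc x) + size k" n] z Nil
        by (auto elim!: ex_mono simp: n_def)
      from ex_Seq_Assign[OF _ _ this, of pop "Node (enc z) k"]
      show ?thesis by (simp add: z Nil pop_def n_def)
    next
      case (Cons y ys)
      \<comment> \<open>The pairs \<open>(x, y # ys)\<close> and \<open>(x, (y, ys))\<close> have
        the same encoding, so the program for \<open>b\<close> can start without any
        rearrangement.\<close>
      then show ?thesis using C(2)[rule_format, of "(x, (y, ys))" k] by (auto elim!: ex_mono simp: z n_def)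
    qed
    then have "ex (if eval tst (\<lambda>_. Node (enc z) k) \<noteq> Leaf then d else Seq (Assign 0 pop) c) (Node (enc z) k)
      (ec pop (n + 1) + (B n + C n) + 1) (Node (enc (?h z)) k)"
      by (cases l) (simp_all add: z tst_def)
    then have "ex ?c (Node (enc z) k) ((ec pop (n + 1) + (B n + C n) + 1) + ec tst (size (Node (enc z) k)))
      (Node (enc (?h z)) k)" by (rule ex_Cond[rotated]) (simp add: tst_def)
    then show "ex ?c (Node (enc z) k) (?K (size (enc z) + size k)) (Node (enc (?h z)) k)"
      by (simp add: n_def)
  qed
  from PT_comp[OF this PT_pair[OF PT_id assms(1)]] show ?thesis by (simp only: fst_conv snd_conv)
qed


section \<open>Folds over lists, and the polynomial-time list functions obtained from them\<close>

lemma size_enc_append: "size (enc (xs @ ys)) = size (enc xs) + size (enc ys)"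
  by (induction xs) auto

lemma length_le_enc: "length xs \<le> size (enc xs)"
  by (induction xs) auto

lemma size_enc_mem: "x \<in> set xs \<Longrightarrow> size (enc x) < size (enc xs)"
  by (induction xs) auto

text \<open>Iterating a polynomial-time step could square the size in every round, so all partial
  results have to obey the polynomial bound \<open>Q\<close>. The loop holds the environment, the
  rest of the list and the accumulator on top of the stack.\<close>

lemma PT_foldl:
  fixes f :: "'e :: tree_enc \<Rightarrow> 'a :: tree_enc \<Rightarrow> 'x :: tree_enc \<Rightarrow> 'a"
  assumes f: "PT (\<lambda>z. f (fst z) (snd (snd z)) (fst (snd z)))" and i: "PT i" and l: "PT l"
    and Q: "pb Q" "\<And>e xs ys. l e = xs @ ys \<Longrightarrow> size (enc (foldl (f e) (i e) xs)) \<le> Q (size (enc e))"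
  shows "PT (\<lambda>e. foldl (f e) (i e) (l e))"
proof -
  from f obtain B c where B: "pb B" "\<forall>z k. ex c (Node (enc z) k) (B (size (enc z) + size k))
      (Node (enc (f (fst z) (snd (snd z)) (fst (snd z)))) k)" by (rule PTE)
  have "PT (\<lambda>e. (e, (l e, i e)))" by (intro PT_pair PT_id i l)
  then obtain C d where C: "pb C" "\<forall>e k. ex d (Node (enc e) k) (C (size (enc e) + size k))
      (Node (enc (e, (l e, i e))) k)" by (rule PTE)
  from l obtain L where L: "pb L" "\<forall>e. size (enc (l e)) \<le> L (size (enc e))" by (rule PT_size)
  define tst where "tst = Left (Right (Left (Var 0)))"
  define sh where "sh = NodeE (NodeE (Left (Left (Var 0))) (NodeE (Left tst) (Right (Right (Left (Var 0))))))
    (NodeE (NodeE (Left (Left (Var 0))) (Right tst)) (Right (Var 0)))"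
  define un where "un = NodeE (NodeE (Left (Left (Right (Var 0))))
    (NodeE (Right (Left (Right (Var 0)))) (Left (Var 0)))) (Right (Right (Var 0)))"
  define fin where "fin = NodeE (Right (Right (Left (Var 0)))) (Right (Var 0))"
  define body where "body = Seq (Assign 0 sh) (Seq c (Assign 0 un))"
  define M where "M n = 3 * n + L n + Q n + 10" for n
  define K1 where "K1 n = ec sh (M n) + (B (M n) + ec un (M n) + 1) + 1 + ec tst (M n) + 2" for n
  show ?thesis
  proof (rule PTI)
    show "pb (\<lambda>n. C n + ((L n * K1 n + ec tst (M n) + 1) + ec fin (M n) + 1) + 1)"
      unfolding M_def K1_def
      by (intro pb_intros pb_comp[OF B(1)] pb_comp[OF C(1)] pb_comp[OF L(1)] pb_comp[OF Q(1)])
    fix e :: 'e and k :: tree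
    define n where "n = size (enc e) + size k"
    have n: "size (enc e) \<le> n" "size k \<le> n" by (auto simp: n_def)
    have Ln: "size (enc (l e)) \<le> L n" using L(2)[rule_format, of e] pb_mono[OF L(1) n(1)] by linarith
    have Qn: "size (enc (foldl (f e) (i e) xs)) \<le> Q n" if "l e = xs @ ys" for xs ys
      using Q(2)[OF that] pb_mono[OF Q(1) n(1)] by linarith
    have loop: "ex (While tst body) (Node (Node (enc e) (Node (enc ys) (enc (foldl (f e) (i e) xs)))) k)
        (length ys * K1 n + ec tst (M n) + 1) (Node (Node (enc e) (Node Leaf (enc (foldl (f e) (i e) (l e))))) k)"
      if "l e = xs @ ys" for xs ys
      using that
    proof (induction ys arbitrary: xs)
      case Nil
      let ?t = "Node (Node (enc e) (Node Leaf (enc (foldl (f e) (i e) (l e))))) k"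
      have "ec tst (size ?t) \<le> ec tst (M n)"
        by (rule ec_mono) (use Nil Qn[of "l e" "[]"] n in \<open>simp add: M_def\<close>)
      then show ?case
        using ex_mono[OF ex_While_False[of tst ?t body], of "ec tst (M n) + 1"] Nil by (simp add: tst_def)
    next
      case (Cons y ys)
      let ?a = "foldl (f e) (i e) xs" and ?a' = "foldl (f e) (i e) (xs @ [y])"
      let ?t = "Node (Node (enc e) (Node (enc (y # ys)) (enc ?a))) k"
      let ?t1 = "Node (enc (e, (y, ?a))) (Node (Node (enc e) (enc ys)) k)"
      let ?t2 = "Node (enc ?a') (Node (Node (enc e) (enc ys)) k)"
      let ?t3 = "Node (Node (enc e) (Node (enc ys) (enc ?a'))) k"
      have sz: "size (enc y) + size (enc ys) + 1 \<le> L n" using Ln Cons.prems by (simp add: size_enc_append)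
      have q: "size (enc ?a) \<le> Q n" "size (enc ?a') \<le> Q n" using Qn[of xs "y # ys"] Qn[of "xs @ [y]" ys] Cons.prems by auto
      have m: "size ?t \<le> M n" "size (enc (e, (y, ?a))) + size (Node (Node (enc e) (enc ys)) k) \<le> M n" "size ?t2 \<le> M n"
        using sz q n by (auto simp: M_def)
      have 3: "ex (Assign 0 un) ?t2 (ec un (M n)) ?t3"
        using ex_mono[OF ex_Assign[of un ?t2] ec_mono[OF m(3)]] by (simp add: un_def)
      have 2: "ex c ?t1 (B (M n)) ?t2"
        using ex_mono[OF B(2)[rule_format, of "(e, (y, ?a))"] pb_mono[OF B(1) m(2)]] by simp
      have 1: "ex body ?t (ec sh (M n) + (B (M n) + ec un (M n) + 1) + 1) ?t3"
        unfolding body_def using ec_mono[OF m(1), of sh]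
        by (intro ex_mono[OF ex_Seq_Assign[OF _ _ ex_Seq[OF 2 3]]]) (simp_all add: sh_def tst_def)
      have 4: "ex (While tst body) ?t3 (length ys * K1 n + ec tst (M n) + 1) (Node (Node (enc e) (Node Leaf (enc (foldl (f e) (i e) (l e))))) k)"
        using Cons.IH[of "xs @ [y]"] Cons.prems by simp
      have "exp0 tst" "eval tst (\<lambda>_. ?t) \<noteq> Leaf" by (auto simp: tst_def)
      from ex_mono[OF ex_While_True[OF this 1 4]] show ?case
        using ec_mono[OF m(1), of tst] by (simp add: K1_def)
    qed
    have len: "length (l e) \<le> L n" using length_le_enc[of "l e"] Ln by linarith
    let ?t = "Node (Node (enc e) (Node Leaf (enc (foldl (f e) (i e) (l e))))) k"
    have "ec fin (size ?t) \<le> ec fin (M n)"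
      by (rule ec_mono) (use Qn[of "l e" "[]"] n in \<open>simp add: M_def\<close>)
    then have "ex (Assign 0 fin) ?t (ec fin (M n)) (Node (enc (foldl (f e) (i e) (l e))) k)"
      using ex_mono[OF ex_Assign[of fin ?t]] by (simp add: fin_def)
    from ex_Seq[OF loop[of "[]" "l e"] this]
    have 5: "ex (Seq (While tst body) (Assign 0 fin)) (Node (enc (e, (l e, i e))) k)
      ((length (l e) * K1 n + ec tst (M n) + 1) + ec fin (M n) + 1) (Node (enc (foldl (f e) (i e) (l e))) k)"
      by simp
    have "length (l e) * K1 n \<le> L n * K1 n" using len by simp
    then show "ex (Seq d (Seq (While tst body) (Assign 0 fin))) (Node (enc e) k)
      (C (size (enc e) + size k) + ((L (size (enc e) + size k) * K1 (size (enc e) + size k) +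
        ec tst (M (size (enc e) + size k)) + 1) + ec fin (M (size (enc e) + size k)) + 1) + 1)
      (Node (enc (foldl (f e) (i e) (l e))) k)"
      unfolding n_def[symmetric]
      by (intro ex_mono[OF ex_Seq[OF C(2)[rule_format, of e k] 5]]) (simp add: n_def)
  qed
qed

lemma PT_not: "PT a \<Longrightarrow> PT (\<lambda>x. \<not> a x)"
proof -
  have "(\<lambda>x. \<not> a x) = (\<lambda>x. if a x then False else True)" by auto
  then show "PT a \<Longrightarrow> ?thesis" by (simp only: PT_if PT_const)
qed

lemma PT_conj: "PT a \<Longrightarrow> PT b \<Longrightarrow> PT (\<lambda>x. a x \<and> b x)"
proof -
  have "(\<lambda>x. a x \<and> b x) = (\<lambda>x. if a x then b x else False)" by auto
  then show "PT a \<Longrightarrow> PT b \<Longrightarrow> ?thesis" by (simp only: PT_if PT_const)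
qed

lemma PT_disj: "PT a \<Longrightarrow> PT b \<Longrightarrow> PT (\<lambda>x. a x \<or> b x)"
proof -
  have "(\<lambda>x. a x \<or> b x) = (\<lambda>x. if a x then True else b x)" by auto
  then show "PT a \<Longrightarrow> PT b \<Longrightarrow> ?thesis" by (simp only: PT_if PT_const)
qed

lemma PT_imp: "PT a \<Longrightarrow> PT b \<Longrightarrow> PT (\<lambda>x. a x \<longrightarrow> b x)"
proof -
  have "(\<lambda>x. a x \<longrightarrow> b x) = (\<lambda>x. if a x then b x else True)" by auto
  then show "PT a \<Longrightarrow> PT b \<Longrightarrow> ?thesis" by (simp only: PT_if PT_const)
qed

lemma size_enc_bool: "size (enc (b :: bool)) \<le> 1"
  by (simp add: enc_bool_def)

lemma PT_Bex:
  fixes P :: "'e :: tree_enc \<Rightarrow> 'x :: tree_enc \<Rightarrow> bool"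
  assumes P: "PT (\<lambda>z. P (fst z) (snd z))" and l: "PT l"
  shows "PT (\<lambda>e. \<exists>x\<in>set (l e). P e x)"
proof -
  have eq: "foldl (\<lambda>b x. b \<or> P e x) b xs = (b \<or> (\<exists>x\<in>set xs. P e x))" for e b xs
    by (induction xs arbitrary: b) auto
  have "PT (\<lambda>e. foldl (\<lambda>b x. b \<or> P e x) False (l e))"
  proof (rule PT_foldl[where Q = "\<lambda>n. 1"])
    show "PT (\<lambda>z. snd (snd z) \<or> P (fst z) (fst (snd z)))"
      by (intro PT_disj PT_comp2[OF P] PT_fst PT_snd PT_id)
  qed (use size_enc_bool in \<open>auto intro: PT_const l pb_intros\<close>)
  then show ?thesis by (simp add: eq)
qed

lemma PT_Ball:
  fixes P :: "'e :: tree_enc \<Rightarrow> 'x :: tree_enc \<Rightarrow> bool"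
  assumes P: "PT (\<lambda>z. P (fst z) (snd z))" and l: "PT l"
  shows "PT (\<lambda>e. \<forall>x\<in>set (l e). P e x)"
  using PT_not[OF PT_Bex[of "\<lambda>e x. \<not> P e x", OF PT_not[OF P] l]] by simp

lemma PT_mem: "PT a \<Longrightarrow> PT l \<Longrightarrow> PT (\<lambda>e. a e \<in> set (l e))"
proof -
  assume a: "PT a" and l: "PT l"
  have "PT (\<lambda>e. \<exists>x\<in>set (l e). x = a e)"
    by (rule PT_Bex) (intro PT_eq PT_snd PT_id PT_comp[OF a] PT_fst l)+
  then show ?thesis by simp
qed

lemma PT_rev: assumes "PT l" shows "PT (\<lambda>e. rev (l e))"
proof -
  have eq: "foldl (\<lambda>acc x. x # acc) b xs = rev xs @ b" for b and xs :: "'b list"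
    by (induction xs arbitrary: b) auto
  have sz: "size (enc (rev xs)) = size (enc xs)" for xs :: "'b list"
    by (induction xs) (auto simp: size_enc_append)
  from assms obtain L where L: "pb L" "\<forall>e. size (enc (l e)) \<le> L (size (enc e))" by (rule PT_size)
  have "PT (\<lambda>e. foldl (\<lambda>acc x. x # acc) [] (l e))"
  proof (rule PT_foldl[where Q = L])
    show "size (enc (foldl (\<lambda>acc x. x # acc) [] xs)) \<le> L (size (enc e))" if "l e = xs @ ys" for e xs ys
      using L(2)[rule_format, of e] that by (simp add: eq sz size_enc_append)
  qed (intro PT_Cons PT_fst PT_snd PT_id PT_const assms L(1))+
  then show ?thesis by (simp add: eq)
qed

lemma PT_append: assumes "PT a" "PT b" shows "PT (\<lambda>e. a e @ b e)"
proof -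
  have eq: "foldl (\<lambda>acc x. x # acc) b xs = rev xs @ b" for b and xs :: "'b list"
    by (induction xs arbitrary: b) auto
  from PT_rev[OF assms(1)] obtain L where L: "pb L" "\<forall>e. size (enc (rev (a e))) \<le> L (size (enc e))" by (rule PT_size)
  from assms(2) obtain L' where L': "pb L'" "\<forall>e. size (enc (b e)) \<le> L' (size (enc e))" by (rule PT_size)
  have sz: "size (enc (rev xs)) = size (enc xs)" for xs :: "'b list"
    by (induction xs) (auto simp: size_enc_append)
  have "PT (\<lambda>e. foldl (\<lambda>acc x. x # acc) (b e) (rev (a e)))"
  proof (rule PT_foldl[where Q = "\<lambda>n. L n + L' n"])
    show "size (enc (foldl (\<lambda>acc x. x # acc) (b e) xs)) \<le> L (size (enc e)) + L' (size (enc e))"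
      if "rev (a e) = xs @ ys" for e xs ys
      using L(2)[rule_format, of e] L'(2)[rule_format, of e] unfolding that by (simp add: eq sz size_enc_append)
  qed (intro PT_Cons PT_fst PT_snd PT_id PT_rev assms pb_add L(1) L'(1))+
  then show ?thesis by (simp add: eq)
qed

lemma size_enc_filter: "size (enc (filter P xs)) \<le> size (enc xs)"
  by (induction xs) auto

lemma PT_filter:
  fixes P :: "'e :: tree_enc \<Rightarrow> 'x :: tree_enc \<Rightarrow> bool"
  assumes P: "PT (\<lambda>z. P (fst z) (snd z))" and l: "PT l"
  shows "PT (\<lambda>e. filter (P e) (l e))"
proof -
  have eq: "foldl (\<lambda>acc x. if P e x then x # acc else acc) b xs = rev (filter (P e) xs) @ b" for e b xs
    by (induction xs arbitrary: b) auto
  have sz: "size (enc (rev xs)) = size (enc xs)" for xs :: "'x list"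
    by (induction xs) (auto simp: size_enc_append)
  from l obtain L where L: "pb L" "\<forall>e. size (enc (l e)) \<le> L (size (enc e))" by (rule PT_size)
  have "PT (\<lambda>e. foldl (\<lambda>acc x. if P e x then x # acc else acc) [] (l e))"
  proof (rule PT_foldl[where Q = L])
    show "size (enc (foldl (\<lambda>acc x. if P e x then x # acc else acc) [] xs)) \<le> L (size (enc e))"
      if "l e = xs @ ys" for e xs ys
      using L(2)[rule_format, of e] that size_enc_filter[of "P e" xs] by (simp add: eq sz size_enc_append)
  qed (intro PT_if PT_comp2[OF P] PT_Cons PT_fst PT_snd PT_id PT_const l L(1))+
  from PT_rev[OF this] show ?thesis by (simp add: eq)
qed

lemma PT_concat_map:
  fixes h :: "'e :: tree_enc \<Rightarrow> 'x :: tree_enc \<Rightarrow> 'y :: tree_enc list"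
  assumes h: "PT (\<lambda>z. h (fst z) (snd z))" and l: "PT l"
  shows "PT (\<lambda>e. concat (map (h e) (l e)))"
proof -
  have eq: "foldl (\<lambda>acc x. acc @ h e x) b xs = b @ concat (map (h e) xs)" for e b xs
    by (induction xs arbitrary: b) auto
  from l obtain L where L: "pb L" "\<forall>e. size (enc (l e)) \<le> L (size (enc e))" by (rule PT_size)
  from h obtain H where H: "pb H" "\<forall>z. size (enc (h (fst z) (snd z))) \<le> H (size (enc z))" by (rule PT_size)
  have "PT (\<lambda>e. foldl (\<lambda>acc x. acc @ h e x) [] (l e))"
  proof (rule PT_foldl[where Q = "\<lambda>n. L n * H (n + L n + 1)"])
    show "size (enc (foldl (\<lambda>acc x. acc @ h e x) [] xs)) \<le>
        L (size (enc e)) * H (size (enc e) + L (size (enc e)) + 1)" if a: "l e = xs @ ys" for e xs ys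
    proof -
      let ?n = "size (enc e)"
      have "size (enc (h e x)) \<le> H (?n + L ?n + 1)" if "x \<in> set xs" for x
      proof -
        have "size (enc x) \<le> L ?n" using size_enc_mem[of x "l e"] that a L(2)[rule_format, of e] by auto
        then have "H (size (enc (e, x))) \<le> H (?n + L ?n + 1)" by (intro pb_mono[OF H(1)]) auto
        with H(2)[rule_format, of "(e, x)"] show ?thesis by simp
      qed
      then have "size (enc (concat (map (h e) xs))) \<le> length xs * H (?n + L ?n + 1)"
        by (induction xs) (auto simp: size_enc_append intro!: add_mono)
      moreover have "length xs \<le> L ?n"
        using a length_le_enc[of "l e"] L(2)[rule_format, of e] by simp
      ultimately show ?thesis unfolding eq append_Nil by (meson le_trans mult_le_mono1)
    qed
    show "pb (\<lambda>n. L n * H (n + L n + 1))"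
      by (intro pb_intros pb_comp[OF H(1)] pb_comp[OF L(1)])
  qed (intro PT_append PT_comp2[OF h] PT_fst PT_snd PT_id PT_const l)+
  then show ?thesis by (simp add: eq)
qed

lemma PT_map:
  assumes "PT (\<lambda>z. h (fst z) (snd z))" and "PT l"
  shows "PT (\<lambda>e. map (h e) (l e))"
proof -
  have "PT (\<lambda>e. concat (map (\<lambda>x. [h e x]) (l e)))"
    by (rule PT_concat_map) (intro PT_Cons PT_const assms)+
  moreover have "concat (map (\<lambda>x. [h e x]) xs) = map (h e) xs" for e xs by (induction xs) auto
  ultimately show ?thesis by simp
qed

text \<open>A number and the list of that many \<open>False\<close> have the same encoding. Folding
  the predecessor function over this list computes the truncated difference, which is nonzero
  exactly if the comparison holds.\<close>

lemma PT_less: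
  assumes "PT a" "PT b"
  shows "PT (\<lambda>e. a e < (b e :: nat))"
proof -
  have r: "enc (replicate n False) = enc n" for n
    by (induction n) (auto simp: enc_nat_def)
  have 1: "PT (\<lambda>n. replicate n False)"
    by (rule PT_Assign[of "Var 0"]) (auto simp: r)
  have 2: "PT (\<lambda>n :: nat. n - 1)"
  proof (rule PT_Assign[of "NodeE (Right (Left (Var 0))) (Right (Var 0))"])
    show "eval (NodeE (Right (Left (Var 0))) (Right (Var 0))) (\<lambda>_. Node (enc n) k) = Node (enc (n - 1)) k" for n :: nat and k
      by (cases n) (auto simp: enc_nat_def)
  qed auto
  have eq: "foldl (\<lambda>n x. n - 1) m xs = m - length xs" for m and xs :: "bool list"
    by (induction xs arbitrary: m) auto
  have sz: "size (enc n) = n" for n :: nat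
    by (induction n) (auto simp: enc_nat_def)
  from assms(2) obtain L where L: "pb L" "\<forall>e. size (enc (b e)) \<le> L (size (enc e))" by (rule PT_size)
  have "PT (\<lambda>e. foldl (\<lambda>n x. n - 1) (b e) (replicate (a e) False))"
  proof (rule PT_foldl[where Q = L])
    show "size (enc (foldl (\<lambda>n x. n - 1) (b e) xs)) \<le> L (size (enc e))" for e and xs :: "bool list"
      using L(2)[rule_format, of e] unfolding eq by (simp add: sz)
  qed (intro PT_comp[OF 2] PT_comp[OF 1] PT_fst PT_snd PT_id assms L(1))+
  from PT_not[OF PT_eq[OF this PT_const[of 0]]] have "PT (\<lambda>e. b e - a e \<noteq> 0)"
    by (simp only: eq length_replicate)
  moreover have "(\<lambda>e. b e - a e \<noteq> 0) = (\<lambda>e. a e < b e)" by auto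
  ultimately show ?thesis by (simp only:)
qed

definition dedup :: "'a list \<Rightarrow> 'a list" where
  "dedup xs = foldl (\<lambda>acc x. if x \<in> set acc then acc else x # acc) [] xs"

lemma dedup: "set (dedup xs) = set xs" "distinct (dedup xs)"
proof -
  have "set (foldl (\<lambda>acc x. if x \<in> set acc then acc else x # acc) b xs) = set b \<union> set xs \<and>
    (distinct b \<longrightarrow> distinct (foldl (\<lambda>acc x. if x \<in> set acc then acc else x # acc) b xs))" for b
    by (induction xs arbitrary: b) auto
  then show "set (dedup xs) = set xs" "distinct (dedup xs)" by (auto simp: dedup_def)
qed

lemma PT_dedup: assumes "PT l" shows "PT (\<lambda>e. dedup (l e))"
proof -
  have sz: "size (enc (foldl (\<lambda>acc x. if x \<in> set acc then acc else x # acc) b xs)) \<le> size (enc b) + size (enc xs)"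
    for b and xs :: "'b list"
  proof (induction xs arbitrary: b)
    case (Cons x xs)
    show ?case using Cons[of b] Cons[of "x # b"] by (cases "x \<in> set b") simp_all
  qed auto
  from assms obtain L where L: "pb L" "\<forall>e. size (enc (l e)) \<le> L (size (enc e))" by (rule PT_size)
  show ?thesis unfolding dedup_def
  proof (rule PT_foldl[where Q = L])
    show "size (enc (foldl (\<lambda>acc x. if x \<in> set acc then acc else x # acc) [] xs)) \<le> L (size (enc e))"
      if "l e = xs @ ys" for e xs ys
      using L(2)[rule_format, of e] sz[of "[]" xs] that by (simp add: size_enc_append)
  qed (intro PT_if PT_mem PT_Cons PT_fst PT_snd PT_id PT_const assms L(1))+
qed

text \<open>Greedy deletion of the candidates \<open>cs\<close>. For monotone \<open>P\<close> a
  single pass is enough: an element that could not be dropped earlier cannot be dropped from a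
  smaller list either (\<open>minz_spec\<close>).\<close>

definition minz :: "('a list \<Rightarrow> bool) \<Rightarrow> 'a list \<Rightarrow> 'a list \<Rightarrow> 'a list" where
  "minz P S cs = foldl (\<lambda>S t. if P (filter (\<lambda>g. g \<noteq> t) S) then filter (\<lambda>g. g \<noteq> t) S else S) S cs"

lemma PT_minz:
  fixes P :: "'e :: tree_enc \<Rightarrow> 'x :: tree_enc list \<Rightarrow> bool"
  assumes P: "PT (\<lambda>z. P (fst z) (snd z))" and i: "PT i" and l: "PT l"
  shows "PT (\<lambda>e. minz (P e) (i e) (l e))"
proof -
  have sz: "size (enc (minz (P e) S xs)) \<le> size (enc S)" for e S xs
    unfolding minz_def
  proof (induction xs arbitrary: S)
    case (Cons x xs)
    then show ?case using size_enc_filter[of "\<lambda>g. g \<noteq> x" S] order_trans by fastforce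
  qed auto
  from i obtain L where L: "pb L" "\<forall>e. size (enc (i e)) \<le> L (size (enc e))" by (rule PT_size)
  have 1: "PT (\<lambda>z :: 'e \<times> 'x \<times> 'x list. filter (\<lambda>g. g \<noteq> fst (snd z)) (snd (snd z)))"
    by (rule PT_filter) (intro PT_not PT_eq PT_fst PT_snd PT_id)+
  show ?thesis unfolding minz_def
  proof (rule PT_foldl[where Q = L])
    show "size (enc (foldl (\<lambda>S t. if P e (filter (\<lambda>g. g \<noteq> t) S) then filter (\<lambda>g. g \<noteq> t) S else S) (i e) xs))
      \<le> L (size (enc e))" for e xs
      using L(2)[rule_format, of e] sz[of e "i e" xs, unfolded minz_def] by linarith
  qed (intro PT_if PT_comp2[OF P] 1 PT_fst PT_snd PT_id i l L(1))+
qed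

section \<open>Minimal edge dominating sets relative to a set of edges\<close>

type_synonym edge = "nat \<times> nat"

definition inc :: "edge \<Rightarrow> nat \<Rightarrow> bool" where
  "inc f v \<longleftrightarrow> v = fst f \<or> v = snd f"

definition oth :: "edge \<Rightarrow> nat \<Rightarrow> nat" where
  "oth f v = (if v = fst f then snd f else fst f)"

definition cov :: "edge set \<Rightarrow> nat \<Rightarrow> bool" where
  "cov S v \<longleftrightarrow> (\<exists>f\<in>S. inc f v)"

definition adj :: "edge set \<Rightarrow> nat \<Rightarrow> nat \<Rightarrow> bool" where
  "adj E u v \<longleftrightarrow> (u, v) \<in> E \<or> (v, u) \<in> E"

definition eds :: "edge set \<Rightarrow> edge set \<Rightarrow> bool" where
  "eds E S \<longleftrightarrow> (\<forall>f\<in>E. cov S (fst f) \<or> cov S (snd f))"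

text \<open>
  The edges in \<open>B\<close> are given for free; \<open>T\<close> completes them, minimally, to an edge dominating set.
\<close>

definition tr :: "edge set \<Rightarrow> edge set \<Rightarrow> edge set \<Rightarrow> bool" where
  "tr E B T \<longleftrightarrow> T \<subseteq> E \<and> eds E (B \<union> T) \<and> (\<forall>t\<in>T. \<not> eds E (B \<union> (T - {t})))"

definition unc :: "edge set \<Rightarrow> edge set \<Rightarrow> nat set" where
  "unc E S = {v. cov E v \<and> \<not> cov S v}"

lemma cov_Un [simp]: "cov (A \<union> B) v \<longleftrightarrow> cov A v \<or> cov B v"
  and cov_insert [simp]: "cov (insert f A) v \<longleftrightarrow> inc f v \<or> cov A v"
  and cov_empty [simp]: "\<not> cov {} v"
  by (auto simp: cov_def)

lemma cov_mono: "A \<subseteq> B \<Longrightarrow> cov A v \<Longrightarrow> cov B v"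
  by (auto simp: cov_def)

lemma covI: "f \<in> S \<Longrightarrow> inc f v \<Longrightarrow> cov S v"
  by (auto simp: cov_def)

lemma eds_iff: "eds E S \<longleftrightarrow> (\<forall>f\<in>E. \<exists>v. inc f v \<and> cov S v)"
  by (auto simp: eds_def inc_def)

lemma eds_cong: "(\<And>v. cov E v \<Longrightarrow> cov S v = cov S' v) \<Longrightarrow> eds E S = eds E S'"
  unfolding eds_iff by (metis covI)

lemma eds_mono: "S \<subseteq> S' \<Longrightarrow> eds E S \<Longrightarrow> eds E S'"
  unfolding eds_iff using cov_mono by blast

lemma inc_oth: "inc f v \<Longrightarrow> inc f (oth f v)"
  and inc_cases: "inc f v \<Longrightarrow> inc f u \<Longrightarrow> u = v \<or> u = oth f v"
  by (auto simp: inc_def oth_def)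

text \<open>
  Here \<open>I\<close> is the set of uncovered vertices, and \<open>pr\<close> a linear order of the vertices. An edge of a solution
  that meets a vertex satisfying \<open>Rv\<close> can be needed only because of its other end. \<open>Nk\<close> selects, for
  each such vertex, the edge whose other end comes first; these are the representatives of \<open>T\<close>.
\<close>

definition Rv :: "edge set \<Rightarrow> edge set \<Rightarrow> nat set \<Rightarrow> nat \<Rightarrow> bool" where
  "Rv E B I v \<longleftrightarrow> \<not> cov B v \<and> v \<notin> I \<and> (\<forall>u\<in>I. \<not> adj E u v)"

definition Lv :: "edge set \<Rightarrow> edge set \<Rightarrow> nat set \<Rightarrow> nat \<Rightarrow> bool" where
  "Lv E B I v \<longleftrightarrow> \<not> cov B v \<and> v \<notin> I \<and> (\<exists>u\<in>I. adj E u v)"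

definition rp :: "edge set \<Rightarrow> edge set \<Rightarrow> nat set \<Rightarrow> (nat \<Rightarrow> nat \<Rightarrow> bool) \<Rightarrow> edge set \<Rightarrow> nat \<Rightarrow> edge \<Rightarrow> bool" where
  "rp E B I pr T r f \<longleftrightarrow> inc f r \<and> Rv E B I r \<and> (\<forall>g\<in>T. inc g r \<longrightarrow> \<not> pr (oth g r) (oth f r))"

definition Nk :: "edge set \<Rightarrow> edge set \<Rightarrow> nat set \<Rightarrow> (nat \<Rightarrow> nat \<Rightarrow> bool) \<Rightarrow> edge set \<Rightarrow> edge set" where
  "Nk E B I pr T = {f\<in>T. rp E B I pr T (fst f) f \<or> rp E B I pr T (snd f) f}"

text \<open>An edge from \<open>z\<close> to \<open>q\<close> cannot become the representative of
  \<open>z\<close>, since \<open>N\<close> has an edge there whose other end precedes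
  \<open>q\<close>. Edges joining two \<open>Rv\<close> vertices are excluded as witnesses: in a
  solution such an edge is the only one at both of its ends (\<open>RR_iso\<close>), so nothing may
  join it there.\<close>

definition rc :: "edge set \<Rightarrow> edge set \<Rightarrow> nat set \<Rightarrow> (nat \<Rightarrow> nat \<Rightarrow> bool) \<Rightarrow> edge set \<Rightarrow> nat \<Rightarrow> nat \<Rightarrow> bool" where
  "rc E B I pr N z q \<longleftrightarrow> Rv E B I z \<and> (\<exists>g\<in>N. inc g z \<and> \<not> Rv E B I (oth g z) \<and> pr (oth g z) q)"

definition Fv :: "edge set \<Rightarrow> edge set \<Rightarrow> nat set \<Rightarrow> edge set \<Rightarrow> nat \<Rightarrow> bool" where
  "Fv E B I N q \<longleftrightarrow> Lv E B I q \<and> \<not> cov N q"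

text \<open>The end \<open>q\<close> is next to an uncovered vertex and is not taken by a
  representative. The condition on \<open>z\<close> keeps the edge off the private vertices of the
  representatives and prevents it from replacing one of them.\<close>

definition okw :: "edge set \<Rightarrow> edge set \<Rightarrow> nat set \<Rightarrow> (nat \<Rightarrow> nat \<Rightarrow> bool) \<Rightarrow> edge set \<Rightarrow> nat \<Rightarrow> nat \<Rightarrow> bool" where
  "okw E B I pr N q z \<longleftrightarrow> Fv E B I N q \<and> (Fv E B I N z \<or> cov B z \<or> rc E B I pr N z q)"

definition Wk :: "edge set \<Rightarrow> edge set \<Rightarrow> nat set \<Rightarrow> (nat \<Rightarrow> nat \<Rightarrow> bool) \<Rightarrow> edge set \<Rightarrow> edge set" where
  "Wk E B I pr N = {f\<in>E. f \<notin> N \<and> (okw E B I pr N (fst f) (snd f) \<or> okw E B I pr N (snd f) (fst f))}"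

definition mincov :: "nat set \<Rightarrow> edge set \<Rightarrow> bool" where
  "mincov X S \<longleftrightarrow> (\<forall>v\<in>X. cov S v) \<and> (\<forall>t\<in>S. \<exists>v\<in>X. inc t v \<and> \<not> cov (S - {t}) v)"

definition Comp :: "nat set \<Rightarrow> edge set \<Rightarrow> edge set \<Rightarrow> edge set set" where
  "Comp X A W = {S. A \<subseteq> S \<and> S \<subseteq> A \<union> W \<and> mincov X S}"

definition ext :: "edge set \<Rightarrow> edge set \<Rightarrow> edge set \<Rightarrow> edge \<Rightarrow> bool" where
  "ext E B T t \<longleftrightarrow> (\<exists>p. inc t p \<and> \<not> cov B p \<and> \<not> cov (T - {t}) p \<and> (\<exists>u\<in>unc E (B \<union> T). adj E u p))"

definition iso :: "edge set \<Rightarrow> edge set \<Rightarrow> edge \<Rightarrow> bool" where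
  "iso B T t \<longleftrightarrow> (\<forall>p. inc t p \<longrightarrow> \<not> cov B p \<and> \<not> cov (T - {t}) p)"

definition linord :: "(nat \<Rightarrow> nat \<Rightarrow> bool) \<Rightarrow> bool" where
  "linord pr \<longleftrightarrow> (\<forall>a. \<not> pr a a) \<and> (\<forall>a b c. pr a b \<longrightarrow> pr b c \<longrightarrow> pr a c) \<and> (\<forall>a b. a \<noteq> b \<longrightarrow> pr a b \<or> pr b a)"

lemma linord_min:
  assumes "linord pr" "finite A" "A \<noteq> {}"
  shows "\<exists>m\<in>A. \<forall>a\<in>A. \<not> pr (k a) (k m)"
  using assms(2,3)
proof (induction rule: finite_ne_induct)
  case (singleton x)
  then show ?case using assms(1) by (auto simp: linord_def)
next
  case (insert x F)
  then obtain m where m: "m \<in> F" "\<forall>a\<in>F. \<not> pr (k a) (k m)" by blast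
  show ?case
  proof (cases "pr (k x) (k m)")
    case True
    have "\<not> pr (k a) (k x)" if "a \<in> F" for a
      using True m that assms(1) unfolding linord_def by blast
    moreover have "\<not> pr (k x) (k x)" using assms(1) by (simp add: linord_def)
    ultimately show ?thesis by blast
  next
    case False
    then show ?thesis using m by blast
  qed
qed

locale graph =
  fixes E :: "edge set"
  assumes fin: "finite E"
    and irr: "f \<in> E \<Longrightarrow> fst f \<noteq> snd f"
    and simple: "f \<in> E \<Longrightarrow> g \<in> E \<Longrightarrow> {fst f, snd f} = {fst g, snd g} \<Longrightarrow> f = g"
begin

lemma oth_neq: "f \<in> E \<Longrightarrow> oth f v \<noteq> v"
  using irr[of f] by (auto simp: oth_def)

lemma oth_oth: "f \<in> E \<Longrightarrow> inc f v \<Longrightarrow> oth f (oth f v) = v"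
  using irr[of f] by (auto simp: oth_def inc_def)

lemma same_edge:
  assumes "f \<in> E" "g \<in> E" "inc f u" "inc f v" "inc g u" "inc g v" "u \<noteq> v"
  shows "f = g"
  by (rule simple) (use assms in \<open>auto simp: inc_def\<close>)

lemma same_edge_oth: "f \<in> E \<Longrightarrow> g \<in> E \<Longrightarrow> inc f u \<Longrightarrow> inc g u \<Longrightarrow> oth f u = oth g u \<Longrightarrow> f = g"
  using same_edge[of f g u "oth f u"] oth_neq[of f u] inc_oth[of f u] inc_oth[of g u] by simp

lemma adj_iff: "adj E u v \<longleftrightarrow> u \<noteq> v \<and> (\<exists>f\<in>E. inc f u \<and> inc f v)"
proof
  assume "adj E u v"
  then show "u \<noteq> v \<and> (\<exists>f\<in>E. inc f u \<and> inc f v)" using irr by (force simp: adj_def inc_def)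
next
  assume "u \<noteq> v \<and> (\<exists>f\<in>E. inc f u \<and> inc f v)"
  then obtain a b where "u \<noteq> v" "(a, b) \<in> E" "inc (a, b) u" "inc (a, b) v" by auto
  then show "adj E u v" by (auto simp: adj_def inc_def)
qed

lemma adj_oth: "f \<in> E \<Longrightarrow> inc f v \<Longrightarrow> adj E (oth f v) v"
  unfolding adj_iff using oth_neq inc_oth by blast

text \<open>If removal of \<open>t\<close> leaves \<open>f\<close> undominated, then
  \<open>t\<close> covers an end of \<open>f\<close>. The other end is uncovered, which gives
  \<open>ext\<close>, or it is covered by \<open>t\<close> as well; then \<open>f = t\<close>
  because the graph is simple, which gives \<open>iso\<close>.\<close>

lemma needed_iff:
  assumes "T \<subseteq> E" "eds E (B \<union> T)" "t \<in> T"
  shows "\<not> eds E (B \<union> (T - {t})) \<longleftrightarrow> ext E B T t \<or> iso B T t"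
proof
  assume "\<not> eds E (B \<union> (T - {t}))"
  then obtain f where f: "f \<in> E" "\<And>v. inc f v \<Longrightarrow> \<not> cov (B \<union> (T - {t})) v"
    unfolding eds_iff by blast
  from assms(2) f(1) obtain v where v: "inc f v" "cov (B \<union> T) v" unfolding eds_iff by blast
  have tv: "inc t v" using v f(2)[OF v(1)] by (auto simp: cov_def)
  let ?u = "oth f v"
  have u: "inc f ?u" "?u \<noteq> v" using v(1) inc_oth oth_neq f(1) by auto
  show "ext E B T t \<or> iso B T t"
  proof (cases "cov (B \<union> T) ?u")
    case True
    then have "inc t ?u" using f(2)[OF u(1)] by (auto simp: cov_def)
    then have "f = t" using same_edge[of f t ?u v] f(1) assms u v tv by blast
    then show ?thesis using f(2) by (auto simp: iso_def)
  next
    case False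
    then have "?u \<in> unc E (B \<union> T)" using covI[OF f(1) u(1)] by (auto simp: unc_def)
    then show ?thesis using adj_oth[OF f(1) v(1)] tv f(2)[OF v(1)] unfolding ext_def by auto
  qed
next
  assume "ext E B T t \<or> iso B T t"
  then show "\<not> eds E (B \<union> (T - {t}))"
  proof
    assume "ext E B T t"
    then obtain p u where p: "inc t p" "\<not> cov B p" "\<not> cov (T - {t}) p" "u \<in> unc E (B \<union> T)" "adj E u p"
      unfolding ext_def by blast
    from p(5) obtain f where f: "f \<in> E" "inc f u" "inc f p" "u \<noteq> p" unfolding adj_iff by blast
    have "\<not> cov (B \<union> (T - {t})) v" if "inc f v" for v
    proof -
      have "v = u \<or> v = p" using f that inc_cases[of f u p] inc_cases[of f u v] by auto
      then show ?thesis using p cov_mono[of "T - {t}" T v] by (auto simp: unc_def)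
    qed
    then show ?thesis using f(1) unfolding eds_iff by blast
  next
    assume "iso B T t"
    then show ?thesis using assms unfolding eds_iff iso_def by auto
  qed
qed

lemma tr_iff: "tr E B T \<longleftrightarrow> T \<subseteq> E \<and> eds E (B \<union> T) \<and> (\<forall>t\<in>T. ext E B T t \<or> iso B T t)"
  unfolding tr_def using needed_iff by blast

end

subsection \<open>The solutions with a given set of uncovered vertices and given representative edges\<close>

locale group = graph +
  fixes B :: "edge set" and T :: "edge set" and pr :: "nat \<Rightarrow> nat \<Rightarrow> bool"
  assumes tr: "tr E B T" and pr: "linord pr"
begin

abbreviation "I \<equiv> unc E (B \<union> T)"
abbreviation "X \<equiv> {v. cov T v \<and> \<not> cov B v}"
abbreviation "R \<equiv> Rv E B I"
abbreviation "L \<equiv> Lv E B I"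
abbreviation "N \<equiv> Nk E B I pr T"
abbreviation "W \<equiv> Wk E B I pr N"
abbreviation "F \<equiv> Fv E B I N"

lemma TE: "T \<subseteq> E" and edsT: "eds E (B \<union> T)" and needT: "t \<in> T \<Longrightarrow> ext E B T t \<or> iso B T t"
  using tr unfolding tr_iff by auto

lemma prD: "\<not> pr a a" "pr a b \<Longrightarrow> pr b c \<Longrightarrow> pr a c" "a \<noteq> b \<Longrightarrow> pr a b \<or> pr b a"
  using pr unfolding linord_def by blast+

lemma I_indep: "u \<in> I \<Longrightarrow> adj E u v \<Longrightarrow> v \<notin> I"
proof
  assume u: "u \<in> I" and a: "adj E u v" and v: "v \<in> I"
  from a obtain f where f: "f \<in> E" "inc f u" "inc f v" "u \<noteq> v" unfolding adj_iff by blast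
  with edsT obtain w where "inc f w" "cov (B \<union> T) w" unfolding eds_iff by blast
  then show False using inc_cases[of f u v] inc_cases[of f u w] f u v by (auto simp: unc_def)
qed

lemma T_notI: "t \<in> T \<Longrightarrow> inc t v \<Longrightarrow> v \<notin> I"
  by (auto simp: unc_def cov_def)

lemma R_not_L: "R v \<Longrightarrow> \<not> L v"
  by (auto simp: Rv_def Lv_def)

lemma X_RL: "v \<in> X \<Longrightarrow> R v \<or> L v"
  by (auto simp: Rv_def Lv_def unc_def)

lemma R_covT: "R v \<Longrightarrow> cov E v \<Longrightarrow> cov T v"
  by (auto simp: Rv_def unc_def)

text \<open>No neighbour of \<open>r\<close> is uncovered, so \<open>r\<close> cannot be the vertex
  \<open>p\<close> of \<open>ext\<close>. Hence \<open>t\<close> is \<open>iso\<close> or satisfies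
  \<open>ext\<close> at its other end, and either makes that end private.\<close>

lemma R_edge:
  assumes "R r" "t \<in> T" "inc t r"
  shows "\<not> cov B (oth t r)" "\<not> cov (T - {t}) (oth t r)" "iso B T t \<or> L (oth t r)"
proof -
  have "iso B T t \<or> (\<not> cov B (oth t r) \<and> \<not> cov (T - {t}) (oth t r) \<and> L (oth t r))"
  proof (cases "iso B T t")
    case False
    then obtain p u where p: "inc t p" "\<not> cov B p" "\<not> cov (T - {t}) p" "u \<in> I" "adj E u p"
      using needT[OF assms(2)] unfolding ext_def by blast
    then have "p \<noteq> r" using assms(1) by (auto simp: Rv_def)
    then have "p = oth t r" using inc_cases[OF assms(3) p(1)] by auto
    with p T_notI[OF assms(2) p(1)] show ?thesis by (auto simp: Lv_def)
  qed auto
  then show "\<not> cov B (oth t r)" "\<not> cov (T - {t}) (oth t r)" "iso B T t \<or> L (oth t r)"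
    using inc_oth[OF assms(3)] by (auto simp: iso_def)
qed

lemma RR_iso:
  assumes "R r" "t \<in> T" "inc t r" "R (oth t r)"
  shows "iso B T t"
  using R_edge(3)[OF assms(1-3)] R_not_L[OF assms(4)] by blast

lemma NT: "N \<subseteq> T"
  by (auto simp: Nk_def)

lemma N_iff: "g \<in> N \<longleftrightarrow> g \<in> T \<and> (\<exists>r. rp E B I pr T r g)"
  by (auto simp: Nk_def rp_def inc_def)

lemma R_rp:
  assumes "R r" "cov E r"
  shows "\<exists>f\<in>N. rp E B I pr T r f"
proof -
  have "finite {g\<in>T. inc g r}" using fin TE by (auto intro: finite_subset)
  moreover have "{g\<in>T. inc g r} \<noteq> {}" using R_covT[OF assms] by (auto simp: cov_def)
  ultimately obtain m where "m \<in> T" "inc m r" "\<forall>g\<in>{g\<in>T. inc g r}. \<not> pr (oth g r) (oth m r)"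
    using linord_min[OF pr, of _ "\<lambda>g. oth g r"] by blast
  then have "rp E B I pr T r m" using assms(1) by (auto simp: rp_def)
  moreover from this have "m \<in> N" using \<open>m \<in> T\<close> N_iff by blast
  ultimately show ?thesis by blast
qed

lemma W_iff: "f \<in> W \<longleftrightarrow> f \<in> E \<and> f \<notin> N \<and> (\<exists>q. inc f q \<and> okw E B I pr N q (oth f q))"
proof -
  have "f \<in> E \<Longrightarrow> (okw E B I pr N (fst f) (snd f) \<or> okw E B I pr N (snd f) (fst f)) \<longleftrightarrow>
     (\<exists>q. inc f q \<and> okw E B I pr N q (oth f q))"
  proof -
    assume "f \<in> E"
    then have "oth f (fst f) = snd f" "oth f (snd f) = fst f" using irr[of f] by (auto simp: oth_def)
    then show ?thesis unfolding inc_def by metis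
  qed
  then show ?thesis by (auto simp: Wk_def)
qed

text \<open>The far end of a representative is private in \<open>T\<close> by \<open>R_edge\<close>.
  No edge of \<open>W\<close> meets it: it is covered by \<open>N\<close>, hence not free, and
  \<open>rc\<close> would need an edge of \<open>N\<close> from there to a vertex outside
  \<open>R\<close>, whereas the only one is \<open>a\<close>, which leads back to \<open>r\<close>.
  Privacy within \<open>N \<union> W\<close> is what makes \<open>inv\<close> hold at the start of
  the branching.\<close>

lemma N_priv:
  assumes "a \<in> N"
  obtains r where "R r" "inc a r" "oth a r \<in> X" "\<not> cov (T - {a}) (oth a r)"
    "\<forall>f\<in>N \<union> W. inc f (oth a r) \<longrightarrow> f = a"
proof -
  from assms obtain r where r: "a \<in> T" "R r" "inc a r" unfolding N_iff rp_def by blast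
  let ?q = "oth a r"
  note q = R_edge[OF r(2,1,3)]
  have q1: "inc a ?q" using inc_oth r(3) .
  have aE: "a \<in> E" using r(1) TE by auto
  have TQ: "f = a" if "f \<in> T" "inc f ?q" for f
    using q(2) that by (auto simp: cov_def)
  have "f = a" if f: "f \<in> N \<union> W" "inc f ?q" for f
  proof (cases "f \<in> N")
    case True then show ?thesis using TQ[OF _ f(2)] NT by blast
  next
    case False
    then obtain q' where q': "f \<in> E" "inc f q'" "okw E B I pr N q' (oth f q')" using f False W_iff[of f] by blast
    have nF: "\<not> F ?q" using covI[OF assms q1] by (auto simp: Fv_def)
    then have "?q \<noteq> q'" using q'(3) by (auto simp: okw_def)
    then have "oth f q' = ?q" using inc_cases[OF q'(2) f(2)] by auto
    then have "rc E B I pr N ?q q'" using q'(3) nF q(1) by (auto simp: okw_def)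
    then obtain g where g: "g \<in> N" "inc g ?q" "\<not> R (oth g ?q)" by (auto simp: rc_def)
    then have "g = a" using TQ[OF _ g(2)] NT by blast
    then show ?thesis using g(3) oth_oth[OF aE r(3)] r(2) by simp
  qed
  moreover have "?q \<in> X" using q(1) covI[OF r(1) q1] by auto
  ultimately show ?thesis using that r q by blast
qed

text \<open>An edge needed through \<open>ext\<close> at \<open>p\<close> has \<open>p\<close> as
  its free end; if the other end met none of the three conditions, it would contradict the choice of
  a representative or be the private vertex of one. An \<open>iso\<close> edge at an
  \<open>R\<close> vertex is the only edge there and so its representative; an \<open>iso\<close>
  edge outside \<open>N\<close> therefore has two free ends.\<close>

lemma T_sub: "T \<subseteq> N \<union> W"
proof
  fix t assume t: "t \<in> T"
  show "t \<in> N \<union> W"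
  proof (cases "t \<in> N")
    case False
    have tE: "t \<in> E" using t TE by auto
    have notcovN: "\<not> cov N p" if "\<not> cov (T - {t}) p" for p
      using that False NT by (auto simp: cov_def)
    have key: "F p" if p: "inc t p" "L p" "\<not> cov (T - {t}) p" for p
      using p notcovN by (auto simp: Fv_def)
    have "\<exists>q. inc t q \<and> okw E B I pr N q (oth t q)"
    proof (cases "ext E B T t")
      case True
      then obtain p u where p: "inc t p" "\<not> cov B p" "\<not> cov (T - {t}) p" "u \<in> I" "adj E u p"
        unfolding ext_def by blast
      then have Lp: "L p" using T_notI[OF t] by (auto simp: Lv_def)
      let ?z = "oth t p"
      have z: "inc t ?z" "?z \<noteq> p" using p inc_oth oth_neq tE by auto
      have "F ?z \<or> cov B ?z \<or> rc E B I pr N ?z p"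
      proof (rule ccontr)
        assume a: "\<not> (F ?z \<or> cov B ?z \<or> rc E B I pr N ?z p)"
        then have "?z \<in> X" using covI[OF t z(1)] by auto
        then consider "R ?z" | "L ?z" using X_RL by blast
        then show False
        proof cases
          case 1
          obtain g where g: "g \<in> N" "rp E B I pr T ?z g" using R_rp[OF 1 covI[OF tE z(1)]] by blast
          then have gz: "inc g ?z" "g \<in> T" using NT by (auto simp: rp_def)
          have ne: "g \<noteq> t" using g(1) False by auto
          have op: "oth t ?z = p" using oth_oth[OF tE p(1)] .
          \<comment> \<open>A representative that joins two \<open>R\<close> vertices would be the
            only edge of \<open>T\<close> at \<open>?z\<close>, but \<open>t\<close> is there
            too.\<close>
          have nR: "\<not> R (oth g ?z)"
          proof
            assume "R (oth g ?z)"
            then have "iso B T g" using RR_iso[OF 1 gz(2,1)] by blast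
            then have "\<not> cov (T - {g}) ?z" using gz(1) by (auto simp: iso_def)
            then show False using t ne z(1) by (auto simp: cov_def)
          qed
          have "\<not> pr p (oth g ?z)" using g(2) t z(1) op by (auto simp: rp_def)
          moreover have "p \<noteq> oth g ?z" using same_edge_oth[of g t ?z] gz TE tE z(1) ne op by auto
          ultimately have "pr (oth g ?z) p" using prD(3) by blast
          then have "rc E B I pr N ?z p" using 1 g(1) gz(1) nR by (auto simp: rc_def)
          then show False using a by blast
        next
          case 2
          then have "cov N ?z" using a by (auto simp: Fv_def)
          then obtain g where g: "g \<in> N" "inc g ?z" by (auto simp: cov_def)
          then have ne: "g \<noteq> t" using False by auto
          obtain r where r: "R r" "inc g r" "\<not> cov (T - {g}) (oth g r)" using N_priv[OF g(1)] by blast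
          have "r \<noteq> ?z" using r(1) 2 R_not_L by auto
          then have "oth g r = ?z" using inc_cases[OF r(2) g(2)] by auto
          then show False using r(3) t z(1) ne by (auto simp: cov_def)
        qed
      qed
      then show ?thesis using key[OF p(1) Lp p(3)] p(1) by (auto simp: okw_def)
    next
      case nx: False
      then have i: "iso B T t" using needT[OF t] by blast
      have Lp: "L p" if p: "inc t p" for p
      proof (rule ccontr)
        assume "\<not> L p"
        moreover have "p \<in> X" using i covI[OF t p] p unfolding iso_def by blast
        ultimately have Rp: "R p" using X_RL by blast
        have "\<not> cov (T - {t}) p" using i p unfolding iso_def by blast
        then have "g = t" if "g \<in> T" "inc g p" for g using covI[of g "T - {t}" p] that by blast
        then have "rp E B I pr T p t" using Rp p prD(1) unfolding rp_def by blast
        then show False using False t N_iff by blast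
      qed
      have F: "F p" if "inc t p" for p using key[OF that Lp[OF that]] i that unfolding iso_def by blast
      have "inc t (fst t)" by (simp add: inc_def)
      moreover from this have "okw E B I pr N (fst t) (oth t (fst t))"
        using F inc_oth[of t "fst t"] unfolding okw_def by blast
      ultimately show ?thesis by blast
    qed
    then have "t \<in> W" using False tE W_iff[of t] by simp
    then show ?thesis ..
  qed auto
qed

lemma X_mincov: "mincov X T"
proof -
  have "\<exists>v\<in>X. inc t v \<and> \<not> cov (T - {t}) v" if t: "t \<in> T" for t
  proof (cases "ext E B T t")
    case True
    then show ?thesis using covI[OF t] unfolding ext_def by blast
  next
    case False
    then have "iso B T t" using needT[OF t] by blast
    then show ?thesis using covI[OF t, of "fst t"] by (auto simp: iso_def inc_def)
  qed
  then show ?thesis by (auto simp: mincov_def)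
qed

lemma T_Comp: "T \<in> Comp X N W"
  using NT T_sub X_mincov by (auto simp: Comp_def)

lemma W_notI: "f \<in> N \<union> W \<Longrightarrow> inc f v \<Longrightarrow> v \<notin> I"
proof (cases "f \<in> N")
  case True
  then show "inc f v \<Longrightarrow> v \<notin> I" using NT T_notI by blast
next
  case False
  assume "f \<in> N \<union> W" "inc f v"
  then obtain q where q: "f \<in> E" "inc f q" "okw E B I pr N q (oth f q)" using False W_iff[of f] by blast
  have "v = q \<or> v = oth f q" using inc_cases q(2) \<open>inc f v\<close> by blast
  then show "v \<notin> I" using q(3) by (auto simp: okw_def Fv_def Lv_def rc_def Rv_def unc_def)
qed

lemma NWE: "N \<union> W \<subseteq> E"
  using NT TE by (auto simp: Wk_def)

section \<open>The members of a group: all are solutions, with the same uncovered vertices and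
  representatives\<close>

context
  fixes S assumes S: "S \<in> Comp X N W"
begin

lemma S_sub: "N \<subseteq> S" "S \<subseteq> N \<union> W" and S_cov: "v \<in> X \<Longrightarrow> cov S v"
  and S_priv: "t \<in> S \<Longrightarrow> \<exists>v\<in>X. inc t v \<and> \<not> cov (S - {t}) v"
  using S by (auto simp: Comp_def mincov_def)

lemma unc_Comp: "unc E (B \<union> S) = I"
proof -
  have "cov (B \<union> S) v \<longleftrightarrow> cov (B \<union> T) v" if "cov E v" for v
  proof
    assume "cov (B \<union> S) v"
    then have "v \<notin> I"
    proof (cases "cov S v")
      case True
      then obtain f where "f \<in> S" "inc f v" by (auto simp: cov_def)
      then show ?thesis using S_sub(2) W_notI by blast
    qed (auto simp: unc_def)
    then show "cov (B \<union> T) v" using that by (auto simp: unc_def)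
  next
    assume "cov (B \<union> T) v" then show "cov (B \<union> S) v" using S_cov[of v] by auto
  qed
  then show ?thesis by (auto simp: unc_def)
qed

lemma S_at_R:
  assumes "f \<in> S" "inc f r" "R r" "f \<notin> N"
  shows "\<exists>g\<in>N. inc g r \<and> \<not> R (oth g r) \<and> pr (oth g r) (oth f r)"
proof -
  from assms obtain q where q: "f \<in> E" "inc f q" "okw E B I pr N q (oth f q)" using S_sub W_iff[of f] by blast
  have "q \<noteq> r" using assms(3) q(3) R_not_L by (auto simp: okw_def Fv_def)
  then have o: "oth f q = r" using inc_cases[OF q(2) assms(2)] by auto
  have "\<not> F r" "\<not> cov B r" using assms(3) R_not_L by (auto simp: Fv_def Rv_def)
  then have "rc E B I pr N r q" using q(3) o by (auto simp: okw_def)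
  moreover have "oth f r = q" using oth_oth[OF q(1,2)] o by simp
  ultimately show ?thesis by (auto simp: rc_def)
qed

text \<open>Edges of \<open>W\<close> at an \<open>R\<close> vertex come after some edge of
  \<open>N\<close> in the order, so neither their presence nor their absence affects which edge
  comes first there.\<close>

lemma rp_Comp: "rp E B I pr S r f \<and> f \<in> S \<longleftrightarrow> rp E B I pr T r f \<and> f \<in> T"
proof -
  have SE: "S \<subseteq> E" using S_sub NWE by blast
  have min: "rp E B I pr S r f0" if f0: "f0 \<in> N" "rp E B I pr T r f0" for f0
    unfolding rp_def
  proof (intro conjI ballI impI)
    show f0r: "inc f0 r" "R r" using f0 by (auto simp: rp_def)
    fix g assume g: "g \<in> S" "inc g r"
    show "\<not> pr (oth g r) (oth f0 r)"
    proof (cases "g \<in> N")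
      case True then show ?thesis using f0(2) g NT by (auto simp: rp_def)
    next
      case False
      then obtain h where h: "h \<in> N" "inc h r" "pr (oth h r) (oth g r)" using S_at_R[OF g f0r(2)] by blast
      then have "\<not> pr (oth h r) (oth f0 r)" using f0(2) NT by (auto simp: rp_def)
      then show ?thesis using h(3) prD(2) by blast
    qed
  qed
  have uniq: "f = f'" if "rp E B I pr S r f" "rp E B I pr S r f'" "f \<in> S" "f' \<in> S" for f f'
    using that prD(3)[of "oth f r" "oth f' r"] same_edge_oth[of f f' r] SE by (auto simp: rp_def)
  show ?thesis
  proof
    assume a: "rp E B I pr S r f \<and> f \<in> S"
    then have r: "R r" "cov E r" using SE by (auto simp: rp_def intro: covI)
    obtain f0 where f0: "f0 \<in> N" "rp E B I pr T r f0" using R_rp[OF r] by blast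
    then have "f = f0" using uniq[of f f0] min[OF f0] a f0(1) S_sub(1) by blast
    then show "rp E B I pr T r f \<and> f \<in> T" using f0 NT by blast
  next
    assume a: "rp E B I pr T r f \<and> f \<in> T"
    then have "f \<in> N" using N_iff[of f] by blast
    then show "rp E B I pr S r f \<and> f \<in> S" using min[of f] a S_sub(1) by blast
  qed
qed

lemma Nk_Comp: "Nk E B I pr S = N"
  using rp_Comp by (auto simp: Nk_def)

text \<open>A representative keeps its private far end. If that end satisfies \<open>R\<close>, the
  near end has to be private as well; it is, because an edge of \<open>W\<close> there would require
  a representative leading to a vertex outside \<open>R\<close>. Any other edge of \<open>S\<close>
  has a private vertex in \<open>X\<close>; this cannot satisfy \<open>R\<close>, as it would then
  be shared with a representative, so it is next to an uncovered vertex.\<close>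

lemma tr_Comp: "tr E B S"
  unfolding tr_iff
proof (intro conjI ballI)
  show "S \<subseteq> E" using S_sub NWE by blast
  have "eds E (B \<union> S) = eds E (B \<union> T)"
    by (rule eds_cong) (use unc_Comp in \<open>auto simp: unc_def\<close>)
  then show "eds E (B \<union> S)" using edsT by simp
  fix t assume t: "t \<in> S"
  have ext: "ext E B S t" if "inc t v" "L v" "\<not> cov (S - {t}) v" for v
    using that unfolding ext_def unc_Comp by (auto simp: Lv_def)
  show "ext E B S t \<or> iso B S t"
  proof (cases "t \<in> N")
    case True
    then obtain r where r: "R r" "inc t r" "oth t r \<in> X" "\<not> cov (T - {t}) (oth t r)"
      "\<forall>f\<in>N \<union> W. inc f (oth t r) \<longrightarrow> f = t" by (rule N_priv)
    have q: "\<not> cov (S - {t}) (oth t r)" using r(5) S_sub unfolding cov_def by blast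
    show ?thesis
    proof (cases "L (oth t r)")
      case True then show ?thesis using ext[OF inc_oth[OF r(2)] _ q] by blast
    next
      case False
      then have Rq: "R (oth t r)" using X_RL[OF r(3)] by blast
      have tT: "t \<in> T" using True NT by auto
      have i: "iso B T t" using RR_iso[OF r(1) tT r(2) Rq] .
      have "f = t" if f: "f \<in> S" "inc f r" for f
      proof (cases "f \<in> N")
        case True then show ?thesis using i f r(2) NT unfolding iso_def cov_def by blast
      next
        case False
        then obtain g where g: "g \<in> N" "inc g r" "\<not> R (oth g r)" using S_at_R[OF f r(1)] by blast
        then have "g = t" using i r(2) NT unfolding iso_def cov_def by blast
        then show ?thesis using g Rq by blast
      qed
      then have "\<not> cov (S - {t}) r" unfolding cov_def by blast
      moreover have "\<not> cov B r" using r(1) by (auto simp: Rv_def)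
      ultimately have "iso B S t" using q r(2,3) inc_cases[of t r] unfolding iso_def by blast
      then show ?thesis by blast
    qed
  next
    case False
    obtain v where v: "v \<in> X" "inc t v" "\<not> cov (S - {t}) v" using S_priv[OF t] by blast
    have "\<not> R v"
    proof
      assume "R v"
      then obtain g where "g \<in> N" "inc g v" using S_at_R[OF t v(2) _ False] by blast
      then have "g \<in> S - {t}" "inc g v" using False S_sub by auto
      then show False using v(3) by (auto simp: cov_def)
    qed
    then show ?thesis using X_RL[OF v(1)] ext[OF v(2) _ v(3)] by blast
  qed
qed

end

end

subsection \<open>The parent of a group of solutions\<close>

text \<open>
  \<open>St\<close> holds for the vertices that border on an uncovered vertex even when \<open>e\<close> is added. The order \<open>prc\<close>
  prefers them and puts the end of \<open>e\<close> other than \<open>y\<close> last; this lets the parent retain the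
  representatives, except the one that meets that end, if any (lemma \<open>Xf_edge\<close>).
\<close>

definition St :: "edge set \<Rightarrow> edge \<Rightarrow> edge set \<Rightarrow> nat \<Rightarrow> nat set \<Rightarrow> nat \<Rightarrow> bool" where
  "St E e B y I v \<longleftrightarrow> \<not> inc e v \<and> \<not> cov B v \<and> v \<notin> I \<and> (\<exists>u\<in>I. u \<noteq> y \<and> adj E u v)"

definition prc :: "edge set \<Rightarrow> edge \<Rightarrow> edge set \<Rightarrow> nat \<Rightarrow> nat set \<Rightarrow> nat \<Rightarrow> nat \<Rightarrow> bool" where
  "prc E e B y I a b \<longleftrightarrow> (St E e B y I a \<and> \<not> St E e B y I b) \<or>
     (St E e B y I a = St E e B y I b \<and> a \<noteq> oth e y \<and> (b = oth e y \<or> a < b))"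

text \<open>The analogue of \<open>okw\<close> for the parent, to which \<open>e\<close> is given:
  ends on \<open>e\<close> count as covered, so edges into \<open>y\<close> become admissible. At an
  \<open>Rv\<close> vertex only edges to \<open>St\<close> vertices are allowed; hence a
  representative whose far end is not in \<open>St\<close> is the only edge of the parent at its
  near end (\<open>tr_par\<close>).\<close>

definition okw0 :: "edge set \<Rightarrow> edge \<Rightarrow> edge set \<Rightarrow> nat \<Rightarrow> nat set \<Rightarrow> edge set \<Rightarrow> nat \<Rightarrow> nat \<Rightarrow> bool" where
  "okw0 E e B y I N q z \<longleftrightarrow> Fv E B I N q \<and> \<not> inc e q \<and>
     (Fv E B I N z \<or> inc e z \<or> cov B z \<or> (rc E B I (prc E e B y I) N z q \<and> St E e B y I q))"

definition W0k :: "edge set \<Rightarrow> edge \<Rightarrow> edge set \<Rightarrow> nat \<Rightarrow> nat set \<Rightarrow> edge set \<Rightarrow> edge set" where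
  "W0k E e B y I N = {f\<in>E. f \<notin> N \<and> (okw0 E e B y I N (fst f) (snd f) \<or> okw0 E e B y I N (snd f) (fst f))}"

definition N0k :: "edge \<Rightarrow> nat \<Rightarrow> edge set \<Rightarrow> edge set" where
  "N0k e y N = {f\<in>N. \<not> inc f (oth e y)}"

definition Xk :: "edge \<Rightarrow> nat \<Rightarrow> edge set \<Rightarrow> edge set" where
  "Xk e y N = {f\<in>N. inc f (oth e y)}"

text \<open>The vertex put last lies on \<open>e\<close> and thus is not in \<open>St\<close>, so
  the exception concerns only the second of the two classes.\<close>

lemma linord_prc:
  assumes "inc e y"
  shows "linord (prc E e B y I)"
proof -
  have *: "linord (\<lambda>a b. (S a \<and> \<not> S b) \<or> (S a = S b \<and> a \<noteq> x \<and> (b = x \<or> a < b)))"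
    if "\<not> S x" for S and x :: nat
    unfolding linord_def
  proof (intro conjI allI impI)
    fix a b :: nat assume "a \<noteq> b"
    then have "a < b \<or> b < a" by auto
    then show "((S a \<and> \<not> S b) \<or> (S a = S b \<and> a \<noteq> x \<and> (b = x \<or> a < b))) \<or>
       (S b \<and> \<not> S a) \<or> (S b = S a \<and> b \<noteq> x \<and> (a = x \<or> b < a))"
      using that \<open>a \<noteq> b\<close> by (cases "S a"; cases "S b"; cases "a = x"; cases "b = x"; simp)
  qed auto
  have "\<not> St E e B y I (oth e y)" using inc_oth[OF assms] by (simp add: St_def)
  from *[of "St E e B y I" "oth e y", OF this] show ?thesis unfolding prc_def[abs_def] .
qed

locale open_end = graph +
  fixes e :: edge and B T :: "edge set" and y :: nat
  assumes eE: "e \<in> E" and ey: "inc e y" and trT: "tr E B T" and yunc: "\<not> cov (B \<union> T) y"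

sublocale open_end \<subseteq> group E B T "prc E e B y (unc E (B \<union> T))"
  by unfold_locales (rule trT, rule linord_prc[OF ey])

context open_end
begin

abbreviation "x \<equiv> oth e y"
abbreviation "PR \<equiv> prc E e B y I"
abbreviation "S0 \<equiv> St E e B y I"
abbreviation "N0 \<equiv> N0k e y N"
abbreviation "W0 \<equiv> W0k E e B y I N"
abbreviation "Xf \<equiv> Xk e y N"
abbreviation "eB \<equiv> insert e B"

lemma yI: "y \<in> I"
  using yunc covI[OF eE ey] by (auto simp: unc_def)

lemma xy: "x \<noteq> y" "inc e x" "adj E y x" "adj E x y"
  using oth_neq[OF eE, of y] inc_oth[OF ey] eE ey by (auto simp: adj_iff)

lemma inc_e: "inc e v \<longleftrightarrow> v = x \<or> v = y"
  using inc_cases[OF ey] ey xy by blast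

lemma xI: "x \<notin> I"
  using I_indep[OF yI xy(3)] .

lemma xR: "\<not> R x" and yR: "\<not> R y"
  using yI xy by (auto simp: Rv_def)

lemma not_Sx: "\<not> S0 x"
  using xy(2) by (simp add: St_def)

lemma prc_x: "\<not> PR x q"
  using not_Sx by (simp add: prc_def)

lemma weak: "L v \<Longrightarrow> \<not> S0 v \<Longrightarrow> \<not> inc e v \<Longrightarrow> adj E y v"
  by (auto simp: Lv_def St_def)

lemma W0_iff: "f \<in> W0 \<longleftrightarrow> f \<in> E \<and> f \<notin> N \<and> (\<exists>q. inc f q \<and> okw0 E e B y I N q (oth f q))"
proof -
  have "f \<in> E \<Longrightarrow> (okw0 E e B y I N (fst f) (snd f) \<or> okw0 E e B y I N (snd f) (fst f)) \<longleftrightarrow>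
     (\<exists>q. inc f q \<and> okw0 E e B y I N q (oth f q))"
  proof -
    assume "f \<in> E"
    then have "oth f (fst f) = snd f" "oth f (snd f) = fst f" using irr[of f] by (auto simp: oth_def)
    then show ?thesis unfolding inc_def by metis
  qed
  then show ?thesis by (auto simp: W0k_def)
qed

lemma N_eq: "N = N0 \<union> Xf" and N0N: "N0 \<subseteq> N"
  by (auto simp: N0k_def Xk_def)

lemma NE: "N \<subseteq> E"
  using NT TE by blast

lemma N_notI: "f \<in> N \<Longrightarrow> inc f v \<Longrightarrow> v \<notin> I"
  using W_notI by blast

lemma W0_notI:
  assumes "f \<in> W0" "inc f v" "v \<in> I"
  shows "v = y"
proof -
  obtain q where q: "inc f q" "okw0 E e B y I N q (oth f q)" using assms(1) W0_iff by blast
  have "v \<noteq> q" using q(2) assms(3) by (auto simp: okw0_def Fv_def Lv_def)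
  then have "v = oth f q" using inc_cases[OF q(1) assms(2)] by blast
  then show ?thesis using q(2) assms(3) xI unfolding okw0_def Fv_def Lv_def rc_def Rv_def inc_e
    by (auto simp: unc_def)
qed

lemma W0_at_R:
  assumes "f \<in> W0" "inc f r" "R r"
  shows "rc E B I PR N r (oth f r)" "S0 (oth f r)"
proof -
  obtain q where q: "f \<in> E" "inc f q" "okw0 E e B y I N q (oth f q)" using assms(1) W0_iff by blast
  have "r \<noteq> q" using q(3) R_not_L[OF assms(3)] unfolding okw0_def Fv_def by blast
  then have r: "r = oth f q" using inc_cases[OF q(2) assms(2)] by blast
  then have o: "oth f r = q" using oth_oth[OF q(1,2)] by simp
  have "\<not> F r" "\<not> inc e r" "\<not> cov B r"
    using R_not_L[OF assms(3)] assms(3) xR yR unfolding Fv_def inc_e Rv_def by blast+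
  then show "rc E B I PR N r (oth f r)" "S0 (oth f r)"
    using q(3) o r unfolding okw0_def by auto
qed

lemma W0_at_N:
  assumes "f \<in> W0" "inc f v" "L v" "cov N v" "\<not> inc e v"
  shows False
proof -
  obtain q where q: "f \<in> E" "inc f q" "okw0 E e B y I N q (oth f q)" using assms(1) W0_iff by blast
  have "v \<noteq> q" using q(3) assms(4) unfolding okw0_def Fv_def by blast
  then have "v = oth f q" using inc_cases[OF q(2) assms(2)] by blast
  then show False using q(3) assms R_not_L[of v] unfolding okw0_def Fv_def rc_def Lv_def by blast
qed

text \<open>Edges chosen at \<open>r\<close> have the same far end, hence are equal. An edge of
  \<open>N\<close> at \<open>r\<close> that was not chosen there was chosen at its other end; it
  then joins two \<open>R\<close> vertices, is \<open>iso\<close>, and has \<open>r\<close> for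
  itself.\<close>

lemma N_at_R:
  assumes "R r" "f \<in> N" "g \<in> N" "inc f r" "inc g r"
  shows "f = g"
proof -
  have *: "rp E B I PR T r f \<or> f = g" if fg: "f \<in> N" "g \<in> N" "inc f r" "inc g r" for f g
  proof -
    obtain r' where r': "rp E B I PR T r' f" using fg(1) N_iff[of f] by blast
    show ?thesis
    proof (cases "r' = r")
      case False
      then have "r' = oth f r" using inc_cases[OF fg(3)] r' unfolding rp_def by blast
      then have "iso B T f" using RR_iso[OF assms(1) _ fg(3)] r' fg(1) NT unfolding rp_def by blast
      then show ?thesis using fg NT unfolding iso_def cov_def by blast
    qed (use r' in blast)
  qed
  show ?thesis
  proof (rule ccontr)
    assume ne: "f \<noteq> g"
    then have "rp E B I PR T r f" "rp E B I PR T r g" using *[of f g] *[of g f] assms by auto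
    then have "oth f r = oth g r" using prD(3)[of "oth f r" "oth g r"] assms NT unfolding rp_def by blast
    then show False using same_edge_oth[of f g r] assms NE ne by blast
  qed
qed

text \<open>Since \<open>x\<close> does not satisfy \<open>R\<close>, the edge was chosen at its
  other end and has \<open>x\<close> as its private vertex. So \<open>Xf\<close> consists of at most
  one edge, and the search for children can try all possibilities for it.\<close>

lemma Xf_edge:
  assumes "a \<in> Xf"
  obtains r where "R r" "inc a r" "oth a r = x" "\<And>f. f \<in> N \<Longrightarrow> inc f x \<Longrightarrow> f = a"
proof -
  have a: "a \<in> N" "inc a x" using assms by (auto simp: Xk_def)
  obtain r where r: "R r" "inc a r" "\<forall>f\<in>N \<union> W. inc f (oth a r) \<longrightarrow> f = a" by (rule N_priv[OF a(1)]) blast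
  have "x \<noteq> r" using r(1) xR by auto
  then have "oth a r = x" using inc_cases[OF r(2) a(2)] by auto
  then show ?thesis using r that by auto
qed

text \<open>Among the vertices covered before, only the near end of the edge in \<open>Xf\<close>
  can get lost. An \<open>L\<close> vertex that \<open>N\<close> misses is covered by
  \<open>W0\<close>: through its edge in \<open>T\<close> if it is in \<open>St\<close> or, failing
  that, through an edge to \<open>y\<close>.\<close>

lemma unc0:
  assumes "cov E v" "\<not> cov (eB \<union> (N0 \<union> W0)) v"
  shows "v \<in> I \<or> (R v \<and> cov Xf v)"
proof (rule ccontr)
  assume a: "\<not> (v \<in> I \<or> (R v \<and> cov Xf v))"
  have n: "\<not> inc e v" "\<not> cov B v" "\<not> cov N0 v" "\<not> cov W0 v" using assms by auto
  have NX: "cov Xf v" if "cov N v" using that n(3) N_eq by (auto simp: cov_def)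
  have vX: "v \<in> X" using a assms n by (auto simp: unc_def)
  have nR: "\<not> R v"
  proof
    assume Rv: "R v"
    then obtain f where "f \<in> N" "inc f v" using R_rp[OF Rv assms(1)] unfolding rp_def by blast
    then show False using a Rv NX covI by blast
  qed
  then have Lv: "L v" using X_RL[OF vX] by blast
  show False
  proof (cases "cov N v")
    case True
    then obtain g where g: "g \<in> Xf" "inc g v" using NX by (auto simp: cov_def)
    obtain r where r: "R r" "inc g r" "oth g r = x" by (rule Xf_edge[OF g(1)])
    then show False using inc_cases[OF r(2) g(2)] nR n(1) xy(2) by auto
  next
    case False
    then have Fv: "F v" using Lv by (simp add: Fv_def)
    show False
    proof (cases "S0 v")
      case True
      obtain t where t: "t \<in> T" "inc t v" using vX by (auto simp: cov_def)
      then have "t \<notin> N" using False covI by blast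
      then obtain q where q: "t \<in> E" "inc t q" "okw E B I PR N q (oth t q)"
        using t(1) T_sub W_iff[of t] by blast
      have "okw0 E e B y I N v (oth t v)"
      proof (cases "v = q")
        case True
        then show ?thesis using q(3) n(1) \<open>S0 v\<close> unfolding okw0_def okw_def by blast
      next
        case False
        then have "oth t v = q" using inc_cases[OF q(2) t(2)] oth_oth[OF q(1,2)] by auto
        then show ?thesis using q(3) n(1) Fv unfolding okw0_def okw_def by blast
      qed
      then have "t \<in> W0" using W0_iff[of t] q(1) \<open>t \<notin> N\<close> t(2) by blast
      then show False using n(4) covI t(2) by blast
    next
      case notS: False
      obtain h where h: "h \<in> E" "inc h y" "inc h v" "v \<noteq> y" using weak[OF Lv notS n(1)] unfolding adj_iff by blast
      have "oth h v = y" using inc_cases[OF h(3) h(2)] h(4) by auto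
      then have "okw0 E e B y I N v (oth h v)" using Fv n(1) ey unfolding okw0_def by blast
      moreover have "h \<notin> N" using N_notI[of h y] h(2) yI by blast
      ultimately have "h \<in> W0" using W0_iff[of h] h by blast
      then show False using n(4) covI h(3) by blast
    qed
  qed
qed

text \<open>Both ends of an undominated edge would be as described in \<open>unc0\<close>. But
  uncovered vertices are adjacent neither to each other nor to \<open>R\<close> vertices, and the
  single edge of \<open>Xf\<close> has only one end in \<open>R\<close>.\<close>

lemma eds0: "eds E (eB \<union> (N0 \<union> W0))"
proof (rule ccontr)
  assume "\<not> ?thesis"
  then obtain f where f: "f \<in> E" "\<And>v. inc f v \<Longrightarrow> \<not> cov (eB \<union> (N0 \<union> W0)) v" unfolding eds_iff by blast
  let ?u = "fst f" and ?v = "snd f"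
  have i: "inc f ?u" "inc f ?v" by (auto simp: inc_def)
  have a: "adj E ?u ?v" "adj E ?v ?u" using f(1) i irr[OF f(1)] irr[OF f(1), symmetric] unfolding adj_iff by blast+
  have "?u \<in> I \<or> (R ?u \<and> cov Xf ?u)" "?v \<in> I \<or> (R ?v \<and> cov Xf ?v)"
    using unc0[OF covI[OF f(1)] f(2)] i by blast+
  moreover have "\<not> (?u \<in> I \<and> ?v \<in> I)" using I_indep a by blast
  moreover have "\<not> (R ?u \<and> ?v \<in> I)" "\<not> (R ?v \<and> ?u \<in> I)" using a unfolding Rv_def by blast+
  ultimately have uv: "R ?u" "cov Xf ?u" "R ?v" "cov Xf ?v" by blast+
  obtain g h where g: "g \<in> Xf" "inc g ?u" "h \<in> Xf" "inc h ?v" using uv(2,4) unfolding cov_def by blast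
  obtain r where r: "R r" "inc g r" "oth g r = x" "\<And>f. f \<in> N \<Longrightarrow> inc f x \<Longrightarrow> f = g" by (rule Xf_edge[OF g(1)]) blast
  have "h = g" using r(4)[of h] g(3) by (auto simp: Xk_def)
  then have "?u = r" "?v = r" using inc_cases[OF r(2) g(2)] inc_cases[OF r(2), of ?v] g(4) uv xR r(3) by auto
  then show False using irr[OF f(1)] by simp
qed

lemma N0W0E: "N0 \<union> W0 \<subseteq> E"
  using NE N0N by (auto simp: W0k_def)

section \<open>Reductions of \<open>N0 \<union> W0\<close> as parents, and recovery of the group
  from them\<close>

context
  fixes P assumes P: "N0 \<subseteq> P" "P \<subseteq> N0 \<union> W0" "eds E (eB \<union> P)"
    "\<And>t. t \<in> P \<Longrightarrow> t \<notin> N0 \<Longrightarrow> \<not> eds E (eB \<union> (P - {t}))"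
begin

lemma P_notI: "cov P v \<Longrightarrow> v \<in> I \<Longrightarrow> v = y"
  using P(2) N0N N_notI W0_notI unfolding cov_def by blast

lemma unc_I: "u \<in> I \<Longrightarrow> u \<noteq> y \<Longrightarrow> u \<in> unc E (eB \<union> P)"
  using P_notI[of u] xI inc_e[of u] by (auto simp: unc_def)

lemma P_at_R:
  assumes "f \<in> P" "inc f r" "R r" "f \<notin> N"
  shows "\<exists>g\<in>N. inc g r \<and> \<not> R (oth g r) \<and> PR (oth g r) (oth f r) \<and> S0 (oth f r)"
proof -
  have "f \<in> W0" using assms P(2) N0N by blast
  from W0_at_R[OF this assms(2,3)] show ?thesis unfolding rc_def by blast
qed

text \<open>Only edges of \<open>N0\<close> need an argument; their far end stays private. If it is
  in \<open>St\<close>, an uncovered vertex other than \<open>y\<close> remains next to it.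
  Otherwise no second edge meets the near end: an edge of \<open>W0\<close> there leads to a vertex
  of \<open>St\<close> and would have to come after the representative, although \<open>St\<close>
  comes first in the order. So the representative is \<open>iso\<close>.\<close>

lemma tr_par: "tr E eB P"
  unfolding tr_iff
proof (intro conjI ballI)
  show PE: "P \<subseteq> E" using P(2) N0W0E by blast
  show "eds E (eB \<union> P)" by (rule P(3))
  fix t assume t: "t \<in> P"
  show "ext E eB P t \<or> iso eB P t"
  proof (cases "t \<in> N0")
    case False
    then show ?thesis using P(4)[OF t] needed_iff[OF PE P(3) t] by blast
  next
    case True
    then have tN: "t \<in> N" and tx: "\<not> inc t x" by (auto simp: N0k_def)
    obtain r where r: "R r" "inc t r" "oth t r \<in> X" "\<not> cov (T - {t}) (oth t r)"
      "\<forall>f\<in>N \<union> W. inc f (oth t r) \<longrightarrow> f = t" by (rule N_priv[OF tN])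
    let ?q = "oth t r"
    have q: "inc t ?q" using inc_oth r(2) .
    have tE: "t \<in> E" using tN NE by auto
    have ne: "\<not> inc e v" if "inc t v" for v using that tx N_notI[OF tN] yI unfolding inc_e by blast
    have nB: "\<not> cov eB r" "\<not> cov eB ?q" using ne[OF r(2)] ne[OF q] r(1,3) by (auto simp: Rv_def)
    have Nq: "f = t" if "f \<in> N" "inc f ?q" for f using r(5) that by blast
    have Nr: "f = t" if "f \<in> N" "inc f r" for f using N_at_R[OF r(1) that(1) tN that(2) r(2)] .
    have Pq: "f = t" if f: "f \<in> P" "inc f ?q" for f
    proof (cases "f \<in> N")
      case True then show ?thesis using Nq f by blast
    next
      case False
      then have fW: "f \<in> W0" using f(1) P(2) N0N by blast
      show ?thesis
      proof (cases "R ?q")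
        case True
        then obtain g where "g \<in> N" "inc g ?q" "\<not> R (oth g ?q)" using P_at_R[OF f True False] by blast
        then show ?thesis using Nq[of g] oth_oth[OF tE r(2)] r(1) by auto
      next
        case nR: False
        then have "L ?q" using X_RL[OF r(3)] by blast
        then show ?thesis using W0_at_N[OF fW f(2) _ covI[OF tN q] ne[OF q]] by blast
      qed
    qed
    then have Pq': "\<not> cov (P - {t}) ?q" unfolding cov_def by blast
    show ?thesis
    proof (cases "S0 ?q")
      case True
      then obtain u where "u \<in> I" "u \<noteq> y" "adj E u ?q" unfolding St_def by blast
      then have "ext E eB P t" unfolding ext_def using q nB(2) Pq' unc_I by blast
      then show ?thesis ..
    next
      case False
      have "f = t" if f: "f \<in> P" "inc f r" for f
      proof (cases "f \<in> N")
        case True then show ?thesis using Nr f by blast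
      next
        case fN: False
        then obtain g where g: "g \<in> N" "inc g r" "PR (oth g r) (oth f r)" "S0 (oth f r)"
          using P_at_R[OF f r(1)] by blast
        then have "g = t" using Nr by blast
        then show ?thesis using g False by (simp add: prc_def)
      qed
      then have "\<not> cov (P - {t}) r" unfolding cov_def by blast
      then have "iso eB P t" using Pq' nB inc_cases[OF r(2)] unfolding iso_def by blast
      then show ?thesis ..
    qed
  qed
qed

text \<open>The vertices uncovered by the parent but covered by \<open>B \<union> T\<close> are the
  near end of the edge in \<open>Xf\<close> and neighbours of \<open>y\<close>. The formula excludes
  both and puts \<open>y\<close> back.\<close>

lemma dec_I: "{v. cov E v \<and> (v = y \<or> \<not> cov (eB \<union> P) v \<and> \<not> cov Xf v \<and> \<not> adj E v y)} = I"
proof -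
  have "v \<in> I" if v: "cov E v" "\<not> cov (eB \<union> P) v" "\<not> cov Xf v" "\<not> adj E v y" for v
  proof (rule ccontr)
    assume nI: "v \<notin> I"
    have n: "\<not> inc e v" "\<not> cov B v" "\<not> cov P v" using v(2) by auto
    have "\<not> cov N0 v" using n(3) P(1) cov_mono by blast
    then have nN: "\<not> cov N v" using v(3) N_eq by (metis cov_Un)
    have vX: "v \<in> X" using nI v(1) n by (auto simp: unc_def)
    have "\<not> R v"
    proof
      assume "R v"
      then show False using R_rp[OF _ v(1)] nN covI unfolding rp_def by blast
    qed
    then have Lv: "L v" using X_RL[OF vX] by blast
    show False
    proof (cases "S0 v")
      case True
      \<comment> \<open>The edge between \<open>u\<close> and \<open>v\<close> must be dominated,
        but both of its ends would be uncovered.\<close>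
      then obtain u where u: "u \<in> I" "u \<noteq> y" "adj E u v" unfolding St_def by blast
      then obtain f where f: "f \<in> E" "inc f u" "inc f v" "u \<noteq> v" unfolding adj_iff by blast
      then obtain w where "inc f w" "cov (eB \<union> P) w" using P(3) unfolding eds_iff by blast
      then have "cov (eB \<union> P) u" using inc_cases[OF f(3), of w] inc_cases[OF f(3,2)] f v(2) by auto
      then show False using unc_I[OF u(1,2)] unfolding unc_def by blast
    next
      case False
      then show False using weak[OF Lv False n(1)] v(4) unfolding adj_iff by blast
    qed
  qed
  moreover have "\<not> cov (eB \<union> P) v \<and> \<not> cov Xf v \<and> \<not> adj E v y" if "v \<in> I" "v \<noteq> y" for v
  proof -
    have "\<not> cov Xf v" using N_notI that(1) unfolding cov_def Xk_def by blast
    then show ?thesis using unc_I[OF that] I_indep[OF that(1)] yI by (auto simp: unc_def)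
  qed
  ultimately show ?thesis using yI by (auto simp: unc_def)
qed

text \<open>As \<open>x\<close> is last in the order, a representative that precedes an added edge
  does not meet \<open>x\<close> and is still present in the parent. So no added edge becomes a
  representative, and only \<open>Xf\<close> has to be supplied.\<close>

lemma dec_N: "Nk E B I PR P \<union> Xf = N"
proof (intro set_eqI iffI)
  fix f assume f: "f \<in> Nk E B I PR P \<union> Xf"
  show "f \<in> N"
  proof (rule ccontr)
    assume fN: "f \<notin> N"
    then have "f \<in> Nk E B I PR P" using f N_eq by blast
    then obtain r where r: "f \<in> P" "rp E B I PR P r f" unfolding Nk_def by blast
    then have rr: "inc f r" "R r" by (auto simp: rp_def)
    obtain g where g: "g \<in> N" "inc g r" "PR (oth g r) (oth f r)" using P_at_R[OF r(1) rr fN] by blast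
    have "\<not> inc g x"
    proof
      assume "inc g x"
      then have "oth g r = x" using inc_cases[OF g(2)] rr(2) xR by metis
      then show False using g(3) prc_x by simp
    qed
    then have "g \<in> P" using g(1) P(1) by (auto simp: N0k_def)
    then show False using r(2) g(2,3) by (auto simp: rp_def)
  qed
next
  fix f assume f: "f \<in> N"
  show "f \<in> Nk E B I PR P \<union> Xf"
  proof (cases "f \<in> N0")
    case False then show ?thesis using f N_eq by blast
  next
    case True
    obtain r where r: "rp E B I PR T r f" using f N_iff[of f] by blast
    then have rr: "inc f r" "R r" by (auto simp: rp_def)
    have "\<not> PR (oth g r) (oth f r)" if g: "g \<in> P" "inc g r" for g
    proof (cases "g \<in> N")
      case True
      then show ?thesis using N_at_R[OF rr(2) True f g(2) rr(1)] prD(1) by simp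
    next
      case False
      then obtain h where h: "h \<in> N" "inc h r" "PR (oth h r) (oth g r)" using P_at_R[OF g rr(2)] by blast
      then have "h = f" using N_at_R[OF rr(2) h(1) f h(2) rr(1)] by simp
      then show ?thesis using h(3) prD(1,2) by blast
    qed
    then have "rp E B I PR P r f" using rr by (auto simp: rp_def)
    then have "f \<in> Nk E B I PR P" using True P(1) rr(1) unfolding Nk_def inc_def by blast
    then show ?thesis ..
  qed
qed

end

end

subsection \<open>Enumerating the minimal covers between two sets of edges\<close>

definition covs :: "nat set \<Rightarrow> edge set \<Rightarrow> bool" where
  "covs X S \<longleftrightarrow> (\<forall>v\<in>X. cov S v)"

text \<open>Each fixed edge has a vertex of \<open>X\<close> reserved for it. Minimality is then a
  matter of the edges in \<open>W\<close> alone and is reached by deleting some of them.\<close>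

definition inv :: "nat set \<Rightarrow> edge set \<Rightarrow> edge set \<Rightarrow> bool" where
  "inv X A W \<longleftrightarrow> (\<forall>a\<in>A. \<exists>v\<in>X. inc a v \<and> (\<forall>f\<in>A \<union> W. inc f v \<longrightarrow> f = a))"

text \<open>
  \<open>bornt eB S0 S t\<close> says that \<open>t\<close> is no longer needed when \<open>e\<close> is added (lemma \<open>born_iff\<close>), and
  \<open>bf\<close> that some minimal cover between \<open>A\<close> and \<open>A \<union> W\<close> contains such an edge \<open>t\<close>: \<open>p\<close> is a vertex to be
  covered by \<open>t\<close> alone, and the other end of \<open>t\<close> is left to \<open>t\<close> as well (\<open>t2 = t\<close>) or is also covered by
  \<open>t2\<close>, which has a vertex of its own.
\<close>

definition bornt :: "edge set \<Rightarrow> (nat \<Rightarrow> bool) \<Rightarrow> edge set \<Rightarrow> edge \<Rightarrow> bool" where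
  "bornt eB S0 S t \<longleftrightarrow> (\<forall>p. inc t p \<longrightarrow> S0 p \<longrightarrow> cov (S - {t}) p) \<and>
     ((\<forall>p. inc t p \<longrightarrow> \<not> cov eB p) \<longrightarrow> (\<exists>p. inc t p \<and> cov (S - {t}) p))"

definition covAW :: "edge set \<Rightarrow> edge set \<Rightarrow> edge set \<Rightarrow> edge set \<Rightarrow> bool" where
  "covAW B A W S \<longleftrightarrow> (\<forall>f\<in>A \<union> W. (cov B (fst f) \<or> cov S (fst f)) \<and> (cov B (snd f) \<or> cov S (snd f)))"

definition bf :: "edge set \<Rightarrow> edge set \<Rightarrow> (nat \<Rightarrow> bool) \<Rightarrow> edge set \<Rightarrow> edge set \<Rightarrow> edge \<Rightarrow> edge \<Rightarrow> nat \<Rightarrow> bool" where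
  "bf B eB S0 A W t t2 p \<longleftrightarrow> \<not> cov B p \<and> \<not> S0 p \<and> \<not> cov (A - {t}) p \<and>
     ((t2 = t \<and> \<not> S0 (oth t p) \<and> (cov eB p \<or> cov eB (oth t p)) \<and>
        covAW B A W (insert t A \<union> {w\<in>W. \<not> inc w p})) \<or>
      (t2 \<noteq> t \<and> inc t2 (oth t p) \<and> \<not> cov B (oth t2 (oth t p)) \<and> \<not> cov (A - {t2}) (oth t2 (oth t p)) \<and>
        covAW B A W (insert t (insert t2 A) \<union> {w\<in>W. \<not> inc w p \<and> \<not> inc w (oth t2 (oth t p))})))"

definition bornf :: "edge set \<Rightarrow> edge set \<Rightarrow> (nat \<Rightarrow> bool) \<Rightarrow> edge set \<Rightarrow> edge set \<Rightarrow> bool" where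
  "bornf B eB S0 A W \<longleftrightarrow> (\<exists>t\<in>A \<union> W. \<exists>t2\<in>A \<union> W. bf B eB S0 A W t t2 (fst t) \<or> bf B eB S0 A W t t2 (snd t))"

text \<open>Nodes store just two edge lists. This recomputes the vertices to be covered, which are
  the same for all nodes that subdivide one group (\<open>Xs_eq\<close>).\<close>

definition Xs :: "edge set \<Rightarrow> edge set \<Rightarrow> nat set" where
  "Xs B S = {v. cov S v \<and> \<not> cov B v}"

lemma covAW_iff: "covAW B A W S \<longleftrightarrow> covs (Xs B (A \<union> W)) S"
  unfolding covAW_def covs_def Xs_def cov_def[of "A \<union> W"] inc_def by blast

lemma Comp_min:
  assumes "inv X A W" "A \<subseteq> S" "S \<subseteq> A \<union> W" "covs X S" "\<And>t. t \<in> S \<Longrightarrow> t \<notin> A \<Longrightarrow> \<not> covs X (S - {t})"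
  shows "S \<in> Comp X A W"
proof -
  have "\<exists>v\<in>X. inc t v \<and> \<not> cov (S - {t}) v" if t: "t \<in> S" for t
  proof (cases "t \<in> A")
    case True
    then obtain v where "v \<in> X" "inc t v" "\<forall>f\<in>A \<union> W. inc f v \<longrightarrow> f = t" using assms(1) unfolding inv_def by blast
    then show ?thesis using assms(3) unfolding cov_def by blast
  next
    case False
    then obtain v where v: "v \<in> X" "\<not> cov (S - {t}) v" using assms(5)[OF t] unfolding covs_def by blast
    then have "cov S v" using assms(4) unfolding covs_def by blast
    then show ?thesis using v unfolding cov_def by blast
  qed
  then show ?thesis using assms unfolding Comp_def mincov_def covs_def by blast
qed

lemma Comp_ex:
  assumes "finite A" "finite W" "inv X A W" "covs X (A \<union> W)"
  shows "\<exists>S. S \<in> Comp X A W"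
proof -
  let ?P = "\<lambda>S. A \<subseteq> S \<and> S \<subseteq> A \<union> W \<and> covs X S"
  have "?P (A \<union> W)" using assms(4) by blast
  from ex_has_least_nat[of ?P, OF this, of card]
  obtain S where S': "?P S \<and> (\<forall>S'. ?P S' \<longrightarrow> card S \<le> card S')" ..
  then have S: "?P S" "\<forall>S'. ?P S' \<longrightarrow> card S \<le> card S'" by simp_all
  have fS: "finite S" using S(1) assms(1,2) finite_subset by blast
  have "\<not> covs X (S - {t})" if "t \<in> S" "t \<notin> A" for t
  proof
    assume "covs X (S - {t})"
    then have "?P (S - {t})" using S(1) that by blast
    then have "card S \<le> card (S - {t})" using S(2) by blast
    then show False using card_Diff1_less[OF fS that(1)] by linarith
  qed
  then have "S \<in> Comp X A W" using S(1) by (intro Comp_min[OF assms(3)]) auto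
  then show ?thesis ..
qed

lemma CompD:
  assumes "S \<in> Comp X A W"
  shows "A \<subseteq> S" "S \<subseteq> A \<union> W" "v \<in> X \<Longrightarrow> cov S v" "t \<in> S \<Longrightarrow> \<exists>v\<in>X. inc t v \<and> \<not> cov (S - {t}) v"
  using assms unfolding Comp_def mincov_def by simp_all

lemma Comp_mono: "A \<subseteq> A' \<Longrightarrow> A' \<union> W' \<subseteq> A \<union> W \<Longrightarrow> Comp X A' W' \<subseteq> Comp X A W"
  unfolding Comp_def by blast

lemma Comp_leaf:
  assumes "inv X A W" "covs X A"
  shows "Comp X A W = {A}"
proof -
  have "S = A" if S: "S \<in> Comp X A W" for S
  proof (rule ccontr)
    assume "S \<noteq> A"
    then obtain t where t: "t \<in> S" "t \<notin> A" using CompD(1)[OF S] by blast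
    obtain v where v: "v \<in> X" "\<not> cov (S - {t}) v" using CompD(4)[OF S t(1)] by blast
    have "A \<subseteq> S - {t}" using CompD(1)[OF S] t by blast
    then show False using assms(2) v cov_mono[of A "S - {t}" v] unfolding covs_def by blast
  qed
  moreover have "A \<in> Comp X A W" by (rule Comp_min[OF assms(1)]) (use assms in auto)
  ultimately show ?thesis by blast
qed

lemma Comp_covs: "S \<in> Comp X A W \<Longrightarrow> covs X (A \<union> W)"
  unfolding covs_def using CompD(3) cov_mono[OF CompD(2)] by simp

section \<open>Branching on the edges of a cover at one vertex \<open>q\<close>\<close>

definition W1 :: "edge set \<Rightarrow> nat \<Rightarrow> edge set" where
  "W1 W q = {g\<in>W. \<not> inc g q}"

text \<open>Dropping all edges at \<open>q\<close> that do not lie beyond \<open>wj\<close> makes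
  \<open>wi\<close> and \<open>wj\<close> the first two in the order of far ends; dropping the edges
  at their far ends reserves these vertices.\<close>

definition W2 :: "edge set \<Rightarrow> nat \<Rightarrow> edge \<Rightarrow> edge \<Rightarrow> edge set" where
  "W2 W q wi wj = {g\<in>W. (inc g q \<longrightarrow> oth wj q < oth g q) \<and> \<not> inc g (oth wi q) \<and> \<not> inc g (oth wj q)}"

lemma inv_step1:
  assumes "inv X A W" "q \<in> X" "\<not> cov A q" "w \<in> W" "inc w q"
  shows "inv X (insert w A) (W1 W q)"
  unfolding inv_def
proof
  fix a assume a: "a \<in> insert w A"
  show "\<exists>v\<in>X. inc a v \<and> (\<forall>f\<in>insert w A \<union> W1 W q. inc f v \<longrightarrow> f = a)"
  proof (cases "a = w")
    case True
    have "\<forall>f\<in>insert w A \<union> W1 W q. inc f q \<longrightarrow> f = w" using assms(3) by (auto simp: W1_def cov_def)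
    then show ?thesis using True assms(2,5) by blast
  next
    case False
    then obtain v where v: "v \<in> X" "inc a v" "\<forall>f\<in>A \<union> W. inc f v \<longrightarrow> f = a" using assms(1) a unfolding inv_def by blast
    then have "\<forall>f\<in>insert w A \<union> W1 W q. inc f v \<longrightarrow> f = a" using assms(4) by (auto simp: W1_def)
    then show ?thesis using v by blast
  qed
qed

lemma Comp_W1:
  assumes "S \<in> Comp X (insert w A) (W1 W q)" "\<not> cov A q" "inc w q"
  shows "{g\<in>S. inc g q} = {w}"
  using CompD(1,2)[OF assms(1)] assms(2,3) by (auto simp: W1_def cov_def)

lemma Comp_W2:
  assumes "S \<in> Comp X (insert wi (insert wj A)) (W2 W q wi wj)" "\<not> cov A q"
  shows "wi \<in> S" "wj \<in> S" "g \<in> S \<Longrightarrow> inc g q \<Longrightarrow> g = wi \<or> g = wj \<or> oth wj q < oth g q"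
  using CompD(1,2)[OF assms(1)] assms(2) unfolding W2_def cov_def by blast+

context graph
begin

lemma inv_step2:
  assumes "inv X A W" "A \<subseteq> E" "W \<subseteq> E" "wi \<in> W" "wj \<in> W" "inc wi q" "inc wj q" "oth wi q < oth wj q"
    "oth wi q \<in> X" "oth wj q \<in> X" "\<not> cov A (oth wi q)" "\<not> cov A (oth wj q)"
  shows "inv X (insert wi (insert wj A)) (W2 W q wi wj)"
proof -
  let ?a = "oth wi q" and ?b = "oth wj q"
  have E: "wi \<in> E" "wj \<in> E" using assms by auto
  have i: "inc wi ?a" "inc wj ?b" using inc_oth assms by auto
  have n: "\<not> inc wi ?b" "\<not> inc wj ?a"
    using inc_cases[OF assms(6), of ?b] inc_cases[OF assms(7), of ?a] assms(8) oth_neq[OF E(1), of q] oth_neq[OF E(2), of q]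
    by auto
  show ?thesis unfolding inv_def
  proof
    fix a assume "a \<in> insert wi (insert wj A)"
    then consider "a = wi" | "a = wj" | "a \<in> A" by blast
    then show "\<exists>v\<in>X. inc a v \<and> (\<forall>f\<in>insert wi (insert wj A) \<union> W2 W q wi wj. inc f v \<longrightarrow> f = a)"
    proof cases
      case 1
      then show ?thesis using assms(9,11) i n unfolding W2_def cov_def by blast
    next
      case 2
      then show ?thesis using assms(10,12) i n unfolding W2_def cov_def by blast
    next
      case 3
      then show ?thesis using assms(1,4,5) unfolding inv_def W2_def by blast
    qed
  qed
qed

text \<open>If a minimal cover has several edges at \<open>q\<close>, none of them has
  \<open>q\<close> for itself, so each has its far end. The branch can be read off \<open>S\<close>:
  it is given by the edge at \<open>q\<close> if there is only one, and otherwise by the two with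
  the smallest far ends.\<close>

lemma Comp_branch:
  assumes S: "S \<in> Comp X A W" and q: "q \<in> X" "\<not> cov A q" and E: "A \<subseteq> E" "W \<subseteq> E"
  shows "(\<exists>w\<in>W. inc w q \<and> S \<in> Comp X (insert w A) (W1 W q)) \<or>
    (\<exists>wi\<in>W. \<exists>wj\<in>W. inc wi q \<and> inc wj q \<and> oth wi q < oth wj q \<and> oth wi q \<in> X \<and> oth wj q \<in> X \<and>
       \<not> cov A (oth wi q) \<and> \<not> cov A (oth wj q) \<and> S \<in> Comp X (insert wi (insert wj A)) (W2 W q wi wj))"
proof -
  let ?D = "{g\<in>S. inc g q}"
  note C = CompD[OF S]
  have mc: "mincov X S" using S by (simp add: Comp_def)
  have SE: "S \<subseteq> E" using C(2) E by blast
  have DW: "?D \<subseteq> W" using C(2) q(2) unfolding cov_def by blast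
  have finD: "finite ?D" using SE fin finite_subset by fastforce
  have inj: "g = h" if "g \<in> ?D" "h \<in> ?D" "oth g q = oth h q" for g h
    using same_edge_oth[of g h q] that SE by blast
  have "?D \<noteq> {}" using C(3)[OF q(1)] unfolding cov_def by blast
  moreover have lin: "linord ((<) :: nat \<Rightarrow> nat \<Rightarrow> bool)" by (auto simp: linord_def)
  ultimately obtain wi where wi: "wi \<in> ?D" "\<forall>g\<in>?D. \<not> oth g q < oth wi q"
    using linord_min[OF lin finD, of "\<lambda>g. oth g q"] by blast
  show ?thesis
  proof (cases "?D = {wi}")
    case True
    then have "S \<in> Comp X (insert wi A) (W1 W q)" using C(1,2) mc wi(1) unfolding Comp_def W1_def by blast
    then show ?thesis using wi(1) DW by blast
  next
    case False
    then have "?D - {wi} \<noteq> {}" using wi(1) by blast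
    moreover have "finite (?D - {wi})" using finD by blast
    ultimately obtain wj where wj: "wj \<in> ?D - {wi}" "\<forall>g\<in>?D - {wi}. \<not> oth g q < oth wj q"
      using linord_min[OF lin, of "?D - {wi}" "\<lambda>g. oth g q"] by blast
    have lt: "oth wi q < oth wj q"
    proof -
      have "oth wi q \<noteq> oth wj q" using inj[of wi wj] wi(1) wj(1) by blast
      moreover have "\<not> oth wj q < oth wi q" using wi(2) wj(1) by blast
      ultimately show ?thesis by simp
    qed
    have gt: "oth wj q < oth g q" if "g \<in> ?D" "g \<noteq> wi" "g \<noteq> wj" for g
    proof -
      have "oth g q \<noteq> oth wj q" using inj[of g wj] wj(1) that by blast
      moreover have "\<not> oth g q < oth wj q" using wj(2) that by blast
      ultimately show ?thesis by simp
    qed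
    have priv: "oth w q \<in> X \<and> \<not> cov (S - {w}) (oth w q)" if w: "w \<in> ?D" "w' \<in> ?D" "w \<noteq> w'" for w w'
    proof -
      obtain v where v: "v \<in> X" "inc w v" "\<not> cov (S - {w}) v" using C(4)[of w] w(1) by blast
      have "v \<noteq> q" using v(3) w unfolding cov_def by blast
      then have "v = oth w q" using inc_cases[of w q v] w(1) v(2) by blast
      then show ?thesis using v by blast
    qed
    have pi: "oth wi q \<in> X" "\<not> cov (S - {wi}) (oth wi q)" and pj: "oth wj q \<in> X" "\<not> cov (S - {wj}) (oth wj q)"
      using priv[of wi wj] priv[of wj wi] wi(1) wj(1) by blast+
    have nA: "wi \<notin> A" "wj \<notin> A" using q(2) wi(1) wj(1) unfolding cov_def by blast+
    then have cA: "\<not> cov A (oth wi q)" "\<not> cov A (oth wj q)" using pi pj C(1) unfolding cov_def by blast+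
    have "g \<in> W2 W q wi wj" if g: "g \<in> S" "g \<notin> A" "g \<noteq> wi" "g \<noteq> wj" for g
      using g C(2) gt[of g] pi(2) pj(2) unfolding W2_def cov_def by blast
    then have "S \<in> Comp X (insert wi (insert wj A)) (W2 W q wi wj)"
      using C(1) mc wi(1) wj(1) unfolding Comp_def by blast
    then show ?thesis using wi(1) wj(1) DW lt pi pj cA by blast
  qed
qed

text \<open>The edges \<open>t\<close> and, if different, \<open>t2\<close> become fixed edges with
  the reserved vertices \<open>p\<close> and the far end of \<open>t2\<close>; the other edges of
  \<open>W\<close> at these vertices are dropped. The coverage test makes the smaller range
  inhabited by \<open>Comp_ex\<close>, and \<open>bornt\<close> holds for \<open>t\<close> in any of
  its members.\<close>

lemma bf_sound:
  assumes b: "bf B eB S0 A W t t2 p" and t: "t \<in> A \<union> W" "t2 \<in> A \<union> W" "inc t p"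
    and E: "A \<subseteq> E" "W \<subseteq> E" and iv: "inv (Xs B (A \<union> W)) A W"
  shows "\<exists>S\<in>Comp (Xs B (A \<union> W)) A W. \<exists>t\<in>S. bornt eB S0 S t"
proof -
  let ?X = "Xs B (A \<union> W)" and ?z = "oth t p"
  have tE: "t \<in> E" "t2 \<in> E" using t E by auto
  have z: "inc t ?z" using inc_oth t(3) .
  have tz: "v = p \<or> v = ?z" if "inc t v" for v using inc_cases[OF t(3) that] by blast
  have fA: "finite A" "finite W" using E fin finite_subset by blast+
  have p: "p \<in> ?X" "\<not> S0 p" "\<not> cov (A - {t}) p" using b covI[OF t(1,3)] by (auto simp: bf_def Xs_def)
  consider (1) "t2 = t" "\<not> S0 ?z" "cov eB p \<or> cov eB ?z" "covs ?X (insert t A \<union> {w\<in>W. \<not> inc w p})"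
    | (2) "t2 \<noteq> t" "inc t2 ?z" "\<not> cov B (oth t2 ?z)" "\<not> cov (A - {t2}) (oth t2 ?z)"
       "covs ?X (insert t (insert t2 A) \<union> {w\<in>W. \<not> inc w p \<and> \<not> inc w (oth t2 ?z)})"
    using b unfolding bf_def covAW_iff by blast
  then show ?thesis
  proof cases
    case 1
    let ?W = "{w\<in>W. \<not> inc w p}"
    have "inv ?X (insert t A) ?W" unfolding inv_def
    proof
      fix a assume a: "a \<in> insert t A"
      show "\<exists>v\<in>?X. inc a v \<and> (\<forall>f\<in>insert t A \<union> ?W. inc f v \<longrightarrow> f = a)"
      proof (cases "a = t")
        case True then show ?thesis using p t(3) unfolding cov_def by blast
      next
        case False then show ?thesis using iv a t(1) unfolding inv_def by blast
      qed
    qed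
    then obtain S where S: "S \<in> Comp ?X (insert t A) ?W" using Comp_ex[of "insert t A" ?W ?X] fA 1(4) by auto
    then have "S \<in> Comp ?X A W" using Comp_mono[of A "insert t A" ?W W ?X] t(1) by blast
    moreover have "t \<in> S" using CompD(1)[OF S] by blast
    moreover have "bornt eB S0 S t" using 1(2,3) p(2) tz t(3) z unfolding bornt_def by blast
    ultimately show ?thesis by blast
  next
    case 2
    let ?c = "oth t2 ?z" and ?A = "insert t (insert t2 A)"
    let ?W = "{w\<in>W. \<not> inc w p \<and> \<not> inc w ?c}"
    have c: "inc t2 ?c" using inc_oth 2(2) .
    have c2: "v = ?z \<or> v = ?c" if "inc t2 v" for v using inc_cases[OF 2(2) that] by blast
    have cX: "?c \<in> ?X" using 2(3) covI[OF t(2) c] by (simp add: Xs_def)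
    have ne: "p \<noteq> ?c"
    proof
      assume "p = ?c"
      then have "inc t2 p" using c by simp
      then have "t2 = t" using same_edge[of t2 t p ?z] tE t(3) z 2(2) oth_neq[OF tE(1), of p] by auto
      then show False using 2(1) by blast
    qed
    have n: "\<not> inc t2 p" "\<not> inc t ?c"
      using c2[of p] tz[of ?c] ne oth_neq[OF tE(1), of p] oth_neq[OF tE(2), of ?z] by auto
    have "inv ?X ?A ?W" unfolding inv_def
    proof
      fix a assume a: "a \<in> ?A"
      show "\<exists>v\<in>?X. inc a v \<and> (\<forall>f\<in>?A \<union> ?W. inc f v \<longrightarrow> f = a)"
      proof (cases "a = t")
        case True then show ?thesis using p t(3) n unfolding cov_def by blast
      next
        case F: False
        show ?thesis
        proof (cases "a = t2")
          case True then show ?thesis using cX c n 2(4) unfolding cov_def by blast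
        next
          case False then show ?thesis using iv a t(1,2) F unfolding inv_def by blast
        qed
      qed
    qed
    then obtain S where S: "S \<in> Comp ?X ?A ?W" using Comp_ex[of ?A ?W ?X] fA 2(5) by auto
    then have "S \<in> Comp ?X A W" using Comp_mono[of A ?A ?W W ?X] t(1,2) by blast
    moreover have tS: "t \<in> S" "t2 \<in> S" using CompD(1)[OF S] by blast+
    moreover have "bornt eB S0 S t"
    proof -
      have "cov (S - {t}) ?z" using tS 2(1,2) by (auto simp: cov_def)
      then show ?thesis using p(2) tz z unfolding bornt_def by blast
    qed
    ultimately show ?thesis by blast
  qed
qed

text \<open>Let \<open>p\<close> be the private vertex of \<open>t\<close>. If the other end of
  \<open>t\<close> is shared with an edge \<open>t2\<close>, then \<open>t2\<close> has its private
  vertex at its opposite end; if not, \<open>t\<close> alone is the witness.\<close>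

lemma bf_complete:
  assumes S: "S \<in> Comp (Xs B (A \<union> W)) A W" and t: "t \<in> S" "bornt eB S0 S t"
    and E: "A \<subseteq> E" "W \<subseteq> E"
  shows "\<exists>t2\<in>A \<union> W. \<exists>p. inc t p \<and> bf B eB S0 A W t t2 p"
proof -
  let ?X = "Xs B (A \<union> W)"
  note C = CompD[OF S]
  obtain p where p: "p \<in> ?X" "inc t p" "\<not> cov (S - {t}) p" using C(4)[OF t(1)] by blast
  let ?z = "oth t p"
  have z: "inc t ?z" using inc_oth p(2) .
  have tz: "v = p \<or> v = ?z" if "inc t v" for v using inc_cases[OF p(2) that] by blast
  have p1: "\<not> cov B p" "\<not> S0 p" "\<not> cov (A - {t}) p"
    using p t(2) C(1) unfolding bornt_def Xs_def cov_def by blast+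
  have only: "inc g p \<Longrightarrow> g \<in> S \<Longrightarrow> g = t" for g using p(3) unfolding cov_def by blast
  show ?thesis
  proof (cases "cov (S - {t}) ?z")
    case True
    then obtain t2 where t2: "t2 \<in> S" "t2 \<noteq> t" "inc t2 ?z" unfolding cov_def by blast
    obtain c where c: "c \<in> ?X" "inc t2 c" "\<not> cov (S - {t2}) c" using C(4)[OF t2(1)] by blast
    have "c \<noteq> ?z" using c(3) z t(1) t2(2) unfolding cov_def by blast
    then have cc: "c = oth t2 ?z" using inc_cases[OF t2(3) c(2)] by blast
    have oc: "inc g c \<Longrightarrow> g \<in> S \<Longrightarrow> g = t2" for g using c(3) unfolding cov_def by blast
    have c1: "\<not> cov B c" "\<not> cov (A - {t2}) c" using c C(1) unfolding Xs_def cov_def by blast+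
    have "S \<subseteq> insert t (insert t2 A) \<union> {w\<in>W. \<not> inc w p \<and> \<not> inc w c}" using C(2) only oc by blast
    then have "covAW B A W (insert t (insert t2 A) \<union> {w\<in>W. \<not> inc w p \<and> \<not> inc w c})"
      using C(3) cov_mono[of S] unfolding covAW_iff covs_def by (simp only: Ball_def) blast
    then have "bf B eB S0 A W t t2 p" unfolding bf_def using p1 c1 t2(2,3) cc by blast
    then show ?thesis using t2(1) C(2) p(2) by blast
  next
    case False
    then have zz: "\<not> S0 ?z" "cov eB p \<or> cov eB ?z" using t(2) z p(3) tz unfolding bornt_def by blast+
    have "S \<subseteq> insert t A \<union> {w\<in>W. \<not> inc w p}" using C(2) only by blast
    then have "covAW B A W (insert t A \<union> {w\<in>W. \<not> inc w p})"
      using C(3) cov_mono[of S] unfolding covAW_iff covs_def by (simp only: Ball_def) blast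
    then have "bf B eB S0 A W t t p" unfolding bf_def using p1 zz by blast
    then show ?thesis using t(1) C(2) p(2) by blast
  qed
qed

lemma bornf_iff:
  assumes E: "A \<subseteq> E" "W \<subseteq> E" and iv: "inv (Xs B (A \<union> W)) A W"
  shows "bornf B eB S0 A W \<longleftrightarrow> (\<exists>S\<in>Comp (Xs B (A \<union> W)) A W. \<exists>t\<in>S. bornt eB S0 S t)"
proof
  assume "bornf B eB S0 A W"
  then obtain t t2 p where "t \<in> A \<union> W" "t2 \<in> A \<union> W" "inc t p" "bf B eB S0 A W t t2 p"
    unfolding bornf_def inc_def by blast
  then show "\<exists>S\<in>Comp (Xs B (A \<union> W)) A W. \<exists>t\<in>S. bornt eB S0 S t" using bf_sound E iv by blast
next
  assume "\<exists>S\<in>Comp (Xs B (A \<union> W)) A W. \<exists>t\<in>S. bornt eB S0 S t"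
  then obtain S t where S: "S \<in> Comp (Xs B (A \<union> W)) A W" "t \<in> S" "bornt eB S0 S t" by blast
  then obtain t2 p where "t2 \<in> A \<union> W" "inc t p" "bf B eB S0 A W t t2 p" using bf_complete E by blast
  moreover have "t \<in> A \<union> W" using S CompD(2) by blast
  ultimately show "bornf B eB S0 A W" unfolding bornf_def inc_def by blast
qed

subsection \<open>Parents of the remaining solutions\<close>

lemma tr_noe: "tr E (insert e B) T \<Longrightarrow> e \<notin> T"
proof
  assume a: "tr E (insert e B) T" "e \<in> T"
  then have "insert e B \<union> (T - {e}) = insert e B \<union> T" by blast
  then show False using a unfolding tr_def by metis
qed

lemma tr_same:
  assumes "tr E (insert e B) T" "eds E (B \<union> T)"
  shows "tr E B T"
proof -
  have "\<not> eds E (B \<union> (T - {t}))" if "t \<in> T" for t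
    using assms(1) that eds_mono[of "B \<union> (T - {t})" "insert e B \<union> (T - {t})"] unfolding tr_def by blast
  then show ?thesis using assms unfolding tr_def by blast
qed

lemma tr_add:
  assumes "tr E (insert e B) T" "\<not> eds E (B \<union> T)" "e \<in> E"
  shows "tr E B (insert e T)"
proof -
  have ne: "e \<notin> T" using tr_noe assms(1) .
  have 1: "B \<union> insert e T = insert e B \<union> T" by blast
  have "\<not> eds E (B \<union> (insert e T - {t}))" if t: "t \<in> insert e T" for t
  proof (cases "t = e")
    case True
    then have "B \<union> (insert e T - {t}) = B \<union> T" using ne by blast
    then show ?thesis using assms(2) by simp
  next
    case False
    then have "B \<union> (insert e T - {t}) = insert e B \<union> (T - {t})" by blast
    then show ?thesis using assms(1) t False unfolding tr_def by auto
  qed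
  then show ?thesis using assms(1,3) 1 unfolding tr_def by auto
qed

lemma tr_del:
  assumes "tr E B T" "e \<in> T"
  shows "tr E (insert e B) (T - {e})" "\<not> eds E (B \<union> (T - {e}))"
proof -
  have 1: "insert e B \<union> (T - {e}) = B \<union> T" using assms(2) by blast
  have "\<not> eds E (insert e B \<union> (T - {e} - {t}))" if t: "t \<in> T - {e}" for t
  proof -
    have "insert e B \<union> (T - {e} - {t}) = B \<union> (T - {t})" using t assms(2) by blast
    then show ?thesis using assms(1) t unfolding tr_def by auto
  qed
  then show "tr E (insert e B) (T - {e})" using assms(1) 1 unfolding tr_def by auto
  show "\<not> eds E (B \<union> (T - {e}))" using assms unfolding tr_def by blast
qed

text \<open>A dropped edge dominated something that \<open>e\<close> now dominates, so it privately
  covers an end of \<open>e\<close>, both ends being covered already. There are two ends, and each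
  is private to at most one edge.\<close>

lemma red_two:
  assumes T: "tr E B T" "\<not> tr E (insert e B) T" and cv: "\<And>v. inc e v \<Longrightarrow> cov (B \<union> T) v"
    and P: "P \<subseteq> T" "eds E (insert e B \<union> P)" "\<And>t. t \<in> P \<Longrightarrow> \<not> eds E (insert e B \<union> (P - {t}))"
  shows "tr E (insert e B) P" "\<exists>s1\<in>E. \<exists>s2\<in>E. T = P \<union> {s1, s2}"
proof -
  show trP: "tr E (insert e B) P" using P T(1) unfolding tr_def by blast
  have ex: "\<exists>v. inc e v \<and> inc t v \<and> \<not> cov (T - {t}) v" if t: "t \<in> T - P" for t
  proof -
    have "\<not> eds E (B \<union> (T - {t}))" using T(1) t unfolding tr_def by blast
    then obtain f where f: "f \<in> E" "\<And>v. inc f v \<Longrightarrow> \<not> cov (B \<union> (T - {t})) v" unfolding eds_iff by blast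
    then obtain v where v: "inc f v" "cov (insert e B \<union> P) v" using P(2) unfolding eds_iff by blast
    have "P \<subseteq> T - {t}" using t P(1) by blast
    then have ev: "inc e v" using v f(2)[OF v(1)] cov_mono[of P "T - {t}" v] by auto
    then have "inc t v" using cv[OF ev] f(2)[OF v(1)] unfolding cov_def by blast
    then show ?thesis using ev f(2)[OF v(1)] by auto
  qed
  have "T \<noteq> P" using trP T(2) by blast
  then obtain s where s: "s \<in> T - P" using P(1) by blast
  have uniq: "t = t'" if "t \<in> T" "t' \<in> T" "inc t v" "inc t' v" "\<not> cov (T - {t}) v" for t t' v
    using that unfolding cov_def by blast
  have "\<exists>s2\<in>T. T - P \<subseteq> {s, s2}"
  proof (cases "T - P \<subseteq> {s}")
    case True then show ?thesis using s by blast
  next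
    case False
    then obtain s2 where s2: "s2 \<in> T - P" "s2 \<noteq> s" by blast
    have "s3 \<in> {s, s2}" if s3: "s3 \<in> T - P" for s3
    proof -
      obtain v1 v2 v3 where v: "inc e v1" "inc s v1" "\<not> cov (T - {s}) v1" "inc e v2" "inc s2 v2" "\<not> cov (T - {s2}) v2"
        "inc e v3" "inc s3 v3" "\<not> cov (T - {s3}) v3" using ex[OF s] ex[OF s2(1)] ex[OF s3] by blast
      have "v1 \<noteq> v2" using uniq[of s s2 v1] v s s2 by blast
      moreover have "v3 = v1 \<or> v3 = v2" using v(1,4,7) \<open>v1 \<noteq> v2\<close> by (auto simp: inc_def)
      ultimately show ?thesis using uniq[of s s3 v1] uniq[of s2 s3 v2] v s s2 s3 by blast
    qed
    then show ?thesis using s2(1) by blast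
  qed
  then obtain s2 where s2: "s2 \<in> T" "T - P \<subseteq> {s, s2}" by blast
  then have "T = P \<union> {s, s2}" using P(1) s by blast
  then show "\<exists>s1\<in>E. \<exists>s2\<in>E. T = P \<union> {s1, s2}" using s s2(1) T(1) unfolding tr_def by blast
qed

end

context open_end
begin

text \<open>Since \<open>x\<close> is covered before, adding \<open>e\<close> removes only
  \<open>y\<close> from the uncovered vertices. So \<open>ext\<close> persists exactly at private
  vertices in \<open>St\<close>.\<close>

lemma born_iff: "\<not> tr E eB T \<longleftrightarrow> (\<exists>t\<in>T. bornt eB S0 T t)"
proof -
  have eds: "eds E (eB \<union> T)" using eds_mono[OF _ edsT, of "eB \<union> T"] by blast
  have unc: "unc E (eB \<union> T) = I - {y}" using xI inc_e by (auto simp: unc_def)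
  have "ext E eB T t \<or> iso eB T t \<longleftrightarrow> \<not> bornt eB S0 T t" if t: "t \<in> T" for t
  proof -
    have "ext E eB T t \<longleftrightarrow> (\<exists>p. inc t p \<and> S0 p \<and> \<not> cov (T - {t}) p)"
      unfolding ext_def unc St_def using T_notI[OF t] by auto
    then show ?thesis unfolding bornt_def iso_def by blast
  qed
  then show ?thesis unfolding tr_iff using eds TE by blast
qed

lemma Xs_eq: "Xs B (N \<union> W) = X"
proof -
  have "cov (N \<union> W) v \<longleftrightarrow> cov T v" if "\<not> cov B v" for v
  proof
    assume a: "cov (N \<union> W) v"
    then have "v \<notin> I" using W_notI by (auto simp: cov_def)
    moreover have "cov E v" using a NWE cov_mono by blast
    ultimately show "cov T v" using that by (auto simp: unc_def)
  next
    assume "cov T v" then show "cov (N \<union> W) v" using T_sub cov_mono by blast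
  qed
  then show ?thesis by (auto simp: Xs_def)
qed

lemma inv_NW: "inv X N W"
  unfolding inv_def
proof
  fix a assume a: "a \<in> N"
  obtain r where "inc a r" "oth a r \<in> X" "\<forall>f\<in>N \<union> W. inc f (oth a r) \<longrightarrow> f = a" by (rule N_priv[OF a])
  then show "\<exists>v\<in>X. inc a v \<and> (\<forall>f\<in>N \<union> W. inc f v \<longrightarrow> f = a)" using inc_oth by blast
qed

lemma covs_NW: "covs X (N \<union> W)"
  using T_Comp Comp_covs by blast

end

section \<open>The search tree\<close>

definition vl :: "edge list \<Rightarrow> nat list" where
  "vl es = map fst es @ map snd es"

definition ul :: "edge list \<Rightarrow> edge list \<Rightarrow> nat list" where
  "ul es S = filter (\<lambda>v. \<not> cov (set S) v) (vl es)"

text \<open>A normal form: each set of edges of \<open>es\<close> has exactly one such list.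
  Equality of lists, by which parents are compared and duplicate nodes removed, is thus equality of
  sets.\<close>

definition canon :: "edge list \<Rightarrow> edge list \<Rightarrow> bool" where
  "canon es T \<longleftrightarrow> T = filter (\<lambda>f. f \<in> set T) es"

definition unionl :: "edge list \<Rightarrow> edge list \<Rightarrow> edge list \<Rightarrow> edge list" where
  "unionl es A W = filter (\<lambda>f. f \<in> set A \<or> f \<in> set W) es"

definition remv :: "edge \<Rightarrow> edge list \<Rightarrow> edge list" where
  "remv t T = filter (\<lambda>g. g \<noteq> t) T"

definition trl :: "edge list \<Rightarrow> edge list \<Rightarrow> edge list \<Rightarrow> bool" where
  "trl es B T \<longleftrightarrow> (\<forall>t\<in>set T. t \<in> set es) \<and> eds (set es) (set (B @ T)) \<and>
     (\<forall>t\<in>set T. \<not> eds (set es) (set (B @ remv t T)))"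

definition natl :: "edge list \<Rightarrow> edge \<Rightarrow> edge list \<Rightarrow> edge list \<Rightarrow> edge list" where
  "natl es e B T = (if eds (set es) (set (B @ T)) then T else unionl es [e] T)"

definition redl :: "edge list \<Rightarrow> edge list \<Rightarrow> edge list \<Rightarrow> edge list" where
  "redl es B T = minz (\<lambda>S. eds (set es) (set (B @ S))) T T"

definition Nl :: "edge list \<Rightarrow> edge \<Rightarrow> edge list \<Rightarrow> nat list \<Rightarrow> nat \<Rightarrow> edge list \<Rightarrow> edge list" where
  "Nl es e B il y T = filter (\<lambda>f. rp (set es) (set B) (set il) (prc (set es) e (set B) y (set il)) (set T) (fst f) f \<or>
     rp (set es) (set B) (set il) (prc (set es) e (set B) y (set il)) (set T) (snd f) f) T"

definition Wl :: "edge list \<Rightarrow> edge \<Rightarrow> edge list \<Rightarrow> nat list \<Rightarrow> nat \<Rightarrow> edge list \<Rightarrow> edge list" where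
  "Wl es e B il y N = filter (\<lambda>f. f \<notin> set N \<and>
     (okw (set es) (set B) (set il) (prc (set es) e (set B) y (set il)) (set N) (fst f) (snd f) \<or>
      okw (set es) (set B) (set il) (prc (set es) e (set B) y (set il)) (set N) (snd f) (fst f))) es"

definition W0l :: "edge list \<Rightarrow> edge \<Rightarrow> edge list \<Rightarrow> nat list \<Rightarrow> nat \<Rightarrow> edge list \<Rightarrow> edge list" where
  "W0l es e B il y N = filter (\<lambda>f. f \<notin> set N \<and>
     (okw0 (set es) e (set B) y (set il) (set N) (fst f) (snd f) \<or>
      okw0 (set es) e (set B) y (set il) (set N) (snd f) (fst f))) es"

definition Xl :: "edge \<Rightarrow> nat \<Rightarrow> edge list \<Rightarrow> edge list" where
  "Xl e y N = filter (\<lambda>f. inc f (oth e y)) N"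

definition parb :: "edge list \<Rightarrow> edge \<Rightarrow> edge list \<Rightarrow> nat list \<Rightarrow> nat \<Rightarrow> edge list \<Rightarrow> edge list" where
  "parb es e B il y N = minz (\<lambda>S. eds (set es) (set ((e # B) @ S)))
     (unionl es (filter (\<lambda>f. \<not> inc f (oth e y)) N) (W0l es e B il y N)) (W0l es e B il y N)"

text \<open>Meant for the case that an end of \<open>e\<close> is uncovered. A solution leaves at
  most one end uncovered, as it dominates \<open>e\<close> (\<open>uy_unique\<close>).\<close>

definition uy :: "edge \<Rightarrow> edge list \<Rightarrow> nat" where
  "uy e S = (if cov (set S) (fst e) then snd e else fst e)"

definition covd :: "edge \<Rightarrow> edge list \<Rightarrow> bool" where
  "covd e S \<longleftrightarrow> cov (set S) (fst e) \<and> cov (set S) (snd e)"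

definition parl :: "edge list \<Rightarrow> edge \<Rightarrow> edge list \<Rightarrow> edge list \<Rightarrow> edge list" where
  "parl es e B T = (if trl es (e # B) (remv e T) then remv e T
     else if covd e (B @ T) then redl es (e # B) T
     else parb es e B (ul es (B @ T)) (uy e (B @ T)) (Nl es e B (ul es (B @ T)) (uy e (B @ T)) T))"

definition candA :: "edge list \<Rightarrow> edge \<Rightarrow> edge list \<Rightarrow> edge list \<Rightarrow> edge list list" where
  "candA es e B T = filter (\<lambda>T'. trl es B T' \<and> \<not> trl es (e # B) (remv e T') \<and> covd e (B @ T') \<and>
     redl es (e # B) T' = T) (concat (map (\<lambda>s1. map (\<lambda>s2. unionl es T [s1, s2]) es) es))"

text \<open>
  A group is recovered from its parent \<open>T\<close>, the uncovered end \<open>y\<close> of \<open>e\<close>, and the representative edge at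
  the other end of \<open>e\<close>, if any, which \<open>Xf\<close> lists.
\<close>

definition deci :: "edge list \<Rightarrow> edge \<Rightarrow> edge list \<Rightarrow> edge list \<Rightarrow> nat \<Rightarrow> edge list \<Rightarrow> nat list" where
  "deci es e B T y Xf = filter (\<lambda>v. v = y \<or> (\<not> cov (set ((e # B) @ T)) v \<and> \<not> cov (set Xf) v \<and> \<not> adj (set es) v y)) (vl es)"

text \<open>Finds some member of the group, not a particular one. With \<open>il\<close> the
  uncovered vertices, the test asks for coverage of precisely the vertices in
  \<open>X\<close>.\<close>

definition minX :: "edge list \<Rightarrow> edge list \<Rightarrow> nat list \<Rightarrow> edge list \<Rightarrow> edge list \<Rightarrow> edge list" where
  "minX es B il N W = minz (\<lambda>S. \<forall>v\<in>set (vl es). v \<in> set il \<or> cov (set B) v \<or> cov (set S) v) (unionl es N W) W"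

definition decl1 :: "edge list \<Rightarrow> edge \<Rightarrow> edge list \<Rightarrow> nat list \<Rightarrow> nat \<Rightarrow> edge list \<Rightarrow> edge list" where
  "decl1 es e B il y N = minX es B il N (Wl es e B il y N)"

definition decl :: "edge list \<Rightarrow> edge \<Rightarrow> edge list \<Rightarrow> edge list \<Rightarrow> nat \<Rightarrow> edge list \<Rightarrow> edge list" where
  "decl es e B T y Xf = decl1 es e B (deci es e B T y Xf) y
     (unionl es (Nl es e B (deci es e B T y Xf) y T) Xf)"

definition bornl :: "edge list \<Rightarrow> edge \<Rightarrow> edge list \<Rightarrow> nat list \<Rightarrow> nat \<Rightarrow> edge list \<Rightarrow> edge list \<Rightarrow> bool" where
  "bornl es e B il y A W \<longleftrightarrow> bornf (set B) (set (e # B)) (St (set es) e (set B) y (set il)) (set A) (set W)"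

text \<open>
  A node \<open>(False, B, T, [])\<close> is the solution \<open>T\<close> at level \<open>B\<close>; a node \<open>(True, e # B, A, W)\<close> stands for the
  solutions born at level \<open>B\<close> that are minimal covers between \<open>A\<close> and \<open>A \<union> W\<close>.
\<close>

type_synonym node = "bool \<times> edge list \<times> edge list \<times> edge list"

text \<open>All checks refer to the decoded \<open>T'\<close> itself, so a wrong guess of
  \<open>y\<close> or \<open>Xf\<close> may decode to anything without harm; that decoding inverts
  the parent map matters only for completeness.\<close>

definition gB2 :: "edge list \<Rightarrow> edge \<Rightarrow> edge list \<Rightarrow> edge list \<Rightarrow> nat \<Rightarrow> edge list \<Rightarrow> edge list \<Rightarrow> nat list \<Rightarrow> edge list \<Rightarrow> edge list \<Rightarrow> node list" where
  "gB2 es e B T y Xf T' il N W = (if trl es B T' \<and> \<not> cov (set (B @ T')) y \<and> Xl e y N = Xf \<and>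
     parb es e B il y N = T \<and> bornl es e B il y N W then [(True, e # B, N, W)] else [])"

definition gB1 :: "edge list \<Rightarrow> edge \<Rightarrow> edge list \<Rightarrow> edge list \<Rightarrow> nat \<Rightarrow> edge list \<Rightarrow> edge list \<Rightarrow> nat list \<Rightarrow> edge list \<Rightarrow> node list" where
  "gB1 es e B T y Xf T' il N = gB2 es e B T y Xf T' il N (Wl es e B il y N)"

definition gB :: "edge list \<Rightarrow> edge \<Rightarrow> edge list \<Rightarrow> edge list \<Rightarrow> nat \<Rightarrow> edge list \<Rightarrow> edge list \<Rightarrow> node list" where
  "gB es e B T y Xf T' = gB1 es e B T y Xf T' (ul es (B @ T')) (Nl es e B (ul es (B @ T')) y T')"

definition candB :: "edge list \<Rightarrow> edge \<Rightarrow> edge list \<Rightarrow> edge list \<Rightarrow> node list" where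
  "candB es e B T = concat (map (\<lambda>y. concat (map (\<lambda>Xf. gB es e B T y Xf (decl es e B T y Xf))
     ([] # map (\<lambda>f. [f]) es))) [fst e, snd e])"

definition childA :: "edge list \<Rightarrow> edge \<Rightarrow> edge list \<Rightarrow> edge list \<Rightarrow> node list" where
  "childA es e B T = (False, B, natl es e B T, []) # map (\<lambda>T'. (False, B, T', [])) (candA es e B T) @ candB es e B T"

definition W1l :: "edge list \<Rightarrow> nat \<Rightarrow> edge list" where
  "W1l W q = filter (\<lambda>g. \<not> inc g q) W"

definition W2l :: "edge list \<Rightarrow> nat \<Rightarrow> edge \<Rightarrow> edge \<Rightarrow> edge list" where
  "W2l W q wi wj = filter (\<lambda>g. (inc g q \<longrightarrow> oth wj q < oth g q) \<and> \<not> inc g (oth wi q) \<and> \<not> inc g (oth wj q)) W"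

definition ch1 :: "edge list \<Rightarrow> edge list \<Rightarrow> edge list \<Rightarrow> edge list \<Rightarrow> nat \<Rightarrow> node list" where
  "ch1 es rest A W q = map (\<lambda>w. (True, rest, unionl es [w] A, W1l W q)) (filter (\<lambda>w. inc w q) W)"

definition ok2 :: "edge list \<Rightarrow> edge list \<Rightarrow> nat \<Rightarrow> edge \<Rightarrow> edge \<Rightarrow> bool" where
  "ok2 B A q wi wj \<longleftrightarrow> inc wi q \<and> inc wj q \<and> oth wi q < oth wj q \<and> \<not> cov (set B) (oth wi q) \<and> \<not> cov (set B) (oth wj q) \<and>
     \<not> cov (set A) (oth wi q) \<and> \<not> cov (set A) (oth wj q)"

definition ch2 :: "edge list \<Rightarrow> edge list \<Rightarrow> edge list \<Rightarrow> edge list \<Rightarrow> edge list \<Rightarrow> nat \<Rightarrow> node list" where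
  "ch2 es rest B A W q = concat (map (\<lambda>wi. map (\<lambda>wj. (True, rest, unionl es [wi, wj] A, W2l W q wi wj))
     (filter (\<lambda>wj. ok2 B A q wi wj) W)) W)"

text \<open>Keeps barren nodes off the stack. The coverage test guarantees that the branch still has
  the same vertices to cover, which \<open>bornl_iff\<close> presupposes.\<close>

definition okB :: "edge list \<Rightarrow> edge \<Rightarrow> edge list \<Rightarrow> nat list \<Rightarrow> nat \<Rightarrow> edge list \<Rightarrow> edge list \<Rightarrow> node \<Rightarrow> bool" where
  "okB es e B il y A W nd \<longleftrightarrow>
     covAW (set B) (set A) (set W) (set (fst (snd (snd nd)) @ snd (snd (snd nd)))) \<and>
     bornl es e B il y (fst (snd (snd nd))) (snd (snd (snd nd)))"

definition qs :: "edge list \<Rightarrow> edge list \<Rightarrow> edge list \<Rightarrow> edge list \<Rightarrow> nat list" where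
  "qs es B A W = filter (\<lambda>v. \<not> cov (set B) v \<and> cov (set W) v \<and> \<not> cov (set A) v) (vl es)"

text \<open>The uncovered vertices and the open end of \<open>e\<close> are recomputed from
  \<open>B @ A @ W\<close>, which covers the same vertices as \<open>B\<close> together with any
  member of the group.\<close>

definition childB :: "edge list \<Rightarrow> edge \<Rightarrow> edge list \<Rightarrow> edge list \<Rightarrow> edge list \<Rightarrow> node list" where
  "childB es e B A W = (case qs es B A W of [] \<Rightarrow> [(False, B, A, [])] | q # _ \<Rightarrow>
     filter (\<lambda>nd. okB es e B (ul es (B @ A @ W)) (uy e (B @ A @ W)) A W nd)
       (ch1 es (e # B) A W q @ ch2 es (e # B) B A W q))"

text \<open>The lists may repeat a node, for instance since \<open>candA\<close> tries each pair in
  both orders.\<close>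

definition children :: "edge list \<Rightarrow> node \<Rightarrow> node list" where
  "children es nd = (case fst (snd nd) of [] \<Rightarrow> [] | e # B \<Rightarrow>
     if fst nd then dedup (childB es e B (fst (snd (snd nd))) (snd (snd (snd nd))))
     else dedup (childA es e B (fst (snd (snd nd)))))"

lemma set_vl: "v \<in> set (vl es) \<longleftrightarrow> cov (set es) v"
  by (force simp: vl_def cov_def inc_def)

lemma set_ul: "set (ul es S) = unc (set es) (set S)"
  by (auto simp: ul_def unc_def set_vl)

lemma set_remv [simp]: "set (remv t T) = set T - {t}"
  by (auto simp: remv_def)

lemma trl_iff: "trl es B T \<longleftrightarrow> tr (set es) (set B) (set T)"
  by (auto simp: trl_def tr_def)

lemma canon_eq: "canon es A \<Longrightarrow> canon es B \<Longrightarrow> set A = set B \<Longrightarrow> A = B"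
  unfolding canon_def by metis

lemma canon_filter_es: "canon es (filter P es)"
  unfolding canon_def by (rule filter_cong) auto

lemma canon_filter: "canon es T \<Longrightarrow> canon es (filter P T)"
proof -
  assume "canon es T"
  then have "filter P T = filter (\<lambda>f. f \<in> set T \<and> P f) es"
    unfolding canon_def by (metis filter_filter)
  then show ?thesis using canon_filter_es by metis
qed

lemma canon_remv: "canon es T \<Longrightarrow> canon es (remv t T)"
  unfolding remv_def by (rule canon_filter)

lemma canon_unionl [simp]: "canon es (unionl es A W)"
  unfolding unionl_def by (rule canon_filter_es)

lemma canon_sub: "canon es T \<Longrightarrow> set T \<subseteq> set es"
  unfolding canon_def by (metis filter_is_subset)

lemma set_unionl: "set A \<subseteq> set es \<Longrightarrow> set W \<subseteq> set es \<Longrightarrow> set (unionl es A W) = set A \<union> set W"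
  by (auto simp: unionl_def)

lemma canon_distinct:
  assumes "canon es T" "distinct es"
  shows "distinct T"
proof -
  have "filter (\<lambda>f. f \<in> set T) es = T" using assms(1) unfolding canon_def by (rule sym)
  moreover have "distinct (filter (\<lambda>f. f \<in> set T) es)" using assms(2) by simp
  ultimately show ?thesis by simp
qed

lemma canon_Nil: "canon es []"
  by (simp add: canon_def)

lemma minz_canon: "canon es S \<Longrightarrow> canon es (minz P S cs)"
  unfolding minz_def
  by (induction cs arbitrary: S) (auto intro: canon_filter)

lemma minz_spec:
  assumes mono: "\<forall>A B. set A \<subseteq> set B \<longrightarrow> P A \<longrightarrow> P B" and "P S"
  shows "P (minz P S cs)" "set (minz P S cs) \<subseteq> set S" "set S - set cs \<subseteq> set (minz P S cs)"
    "t \<in> set (minz P S cs) \<Longrightarrow> t \<in> set cs \<Longrightarrow> \<not> P (filter (\<lambda>g. g \<noteq> t) (minz P S cs))"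
proof -
  have "P (minz P S cs) \<and> set (minz P S cs) \<subseteq> set S \<and> set S - set cs \<subseteq> set (minz P S cs) \<and>
    (\<forall>t\<in>set (minz P S cs) \<inter> set cs. \<not> P (filter (\<lambda>g. g \<noteq> t) (minz P S cs)))"
    using assms(2)
  proof (induction cs arbitrary: S)
    case Nil
    then show ?case by (simp add: minz_def)
  next
    case (Cons c cs)
    let ?S = "if P (filter (\<lambda>g. g \<noteq> c) S) then filter (\<lambda>g. g \<noteq> c) S else S"
    have e: "minz P S (c # cs) = minz P ?S cs" by (simp add: minz_def)
    have "P ?S" using Cons.prems by simp
    note IH = Cons.IH[OF this]
    let ?R = "minz P ?S cs"
    have "\<not> P (filter (\<lambda>g. g \<noteq> c) ?R)" if "c \<in> set ?R"
    proof -
      have "c \<in> set ?S" using that IH by blast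
      then have n: "\<not> P (filter (\<lambda>g. g \<noteq> c) S)" by (auto split: if_splits)
      have "set (filter (\<lambda>g. g \<noteq> c) ?R) \<subseteq> set (filter (\<lambda>g. g \<noteq> c) S)" using IH by (auto split: if_splits)
      then show ?thesis using n mono by blast
    qed
    moreover have "set ?S \<subseteq> set S" "set S - set (c # cs) \<subseteq> set ?S - set cs" by auto
    ultimately show ?case unfolding e using IH by auto
  qed
  then show "P (minz P S cs)" "set (minz P S cs) \<subseteq> set S" "set S - set cs \<subseteq> set (minz P S cs)"
    "t \<in> set (minz P S cs) \<Longrightarrow> t \<in> set cs \<Longrightarrow> \<not> P (filter (\<lambda>g. g \<noteq> t) (minz P S cs))" by blast+
qed

text \<open>Iterated parents, from a solution \<open>D\<close> of the empty level up to the level of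
  the given suffix. The outputs belonging to a node are defined through this map
  (\<open>Sem\<close>).\<close>

primrec anc :: "edge list \<Rightarrow> edge list \<Rightarrow> edge list \<Rightarrow> edge list" where
  "anc es [] D = D"
| "anc es (e # B) D = parl es e B (anc es B D)"

locale graph_list =
  fixes es :: "edge list"
  assumes dist: "distinct es" and gr: "graph (set es)"

sublocale graph_list \<subseteq> graph "set es" by (rule gr)

context graph_list
begin

abbreviation "EE \<equiv> set es"

definition sols :: "edge list \<Rightarrow> edge list set" where
  "sols B = {T. canon es T \<and> tr EE (set B) (set T)}"

lemma ul_cong: "unc EE (set S) = unc EE (set S') \<Longrightarrow> ul es S = ul es S'"
  unfolding ul_def by (rule filter_cong) (auto simp: unc_def set_vl)

lemma uy_props:
  assumes "T \<in> sols B" "e \<in> EE" "\<not> covd e (B @ T)"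
  shows "inc e (uy e (B @ T))" "\<not> cov (set B \<union> set T) (uy e (B @ T))"
  using assms by (auto simp: uy_def covd_def inc_def)

lemma uy_unique:
  assumes "T \<in> sols B" "e \<in> EE" "inc e y" "\<not> cov (set B \<union> set T) y"
  shows "uy e (B @ T) = y" "\<not> covd e (B @ T)"
proof -
  have "eds EE (set B \<union> set T)" using assms(1) by (simp add: sols_def tr_def)
  then have "cov (set B \<union> set T) (fst e) \<or> cov (set B \<union> set T) (snd e)" using assms(2) by (simp add: eds_def)
  then show "uy e (B @ T) = y" "\<not> covd e (B @ T)" using assms(3,4) by (auto simp: uy_def covd_def inc_def)
qed

lemma open_endI:
  assumes "T \<in> sols B" "e \<in> EE" "inc e y" "\<not> cov (set B \<union> set T) y"
  shows "open_end EE e (set B) (set T) y"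
  using assms gr by (simp add: open_end_def open_end_axioms_def sols_def)

lemma set_Nl: "set (Nl es e B il y T) = Nk EE (set B) (set il) (prc EE e (set B) y (set il)) (set T)"
  by (auto simp: Nl_def Nk_def)

lemma set_Wl: "set (Wl es e B il y N) = Wk EE (set B) (set il) (prc EE e (set B) y (set il)) (set N)"
  by (auto simp: Wl_def Wk_def)

lemma set_W0l: "set (W0l es e B il y N) = W0k EE e (set B) y (set il) (set N)"
  by (auto simp: W0l_def W0k_def)

lemma set_Xl: "set (Xl e y N) = Xk e y (set N)"
  by (auto simp: Xl_def Xk_def)

lemma canon_Nl: "canon es T \<Longrightarrow> canon es (Nl es e B il y T)"
  unfolding Nl_def by (rule canon_filter)

lemma canon_Wl: "canon es (Wl es e B il y N)"
  unfolding Wl_def by (rule canon_filter_es)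

lemma eds_app_mono: "\<forall>A A'. set A \<subseteq> set A' \<longrightarrow> eds EE (set (B @ A)) \<longrightarrow> eds EE (set (B @ A'))"
proof (intro allI impI)
  fix A A' :: "edge list"
  assume "set A \<subseteq> set A'" "eds EE (set (B @ A))"
  then show "eds EE (set (B @ A'))" by (elim eds_mono[rotated]) auto
qed

lemma redl_props:
  assumes "T \<in> sols B" "e \<in> EE" "\<not> tr EE (set (e # B)) (set T)" "covd e (B @ T)"
  shows "redl es (e # B) T \<in> sols (e # B)"
    "\<exists>s1\<in>EE. \<exists>s2\<in>EE. T = unionl es (redl es (e # B) T) [s1, s2]"
proof -
  let ?P = "redl es (e # B) T"
  have T: "canon es T" "tr EE (set B) (set T)" using assms(1) by (auto simp: sols_def)
  have "eds EE (set B \<union> set T)" using T(2) by (simp add: tr_def)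
  then have "eds EE (set ((e # B) @ T))" by (rule eds_mono[rotated]) auto
  note m = minz_spec[where P = "\<lambda>S. eds EE (set ((e # B) @ S))" and cs = T, OF eds_app_mono this, folded redl_def]
  have 1: "set ?P \<subseteq> set T" "eds EE (insert e (set B) \<union> set ?P)" using m(1,2) by simp_all
  have 2: "\<not> eds EE (insert e (set B) \<union> (set ?P - {t}))" if "t \<in> set ?P" for t
  proof -
    have "set (filter (\<lambda>g. g \<noteq> t) ?P) = set ?P - {t}" by auto
    moreover have "t \<in> set T" using that 1(1) by blast
    ultimately show ?thesis using m(4)[OF that] by simp
  qed
  have cv: "cov (set B \<union> set T) v" if "inc e v" for v
    using assms(4) that by (auto simp: covd_def inc_def)
  have tr: "\<not> tr EE (insert e (set B)) (set T)" using assms(3) by simp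
  note r = red_two[OF T(2) tr cv 1(1) 1(2) 2]
  have cP: "canon es ?P" unfolding redl_def by (rule minz_canon[OF T(1)])
  show "?P \<in> sols (e # B)" using r(1) cP by (simp add: sols_def)
  obtain s1 s2 where s: "s1 \<in> EE" "s2 \<in> EE" "set T = set ?P \<union> {s1, s2}" using r(2) by blast
  have "T = unionl es ?P [s1, s2]"
    by (rule canon_eq[OF T(1) canon_unionl]) (use s canon_sub[OF cP] set_unionl[of ?P es "[s1, s2]"] in simp)
  then show "\<exists>s1\<in>EE. \<exists>s2\<in>EE. T = unionl es ?P [s1, s2]" using s by blast
qed

end

section \<open>Computing the parent of a group, and decoding the group from it, on lists\<close>

locale open_end_list = graph_list +
  fixes e :: edge and B T :: "edge list" and y :: nat
  assumes Ts: "T \<in> sols B" and eE': "e \<in> EE" and ey': "inc e y" and yu': "\<not> cov (set B \<union> set T) y"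

sublocale open_end_list \<subseteq> open_end "set es" e "set B" "set T" y
  by (rule open_endI[OF Ts eE' ey' yu'])

context open_end_list
begin

abbreviation "il \<equiv> ul es (B @ T)"
abbreviation "NL \<equiv> Nl es e B il y T"
abbreviation "WL \<equiv> Wl es e B il y NL"

lemma set_il: "set il = I"
  by (simp add: set_ul)

lemma set_NL: "set NL = N" and set_WL: "set WL = W" and set_XL: "set (Xl e y NL) = Xf"
  by (simp_all add: set_Nl set_Wl set_il set_Xl)

lemma set_W0L: "set (W0l es e B il y NL) = W0"
  by (simp add: set_W0l set_NL set_il)

lemma cT: "canon es T"
  using Ts by (simp add: sols_def)

lemma cN: "canon es NL"
  using canon_Nl[OF cT] .

lemma parb_props:
  defines "P \<equiv> parb es e B il y NL"
  shows "N0 \<subseteq> set P" "set P \<subseteq> N0 \<union> W0" "eds EE (eB \<union> set P)"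
    "t \<in> set P \<Longrightarrow> t \<notin> N0 \<Longrightarrow> \<not> eds EE (eB \<union> (set P - {t}))" "canon es P"
proof -
  let ?n = "filter (\<lambda>f. \<not> inc f (oth e y)) NL" and ?w = "W0l es e B il y NL"
  have n: "set ?n = N0" using set_NL by (auto simp: N0k_def)
  have w: "set ?w = W0" by (rule set_W0L)
  have U: "set (unionl es ?n ?w) = N0 \<union> W0" using N0W0E n w by (simp add: set_unionl)
  have N0W0: "N0 \<inter> W0 = {}" by (auto simp: N0k_def W0k_def)
  have e: "eds EE (set ((e # B) @ unionl es ?n ?w))" using eds0 U by (simp add: Un_insert_left)
  note m = minz_spec[where P = "\<lambda>S. eds EE (set ((e # B) @ S))" and cs = ?w, OF eds_app_mono e, folded parb_def, folded P_def]
  show "N0 \<subseteq> set P" using m(3) U w N0W0 by blast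
  show "set P \<subseteq> N0 \<union> W0" using m(2) U by blast
  show "eds EE (eB \<union> set P)" using m(1) by simp
  show "\<not> eds EE (eB \<union> (set P - {t}))" if "t \<in> set P" "t \<notin> N0"
  proof -
    have "t \<in> set ?w" using that m(2) U w by blast
    moreover have "set (filter (\<lambda>g. g \<noteq> t) P) = set P - {t}" by auto
    ultimately show ?thesis using m(4)[OF that(1)] by simp
  qed
  show "canon es P" unfolding P_def parb_def by (rule minz_canon) simp
qed

lemma parb_sols: "parb es e B il y NL \<in> sols (e # B)"
  using tr_par[OF parb_props(1-4)] parb_props(5) by (simp add: sols_def)

lemma Xl_cases: "Xl e y NL \<in> set ([] # map (\<lambda>f. [f]) es)"
proof (cases "Xl e y NL")
  case (Cons a l)
  have d: "distinct (Xl e y NL)" unfolding Xl_def by (intro distinct_filter canon_distinct[OF cN dist])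
  have a: "a \<in> Xf" using set_XL Cons by auto
  obtain r where r: "\<And>f. f \<in> N \<Longrightarrow> inc f x \<Longrightarrow> f = a" by (rule Xf_edge[OF a]) blast
  have "f = a" if "f \<in> set (Xl e y NL)" for f using r[of f] that set_XL by (auto simp: Xk_def)
  then have "l = []" using d Cons by (cases l) auto
  moreover have "a \<in> EE" using a NE by (auto simp: Xk_def)
  ultimately show ?thesis using Cons by simp
qed simp

lemma minX_Comp: "set (minX es B il NL WL) \<in> Comp X N W" "canon es (minX es B il NL WL)"
proof -
  let ?Q = "\<lambda>S. \<forall>v\<in>set (vl es). v \<in> set il \<or> cov (set B) v \<or> cov (set S) v"
  let ?M = "minX es B il NL WL"
  have Q: "?Q S = covs X (set S)" for S
  proof
    assume Q: "?Q S"
    have "cov (set S) v" if v: "cov (set T) v" "\<not> cov (set B) v" for v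
    proof -
      have "v \<in> set (vl es)" using cov_mono[OF TE v(1)] by (simp add: set_vl)
      moreover have "v \<notin> set il" using v by (simp add: set_il unc_def)
      ultimately show ?thesis using Q v(2) by blast
    qed
    then show "covs X (set S)" by (simp add: covs_def)
  next
    assume c: "covs X (set S)"
    show "?Q S"
    proof
      fix v assume "v \<in> set (vl es)"
      then have "v \<in> set il \<or> cov (set B) v \<or> cov (set T) v" by (auto simp: set_vl set_il unc_def)
      then show "v \<in> set il \<or> cov (set B) v \<or> cov (set S) v" using c by (auto simp: covs_def)
    qed
  qed
  have U: "set (unionl es NL WL) = N \<union> W" using NWE set_NL set_WL by (simp add: set_unionl)
  have mono: "\<forall>A A'. set A \<subseteq> set A' \<longrightarrow> ?Q A \<longrightarrow> ?Q A'" using cov_mono by meson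
  have "covs X (set (unionl es NL WL))" unfolding U by (rule covs_NW)
  then have "?Q (unionl es NL WL)" using Q by blast
  note m = minz_spec[where P = ?Q and cs = WL, OF mono this, folded minX_def]
  have NW: "N \<inter> W = {}" by (auto simp: Wk_def)
  show "set ?M \<in> Comp X N W"
  proof (rule Comp_min[OF inv_NW])
    show "N \<subseteq> set ?M" using m(3) U set_WL NW by blast
    show "set ?M \<subseteq> N \<union> W" using m(2) U by blast
    show "covs X (set ?M)" using m(1) Q by blast
    show "\<not> covs X (set ?M - {t})" if t: "t \<in> set ?M" "t \<notin> N" for t
    proof -
      have "t \<in> set WL" using t m(2) U set_WL by blast
      from m(4)[OF t(1) this] have "\<not> covs X (set (filter (\<lambda>g. g \<noteq> t) ?M))" unfolding Q .
      moreover have "set (filter (\<lambda>g. g \<noteq> t) ?M) = set ?M - {t}" by auto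
      ultimately show ?thesis by simp
    qed
  qed
  show "canon es ?M" unfolding minX_def by (rule minz_canon) simp
qed

lemma par_I: "{v. cov EE v \<and> (v = y \<or> \<not> cov (eB \<union> set (parb es e B il y NL)) v \<and> \<not> cov Xf v \<and> \<not> adj EE v y)} = I"
  by (rule dec_I) (rule parb_props; assumption)+

lemma par_N: "Nk EE (set B) I PR (set (parb es e B il y NL)) \<union> Xf = N"
  by (rule dec_N) (rule parb_props; assumption)+

lemma deci_par: "deci es e B (parb es e B il y NL) y (Xl e y NL) = il"
proof -
  have "deci es e B (parb es e B il y NL) y (Xl e y NL) = filter (\<lambda>v. \<not> cov (set (B @ T)) v) (vl es)"
    unfolding deci_def
  proof (rule filter_cong[OF refl])
    fix v assume "v \<in> set (vl es)"
    then have v: "cov EE v" by (simp add: set_vl)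
    have "(cov EE v \<and> (v = y \<or> \<not> cov (eB \<union> set (parb es e B il y NL)) v \<and>
        \<not> cov Xf v \<and> \<not> adj EE v y)) \<longleftrightarrow> v \<in> {v. cov EE v \<and> (v = y \<or> \<not> cov (eB \<union> set (parb es e B il y NL)) v \<and> \<not> cov Xf v \<and> \<not> adj EE v y)}"
      by (simp only: mem_Collect_eq)
    also have "\<dots> \<longleftrightarrow> v \<in> I" by (simp only: par_I)
    finally have "(cov EE v \<and> (v = y \<or> \<not> cov (eB \<union> set (parb es e B il y NL)) v \<and>
        \<not> cov Xf v \<and> \<not> adj EE v y)) = (v \<in> I)" .
    moreover have "(v \<in> I) = (\<not> cov (set (B @ T)) v)" using v by (simp add: unc_def)
    ultimately show "(v = y \<or> \<not> cov (set ((e # B) @ parb es e B il y NL)) v \<and>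
        \<not> cov (set (Xl e y NL)) v \<and> \<not> adj EE v y) = (\<not> cov (set (B @ T)) v)"
      using v set_XL by simp
  qed
  then show ?thesis by (simp only: ul_def)
qed

text \<open>The parent with the right \<open>y\<close> and \<open>Xl\<close> determines
  \<open>il\<close> and \<open>NL\<close>, so decoding returns the same greedily chosen member for
  every \<open>T\<close> of the group.\<close>

lemma decl_par: "decl es e B (parb es e B il y NL) y (Xl e y NL) = minX es B il NL WL"
proof -
  let ?P = "parb es e B il y NL"
  have "Xf \<subseteq> EE" using NE by (auto simp: Xk_def)
  moreover have 1: "set (Nl es e B il y ?P) = Nk EE (set B) I PR (set ?P)" by (simp add: set_Nl set_il)
  moreover have "Nk EE (set B) I PR (set ?P) \<subseteq> EE"
    using parb_props(2) N0W0E by (auto simp: Nk_def)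
  ultimately have "set (unionl es (Nl es e B il y ?P) (Xl e y NL)) = Nk EE (set B) I PR (set ?P) \<union> Xf"
    by (simp add: set_unionl set_XL)
  also have "\<dots> = N" by (rule par_N)
  finally have "unionl es (Nl es e B il y ?P) (Xl e y NL) = NL"
    by (intro canon_eq[OF canon_unionl cN]) (simp add: set_NL)
  then show ?thesis unfolding decl_def decl1_def deci_par by simp
qed

lemma group_same:
  assumes S: "canon es S" "set S \<in> Comp X N W"
  shows "S \<in> sols B" "ul es (B @ S) = il" "Nl es e B il y S = NL" "\<not> cov (set B \<union> set S) y"
    "open_end_list es e B S y"
proof -
  have u: "unc EE (set B \<union> set S) = I" by (rule unc_Comp[OF S(2)])
  show s: "S \<in> sols B" using tr_Comp[OF S(2)] S(1) by (simp add: sols_def)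
  show "ul es (B @ S) = il" by (rule ul_cong) (use u in simp)
  show "Nl es e B il y S = NL"
    by (rule canon_eq[OF canon_Nl[OF S(1)] cN]) (simp add: set_Nl set_il Nk_Comp[OF S(2)])
  show y: "\<not> cov (set B \<union> set S) y" using u yI by (auto simp: unc_def)
  show "open_end_list es e B S y" by unfold_locales (rule s, rule eE', rule ey', rule y)
qed

end

lemma in_concat_map: "x \<in> set xs \<Longrightarrow> z \<in> set (f x) \<Longrightarrow> z \<in> set (concat (map f xs))"
  by auto

lemma concat_mapD: "z \<in> set (concat (map f xs)) \<Longrightarrow> \<exists>x. x \<in> set xs \<and> z \<in> set (f x)"
  by auto

lemma mem_ifl: "c \<in> set (if b1 \<and> b2 \<and> b3 \<and> b4 \<and> b5 then [x] else []) \<longleftrightarrow> b1 \<and> b2 \<and> b3 \<and> b4 \<and> b5 \<and> c = x"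
  using [[simproc del: list_to_set_comprehension]] by auto

context open_end_list
begin

text \<open>Each member is again a solution that leaves \<open>y\<close> open, and has the same
  uncovered vertices; so \<open>born_iff\<close> applies to it with the same
  \<open>S0\<close>.\<close>

lemma born_Comp:
  assumes "S \<in> Comp X N W"
  shows "\<not> tr EE eB S \<longleftrightarrow> (\<exists>t\<in>S. bornt eB S0 S t)"
proof -
  have SE: "S \<subseteq> EE" using tr_Comp[OF assms] by (simp add: tr_def)
  define S' where "S' = filter (\<lambda>f. f \<in> S) es"
  have S': "canon es S'" "set S' = S" using SE canon_filter_es unfolding S'_def by auto
  have "open_end_list es e B S' y" by (rule group_same(5)[OF S'(1)]) (simp add: S' assms)
  then interpret k: open_end_list es e B S' y .
  show ?thesis using k.born_iff unc_Comp[OF assms] by (simp add: S'(2))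
qed

lemma bornl_iff:
  assumes "N \<subseteq> set A" "set A \<union> set W' \<subseteq> N \<union> W" "Xs (set B) (set A \<union> set W') = X" "inv X (set A) (set W')"
  shows "bornl es e B il y A W' \<longleftrightarrow> (\<exists>S\<in>Comp X (set A) (set W'). \<not> tr EE eB S)"
proof -
  have E: "set A \<subseteq> EE" "set W' \<subseteq> EE" using assms(2) NWE by blast+
  have "bornl es e B il y A W' \<longleftrightarrow> (\<exists>S\<in>Comp X (set A) (set W'). \<exists>t\<in>S. bornt eB S0 S t)"
    using bornf_iff[OF E, of "set B" eB S0] assms(3,4) by (simp add: bornl_def set_il)
  also have "\<dots> \<longleftrightarrow> (\<exists>S\<in>Comp X (set A) (set W'). \<not> tr EE eB S)"
    using born_Comp Comp_mono[OF assms(1,2), of X] by blast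
  finally show ?thesis .
qed

text \<open>The parent is computed from the uncovered vertices, \<open>y\<close> and the
  representatives, all of which the members share.\<close>

lemma group_parl:
  assumes S: "canon es S" "set S \<in> Comp X N W" "\<not> tr EE eB (set S)"
  shows "S \<in> sols B" "uy e (B @ S) = y" "\<not> covd e (B @ S)" "\<not> trl es (e # B) (remv e S)"
    "parl es e B S = parb es e B il y NL" "ul es (B @ S) = il" "Nl es e B il y S = NL"
proof -
  note g = group_same[OF S(1,2)]
  show 1: "S \<in> sols B" "ul es (B @ S) = il" "Nl es e B il y S = NL" by (rule g)+
  show 2: "uy e (B @ S) = y" "\<not> covd e (B @ S)" by (rule uy_unique[OF g(1) eE' ey' g(4)])+
  have "e \<notin> set S" using g(4) ey' by (auto simp: cov_def)
  then have "remv e S = S" by (auto simp: remv_def filter_id_conv)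
  then show 3: "\<not> trl es (e # B) (remv e S)" using S(3) by (simp add: trl_iff)
  show "parl es e B S = parb es e B il y NL" using 1 2 3 by (simp add: parl_def)
qed

lemma bornl_NW:
  assumes "\<not> tr EE eB (set T)"
  shows "bornl es e B il y NL WL"
proof -
  note bi = bornl_iff[of NL WL, unfolded set_NL set_WL, OF subset_refl subset_refl Xs_eq inv_NW]
  show ?thesis unfolding bi by (rule bexI[where P = "\<lambda>S. \<not> tr EE eB S", OF assms T_Comp])
qed

text \<open>The decoded member need be neither \<open>T\<close> nor born: the checks in
  \<open>gB\<close> see it only through data common to the group.\<close>

lemma candB_in:
  assumes "\<not> tr EE eB (set T)"
  shows "(True, e # B, NL, WL) \<in> set (candB es e B (parb es e B il y NL))"
proof -
  let ?S = "minX es B il NL WL" and ?P = "parb es e B il y NL"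
  note g = group_same[OF minX_Comp(2,1)]
  have b: "bornl es e B il y NL WL" by (rule bornl_NW[OF assms])
  have "trl es B ?S" using g(1) by (simp add: sols_def trl_iff)
  then have "(True, e # B, NL, WL) \<in> set (gB es e B ?P y (Xl e y NL) (decl es e B ?P y (Xl e y NL)))"
    unfolding decl_par gB_def gB1_def gB2_def g(2) g(3) using b g(4) by simp
  then have c: "(True, e # B, NL, WL) \<in> set (concat (map (\<lambda>Xf. gB es e B ?P y Xf (decl es e B ?P y Xf)) ([] # map (\<lambda>f. [f]) es)))"
    by (rule in_concat_map[OF Xl_cases])
  have y: "y \<in> set [fst e, snd e]" using ey' by (auto simp: inc_def)
  show ?thesis unfolding candB_def by (rule in_concat_map, rule y, rule c)
qed

end

context graph_list
begin

lemma solsD: "T \<in> sols B \<Longrightarrow> canon es T" "T \<in> sols B \<Longrightarrow> tr EE (set B) (set T)"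
  by (simp_all add: sols_def)

lemma remv_id: "e \<notin> set T \<Longrightarrow> remv e T = T"
  by (auto simp: remv_def filter_id_conv)

lemma not_old:
  assumes "\<not> trl es (e # B) (remv e T)"
  shows "\<not> tr EE (insert e (set B)) (set T)"
proof
  assume a: "tr EE (insert e (set B)) (set T)"
  then have "remv e T = T" using tr_noe remv_id by blast
  then show False using a assms by (simp add: trl_iff)
qed

lemma open_end_list_uy:
  assumes "T \<in> sols B" "e \<in> EE" "\<not> covd e (B @ T)"
  shows "open_end_list es e B T (uy e (B @ T))"
  by unfold_locales (rule assms uy_props[OF assms])+

lemma parl_sols:
  assumes T: "T \<in> sols B" and e: "e \<in> EE"
  shows "parl es e B T \<in> sols (e # B)"
proof -
  consider (1) "trl es (e # B) (remv e T)" | (2) "\<not> trl es (e # B) (remv e T)" "covd e (B @ T)"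
    | (3) "\<not> trl es (e # B) (remv e T)" "\<not> covd e (B @ T)" by blast
  then show ?thesis
  proof cases
    case 1
    then show ?thesis using solsD(1)[OF T] canon_remv by (simp add: parl_def sols_def trl_iff)
  next
    case 2
    then show ?thesis using redl_props(1)[OF T e _ 2(2)] not_old[OF 2(1)] by (simp add: parl_def)
  next
    case 3
    interpret open_end_list es e B T "uy e (B @ T)" by (rule open_end_list_uy[OF T e 3(2)])
    show ?thesis using parb_sols 3 by (simp add: parl_def)
  qed
qed

lemma natl_sols:
  assumes T: "T \<in> sols (e # B)" and e: "e \<in> EE"
  shows "natl es e B T \<in> sols B" "trl es (e # B) (remv e (natl es e B T))" "parl es e B (natl es e B T) = T"
proof -
  let ?T = "natl es e B T"
  have c: "canon es T" and t: "tr EE (insert e (set B)) (set T)" using solsD[OF T] by simp_all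
  have eT: "e \<notin> set T" using tr_noe[OF t] .
  have "?T \<in> sols B \<and> remv e ?T = T"
  proof (cases "eds EE (set (B @ T))")
    case True
    then show ?thesis using tr_same[OF t] c remv_id[OF eT] by (simp add: natl_def sols_def)
  next
    case False
    let ?U = "unionl es [e] T"
    have U: "set ?U = insert e (set T)" using e canon_sub[OF c] by (simp add: set_unionl)
    have "tr EE (set B) (set ?U)" unfolding U by (rule tr_add[OF t _ e]) (use False in simp)
    moreover have "remv e ?U = T" by (rule canon_eq[OF canon_remv c]) (use U eT in auto)
    ultimately show ?thesis using False by (simp add: natl_def sols_def)
  qed
  then show "?T \<in> sols B" "trl es (e # B) (remv e ?T)" "parl es e B ?T = T"
    using t by (simp_all add: trl_iff parl_def)
qed

text \<open>Whether \<open>e\<close> belongs to \<open>T\<close> can be told from the parent: it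
  does exactly if the parent without \<open>e\<close> is not dominating. So each parent has one such
  child.\<close>

lemma old_natl:
  assumes T: "T \<in> sols B" "e \<in> EE" "trl es (e # B) (remv e T)"
  shows "T = natl es e B (parl es e B T)"
proof -
  have c: "canon es T" and t: "tr EE (set B) (set T)" using solsD[OF T(1)] .
  have p: "parl es e B T = remv e T" using T(3) by (simp add: parl_def)
  show ?thesis
  proof (cases "e \<in> set T")
    case True
    have "\<not> eds EE (set (B @ remv e T))" using tr_del(2)[OF t True] by simp
    then have "natl es e B (remv e T) = unionl es [e] (remv e T)" by (simp add: natl_def)
    also have "\<dots> = T"
    proof (rule canon_eq[OF canon_unionl c])
      have "set (unionl es [e] (remv e T)) = set [e] \<union> set (remv e T)"
        by (rule set_unionl) (use T(2) canon_sub[OF c] in auto)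
      then show "set (unionl es [e] (remv e T)) = set T" using True by auto
    qed
    finally show ?thesis using p by simp
  next
    case False
    have "eds EE (set B \<union> set T)" using t by (simp add: tr_def)
    then show ?thesis using p remv_id[OF False] by (simp add: natl_def)
  qed
qed

lemma candA_iff: "T' \<in> set (candA es e B T) \<longleftrightarrow> (\<exists>s1\<in>EE. \<exists>s2\<in>EE. T' = unionl es T [s1, s2]) \<and> trl es B T' \<and>
    \<not> trl es (e # B) (remv e T') \<and> covd e (B @ T') \<and> redl es (e # B) T' = T"
  by (auto simp: candA_def)

section \<open>Nodes as sets of solutions, and how their children partition them\<close>

definition Gr :: "node \<Rightarrow> edge list set" where
  "Gr nd = (case nd of (fl, rest, A, W) \<Rightarrow> if fl then {S. canon es S \<and>
      set S \<in> Comp (Xs (set (tl rest)) (set A \<union> set W)) (set A) (set W) \<and> \<not> tr EE (set rest) (set S)} else {A})"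

lemma Gr_simps [simp]: "Gr (False, rest, A, W) = {A}"
  "Gr (True, e # B, A, W) = {S. canon es S \<and> set S \<in> Comp (Xs (set B) (set A \<union> set W)) (set A) (set W) \<and>
     \<not> tr EE (insert e (set B)) (set S)}"
  by (simp_all add: Gr_def)

text \<open>Here \<open>T\<close> merely exhibits the group that the node subdivides and need not
  belong to the node. The last clause says that the node is not barren.\<close>

definition invB :: "edge \<Rightarrow> edge list \<Rightarrow> edge list \<Rightarrow> edge list \<Rightarrow> bool" where
  "invB e B A W \<longleftrightarrow> canon es A \<and> canon es W \<and> (\<exists>T y N. open_end_list es e B T y \<and> N = Nl es e B (ul es (B @ T)) y T \<and>
     set N \<subseteq> set A \<and> set A \<union> set W \<subseteq> set N \<union> set (Wl es e B (ul es (B @ T)) y N) \<and>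
     Xs (set B) (set A \<union> set W) = {v. cov (set T) v \<and> \<not> cov (set B) v} \<and>
     inv (Xs (set B) (set A \<union> set W)) (set A) (set W) \<and>
     (\<exists>S\<in>Comp (Xs (set B) (set A \<union> set W)) (set A) (set W). \<not> tr EE (insert e (set B)) S))"

lemma invB_ne:
  assumes "invB e B A W"
  shows "Gr (True, e # B, A, W) \<noteq> {}"
proof -
  obtain T y S where k: "open_end_list es e B T y" and NW: "set A \<union> set W \<subseteq> EE"
    and S: "S \<in> Comp (Xs (set B) (set A \<union> set W)) (set A) (set W)" "\<not> tr EE (insert e (set B)) S"
    using assms canon_sub unfolding invB_def by blast
  have "S \<subseteq> EE" using CompD(2)[OF S(1)] NW by blast
  then have "canon es (filter (\<lambda>f. f \<in> S) es)" "set (filter (\<lambda>f. f \<in> S) es) = S" using canon_filter_es by auto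
  then have "filter (\<lambda>f. f \<in> S) es \<in> Gr (True, e # B, A, W)" using S by simp
  then show ?thesis by blast
qed

lemma gB_iff: "c \<in> set (gB es e B P y Xf T) \<longleftrightarrow> trl es B T \<and> \<not> cov (set (B @ T)) y \<and>
    Xl e y (Nl es e B (ul es (B @ T)) y T) = Xf \<and> parb es e B (ul es (B @ T)) y (Nl es e B (ul es (B @ T)) y T) = P \<and>
    bornl es e B (ul es (B @ T)) y (Nl es e B (ul es (B @ T)) y T) (Wl es e B (ul es (B @ T)) y (Nl es e B (ul es (B @ T)) y T)) \<and>
    c = (True, e # B, Nl es e B (ul es (B @ T)) y T, Wl es e B (ul es (B @ T)) y (Nl es e B (ul es (B @ T)) y T))"
  unfolding gB_def gB1_def gB2_def by (subst mem_ifl) (rule refl)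

lemma candB_sound:
  assumes "c \<in> set (candB es e B P)" "e \<in> EE"
  obtains T y where "open_end_list es e B T y" "parb es e B (ul es (B @ T)) y (Nl es e B (ul es (B @ T)) y T) = P"
    "c = (True, e # B, Nl es e B (ul es (B @ T)) y T, Wl es e B (ul es (B @ T)) y (Nl es e B (ul es (B @ T)) y T))"
    "bornl es e B (ul es (B @ T)) y (Nl es e B (ul es (B @ T)) y T) (Wl es e B (ul es (B @ T)) y (Nl es e B (ul es (B @ T)) y T))"
proof -
  obtain y where y: "y \<in> set [fst e, snd e]"
    and "c \<in> set (concat (map (\<lambda>Xf. gB es e B P y Xf (decl es e B P y Xf)) ([] # map (\<lambda>f. [f]) es)))"
    using concat_mapD[OF assms(1)[unfolded candB_def]] by blast
  from concat_mapD[OF this(2)] obtain Xf where c: "c \<in> set (gB es e B P y Xf (decl es e B P y Xf))" by blast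
  define T where "T = decl es e B P y Xf"
  have cn: "canon es T" unfolding T_def decl_def decl1_def minX_def by (rule minz_canon) simp
  note h = c[folded T_def, unfolded gB_iff]
  have "T \<in> sols B" using cn h by (simp add: sols_def trl_iff)
  moreover have "inc e y" using y by (auto simp: inc_def)
  ultimately have "open_end_list es e B T y"
    by unfold_locales (use h assms(2) in simp_all)
  then show ?thesis by (rule that) (use h in blast)+
qed

lemma candB_props:
  assumes c: "c \<in> set (candB es e B P)" and e: "e \<in> EE"
  shows "\<exists>A W. c = (True, e # B, A, W) \<and> invB e B A W"
    "S \<in> Gr c \<Longrightarrow> S \<in> sols B \<and> \<not> trl es (e # B) (remv e S) \<and> \<not> covd e (B @ S) \<and> parl es e B S = P \<and>
      c = (True, e # B, Nl es e B (ul es (B @ S)) (uy e (B @ S)) S,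
        Wl es e B (ul es (B @ S)) (uy e (B @ S)) (Nl es e B (ul es (B @ S)) (uy e (B @ S)) S))"
proof -
  obtain T y where k: "open_end_list es e B T y" and p: "parb es e B (ul es (B @ T)) y (Nl es e B (ul es (B @ T)) y T) = P"
    and cc: "c = (True, e # B, Nl es e B (ul es (B @ T)) y T, Wl es e B (ul es (B @ T)) y (Nl es e B (ul es (B @ T)) y T))"
    and b: "bornl es e B (ul es (B @ T)) y (Nl es e B (ul es (B @ T)) y T) (Wl es e B (ul es (B @ T)) y (Nl es e B (ul es (B @ T)) y T))"
    by (rule candB_sound[OF c e])
  interpret open_end_list es e B T y by (rule k)
  have "\<exists>S\<in>Comp X N W. \<not> tr EE eB S"
    using b bornl_iff[of NL WL] inv_NW Xs_eq by (simp add: set_NL set_WL)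
  then have "invB e B NL WL" unfolding invB_def
    using k cN canon_Wl inv_NW Xs_eq
    by (intro conjI exI[of _ T] exI[of _ y] exI[of _ NL]) (simp_all add: set_NL set_WL)
  then show "\<exists>A W. c = (True, e # B, A, W) \<and> invB e B A W" using cc by blast
  assume "S \<in> Gr c"
  then have "canon es S" "set S \<in> Comp X N W" "\<not> tr EE eB (set S)"
    using Xs_eq by (simp_all add: cc set_NL set_WL)
  note g = group_parl[OF this]
  show "S \<in> sols B \<and> \<not> trl es (e # B) (remv e S) \<and> \<not> covd e (B @ S) \<and> parl es e B S = P \<and>
      c = (True, e # B, Nl es e B (ul es (B @ S)) (uy e (B @ S)) S,
        Wl es e B (ul es (B @ S)) (uy e (B @ S)) (Nl es e B (ul es (B @ S)) (uy e (B @ S)) S))"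
    using g p cc by simp
qed

lemma childA_Gr:
  assumes P: "P \<in> sols (e # B)" and e: "e \<in> EE"
  shows "(\<Union>c\<in>set (childA es e B P). Gr c) = {T \<in> sols B. parl es e B T = P}"
proof (intro set_eqI iffI)
  fix T assume "T \<in> (\<Union>c\<in>set (childA es e B P). Gr c)"
  then obtain c where "c \<in> set (childA es e B P)" "T \<in> Gr c" by blast
  then consider "T = natl es e B P" | "T \<in> set (candA es e B P)" | "c \<in> set (candB es e B P)"
    by (auto simp: childA_def)
  then show "T \<in> {T \<in> sols B. parl es e B T = P}"
  proof cases
    case 1
    then show ?thesis using natl_sols[OF P e] by simp
  next
    case 2
    then show ?thesis by (auto simp: candA_iff sols_def trl_iff parl_def)
  next
    case 3
    then show ?thesis using candB_props(2)[OF 3 e \<open>T \<in> Gr c\<close>] by simp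
  qed
next
  fix T assume "T \<in> {T \<in> sols B. parl es e B T = P}"
  then have T: "T \<in> sols B" "parl es e B T = P" by simp_all
  consider (1) "trl es (e # B) (remv e T)" | (2) "\<not> trl es (e # B) (remv e T)" "covd e (B @ T)"
    | (3) "\<not> trl es (e # B) (remv e T)" "\<not> covd e (B @ T)" by blast
  then show "T \<in> (\<Union>c\<in>set (childA es e B P). Gr c)"
  proof cases
    case 1
    then show ?thesis using old_natl[OF T(1) e 1] T(2) by (auto simp: childA_def)
  next
    case 2
    have "redl es (e # B) T = P" using T(2) 2 by (simp add: parl_def)
    then have "T \<in> set (candA es e B P)" unfolding candA_iff
      using redl_props(2)[OF T(1) e _ 2(2)] not_old[OF 2(1)] 2 solsD(2)[OF T(1)] by (simp add: trl_iff)
    then show ?thesis by (auto simp: childA_def)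
  next
    case 3
    interpret open_end_list es e B T "uy e (B @ T)" by (rule open_end_list_uy[OF T(1) e 3(2)])
    have "\<not> tr EE eB (set T)" using not_old[OF 3(1)] .
    moreover have "parb es e B il (uy e (B @ T)) NL = P" using T(2) 3 by (simp add: parl_def)
    ultimately have "(True, e # B, NL, WL) \<in> set (childA es e B P)" using candB_in by (simp add: childA_def)
    moreover have "T \<in> Gr (True, e # B, NL, WL)"
      using cT T_Comp Xs_eq \<open>\<not> tr EE eB (set T)\<close> by (simp add: set_NL set_WL)
    ultimately show ?thesis by blast
  qed
qed

text \<open>The child that contains \<open>S\<close> can be computed from \<open>S\<close>.\<close>

lemma childA_disj:
  assumes P: "P \<in> sols (e # B)" and e: "e \<in> EE" and c: "c \<in> set (childA es e B P)" "c' \<in> set (childA es e B P)"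
    and S: "S \<in> Gr c" "S \<in> Gr c'"
  shows "c = c'"
proof -
  have *: "(c = (False, B, S, []) \<and> (trl es (e # B) (remv e S) \<or> covd e (B @ S))) \<or>
    (\<not> trl es (e # B) (remv e S) \<and> \<not> covd e (B @ S) \<and> c = (True, e # B, Nl es e B (ul es (B @ S)) (uy e (B @ S)) S,
        Wl es e B (ul es (B @ S)) (uy e (B @ S)) (Nl es e B (ul es (B @ S)) (uy e (B @ S)) S)))"
    if "c \<in> set (childA es e B P)" "S \<in> Gr c" for c
    using that candB_props(2)[of c e B P S] e natl_sols(2)[OF P e] by (auto simp: childA_def candA_iff)
  show ?thesis using *[OF c(1) S(1)] *[OF c(2) S(2)] by blast
qed

definition invN :: "node \<Rightarrow> bool" where
  "invN nd \<longleftrightarrow> (case nd of (fl, rest, A, W) \<Rightarrow> (\<exists>pre. es = pre @ rest) \<and>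
     (if fl then rest \<noteq> [] \<and> invB (hd rest) (tl rest) A W else A \<in> sols rest \<and> W = []))"

lemma invN_simps [simp]: "invN (False, rest, A, W) \<longleftrightarrow> (\<exists>pre. es = pre @ rest) \<and> A \<in> sols rest \<and> W = []"
  "invN (True, e # B, A, W) \<longleftrightarrow> (\<exists>pre. es = pre @ e # B) \<and> invB e B A W"
  by (auto simp: invN_def)

text \<open>The edges of a member at the branching vertex tell which branch it belongs to, so the
  branches partition the node. Every branch covers a further vertex, which bounds the number of
  branchings within one level.\<close>

lemma childB_props:
  assumes iv: "invB e B P Q" and pre: "\<exists>pre. es = pre @ e # B"
  shows "c \<in> set (childB es e B P Q) \<Longrightarrow> invN c \<and> (c = (False, B, P, []) \<or> (\<exists>P' Q' q. c = (True, e # B, P', Q') \<and>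
      set P \<subseteq> set P' \<and> q \<in> set (vl es) \<and> \<not> cov (set P) q \<and> cov (set P') q))"
    "(\<Union>c\<in>set (childB es e B P Q). Gr c) = Gr (True, e # B, P, Q)"
    "c \<in> set (childB es e B P Q) \<Longrightarrow> c' \<in> set (childB es e B P Q) \<Longrightarrow> S \<in> Gr c \<Longrightarrow> S \<in> Gr c' \<Longrightarrow> c = c'"
proof -
  have cA: "canon es P" and cW: "canon es Q" using iv by (auto simp: invB_def)
  have AE: "set P \<subseteq> EE" and WE: "set Q \<subseteq> EE" using canon_sub cA cW by blast+
  obtain T y where k: "open_end_list es e B T y"
    and i: "set (Nl es e B (ul es (B @ T)) y T) \<subseteq> set P"
    "set P \<union> set Q \<subseteq> set (Nl es e B (ul es (B @ T)) y T) \<union> set (Wl es e B (ul es (B @ T)) y (Nl es e B (ul es (B @ T)) y T))"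
    "Xs (set B) (set P \<union> set Q) = {v. cov (set T) v \<and> \<not> cov (set B) v}"
    "inv (Xs (set B) (set P \<union> set Q)) (set P) (set Q)"
    "\<exists>S\<in>Comp (Xs (set B) (set P \<union> set Q)) (set P) (set Q). \<not> tr EE (insert e (set B)) S"
    using iv unfolding invB_def by blast
  interpret open_end_list es e B T y by (rule k)
  have i1: "N \<subseteq> set P" "set P \<union> set Q \<subseteq> N \<union> W" using i(1,2) by (simp_all only: set_NL set_WL)
  have iX: "Xs (set B) (set P \<union> set Q) = X" and iI: "inv X (set P) (set Q)" using i(3,4) by simp_all
  have gG: "S \<in> Gr (True, e # B, P, Q) \<longleftrightarrow> canon es S \<and> set S \<in> Comp X (set P) (set Q) \<and> \<not> tr EE eB (set S)" for S
    by (simp add: iX)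
  have cvv: "cov (set (B @ P @ Q)) v \<longleftrightarrow> cov (set (B @ T)) v" for v
    using iX by (auto simp: Xs_def set_eq_iff)
  have uI: "ul es (B @ P @ Q) = il" unfolding ul_def cvv ..
  have uY: "uy e (B @ P @ Q) = y"
    using uy_unique(1)[OF Ts eE' ey' yu'] unfolding uy_def cvv .
  have sub: "S \<in> Comp X (set P) (set Q) \<Longrightarrow> S \<in> Comp X N W" for S
    using Comp_mono[OF i1] by blast
  have new: "invN (True, e # B, P', Q') \<and> (\<forall>S. S \<in> Gr (True, e # B, P', Q') \<longleftrightarrow> canon es S \<and>
      set S \<in> Comp X (set P') (set Q') \<and> \<not> tr EE eB (set S))"
    if h: "okB es e B il y P Q (True, e # B, P', Q')" "canon es P'" "canon es Q'" "set P \<subseteq> set P'"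
      "set P' \<union> set Q' \<subseteq> set P \<union> set Q" "inv X (set P') (set Q')" for P' Q'
  proof -
    have "covs X (set P' \<union> set Q')" using h(1) iX by (simp add: okB_def covAW_iff)
    then have X': "Xs (set B) (set P' \<union> set Q') = X"
      using iX cov_mono[OF h(5)] unfolding covs_def Xs_def by blast
    have n: "N \<subseteq> set P'" and w: "set P' \<union> set Q' \<subseteq> N \<union> W" using i1 h(4,5) by blast+
    have "\<exists>S\<in>Comp X (set P') (set Q'). \<not> tr EE eB S"
      using h(1) bornl_iff[OF n w X' h(6)] by (simp add: okB_def)
    then have "invB e B P' Q'" unfolding invB_def
      using k h(2,3,6) n w X'
      by (intro conjI exI[of _ T] exI[of _ y] exI[of _ NL]) (simp_all add: set_NL set_WL)
    then show ?thesis using pre X' by simp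
  qed
  have okI: "okB es e B il y P Q (True, e # B, P', Q')"
    if h: "set P \<subseteq> set P'" "set P' \<union> set Q' \<subseteq> set P \<union> set Q" "inv X (set P') (set Q')"
      "S \<in> Comp X (set P') (set Q')" "\<not> tr EE eB S" for P' Q' S
  proof -
    have c: "covs X (set P' \<union> set Q')" using Comp_covs h(4) .
    then have X': "Xs (set B) (set P' \<union> set Q') = X"
      using iX cov_mono[OF h(2)] unfolding covs_def Xs_def by blast
    have n: "N \<subseteq> set P'" and w: "set P' \<union> set Q' \<subseteq> N \<union> W" using i1 h(1,2) by blast+
    show ?thesis using c iX bornl_iff[OF n w X' h(3)] h(4,5) by (auto simp: okB_def covAW_iff)
  qed
  have qsX: "set (qs es B P Q) = {v \<in> X. \<not> cov (set P) v}"
    using iX cov_mono[OF AE] cov_mono[OF WE] by (auto simp: qs_def set_vl Xs_def)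
  have "(\<forall>c\<in>set (childB es e B P Q). invN c \<and> (c = (False, B, P, []) \<or> (\<exists>P' Q' q. c = (True, e # B, P', Q') \<and>
      set P \<subseteq> set P' \<and> q \<in> set (vl es) \<and> \<not> cov (set P) q \<and> cov (set P') q))) \<and>
    (\<forall>S. (\<exists>c\<in>set (childB es e B P Q). S \<in> Gr c) \<longleftrightarrow> S \<in> Gr (True, e # B, P, Q)) \<and>
    (\<forall>c\<in>set (childB es e B P Q). \<forall>c'\<in>set (childB es e B P Q). \<forall>S. S \<in> Gr c \<longrightarrow> S \<in> Gr c' \<longrightarrow> c = c')"
  proof (cases "qs es B P Q")
    case Nil
    then have C: "Comp X (set P) (set Q) = {set P}" using Comp_leaf[OF iI] qsX by (auto simp: covs_def)
    have P: "\<not> tr EE eB (set P)" "set P \<in> Comp X N W" using i(5) iX C sub[of "set P"] by simp_all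
    have "P \<in> sols B" by (rule group_same(1)[OF cA P(2)])
    moreover have "Gr (True, e # B, P, Q) = {P}" using gG C P(1) cA canon_eq by auto
    moreover have "\<exists>pre. es = pre @ B" using pre by (metis append.assoc append_Cons append_Nil)
    ultimately show ?thesis using Nil by (simp add: childB_def)
  next
    case (Cons q l)
    then have "q \<in> set (qs es B P Q)" by simp
    then have q: "q \<in> X" "\<not> cov (set P) q" "q \<in> set (vl es)" unfolding qsX using Cons by (auto simp: qs_def filter_eq_Cons_iff)
    define n1 where "n1 w = (True, e # B, unionl es [w] P, W1l Q q)" for w
    define n2 where "n2 wi wj = (True, e # B, unionl es [wi, wj] P, W2l Q q wi wj)" for wi wj
    have mem: "c \<in> set (childB es e B P Q) \<longleftrightarrow> okB es e B il y P Q c \<and>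
       ((\<exists>w\<in>set Q. inc w q \<and> c = n1 w) \<or> (\<exists>wi\<in>set Q. \<exists>wj\<in>set Q. ok2 B P q wi wj \<and> c = n2 wi wj))" for c
      using Cons uI uY by (auto simp: childB_def ch1_def ch2_def n1_def n2_def)
    have s1: "set (unionl es [w] P) = insert w (set P)" "set (W1l Q q) = W1 (set Q) q"
      "inv X (insert w (set P)) (W1 (set Q) q)" if "w \<in> set Q" "inc w q" for w
    proof -
      show "set (unionl es [w] P) = insert w (set P)" using set_unionl[of "[w]" es P] AE WE that by auto
      show "set (W1l Q q) = W1 (set Q) q" by (auto simp: W1l_def W1_def)
      show "inv X (insert w (set P)) (W1 (set Q) q)" by (rule inv_step1[OF iI q(1,2) that])
    qed
    have s2: "set (unionl es [wi, wj] P) = insert wi (insert wj (set P))" "set (W2l Q q wi wj) = W2 (set Q) q wi wj"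
      "inv X (insert wi (insert wj (set P))) (W2 (set Q) q wi wj)"
      if "wi \<in> set Q" "wj \<in> set Q" "ok2 B P q wi wj" for wi wj
    proof -
      have o: "inc wi q" "inc wj q" "oth wi q < oth wj q" "\<not> cov (set B) (oth wi q)" "\<not> cov (set B) (oth wj q)"
        "\<not> cov (set P) (oth wi q)" "\<not> cov (set P) (oth wj q)" using that(3) by (simp_all add: ok2_def)
      have "cov (set Q) (oth wi q)" "cov (set Q) (oth wj q)"
        using covI[OF that(1) inc_oth[OF o(1)]] covI[OF that(2) inc_oth[OF o(2)]] .
      then have oX: "oth wi q \<in> X" "oth wj q \<in> X" unfolding iX[symmetric] using o(4,5) by (simp_all add: Xs_def)
      show "set (unionl es [wi, wj] P) = insert wi (insert wj (set P))"
        using set_unionl[of "[wi, wj]" es P] AE WE that by auto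
      show "set (W2l Q q wi wj) = W2 (set Q) q wi wj" by (auto simp: W2l_def W2_def)
      show "inv X (insert wi (insert wj (set P))) (W2 (set Q) q wi wj)"
        by (rule inv_step2[OF iI AE WE that(1,2) o(1-3) oX o(6,7)])
    qed
    have c1: "canon es (W1l Q q)" "canon es (W2l Q q wi wj)" for wi wj
      unfolding W1l_def W2l_def by (rule canon_filter[OF cW])+
    have N1: "invN (n1 w) \<and> (\<forall>S. S \<in> Gr (n1 w) \<longleftrightarrow> canon es S \<and>
      set S \<in> Comp X (insert w (set P)) (W1 (set Q) q) \<and> \<not> tr EE eB (set S))"
      if w: "w \<in> set Q" "inc w q" "okB es e B il y P Q (n1 w)" for w
    proof -
      note s = s1[OF w(1,2)]
      show ?thesis unfolding n1_def s(1,2)[symmetric]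
        by (rule new[OF w(3)[unfolded n1_def] canon_unionl c1(1)]) (use s w(1) in \<open>auto simp: W1_def\<close>)
    qed
    have N2: "invN (n2 wi wj) \<and> (\<forall>S. S \<in> Gr (n2 wi wj) \<longleftrightarrow> canon es S \<and>
      set S \<in> Comp X (insert wi (insert wj (set P))) (W2 (set Q) q wi wj) \<and> \<not> tr EE eB (set S))"
      if w: "wi \<in> set Q" "wj \<in> set Q" "ok2 B P q wi wj" "okB es e B il y P Q (n2 wi wj)" for wi wj
    proof -
      note s = s2[OF w(1-3)]
      show ?thesis unfolding n2_def s(1,2)[symmetric]
        by (rule new[OF w(4)[unfolded n2_def] canon_unionl c1(2)]) (use s w(1,2) in \<open>auto simp: W2_def\<close>)
    qed
    have "invN c \<and> (\<exists>P' Q' q. c = (True, e # B, P', Q') \<and>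
      set P \<subseteq> set P' \<and> q \<in> set (vl es) \<and> \<not> cov (set P) q \<and> cov (set P') q)" if c: "c \<in> set (childB es e B P Q)" for c
    proof -
      from c[unfolded mem] consider w where "w \<in> set Q" "inc w q" "c = n1 w" "okB es e B il y P Q c"
        | wi wj where "wi \<in> set Q" "wj \<in> set Q" "ok2 B P q wi wj" "c = n2 wi wj" "okB es e B il y P Q c" by blast
      then show ?thesis
      proof cases
        case 1
        have "c = (True, e # B, unionl es [w] P, W1l Q q)" "set P \<subseteq> set (unionl es [w] P)" "cov (set (unionl es [w] P)) q"
          using 1 s1(1)[OF 1(1,2)] by (auto simp: n1_def)
        moreover have "invN c" using N1[OF 1(1,2) 1(4)[unfolded 1(3)]] unfolding 1(3) by (rule conjunct1)
        ultimately show ?thesis using q by blast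
      next
        case 2
        have "c = (True, e # B, unionl es [wi, wj] P, W2l Q q wi wj)" "set P \<subseteq> set (unionl es [wi, wj] P)" "cov (set (unionl es [wi, wj] P)) q"
          using 2 s2(1)[OF 2(1-3)] by (auto simp: n2_def ok2_def)
        moreover have "invN c" using N2[OF 2(1-3) 2(5)[unfolded 2(4)]] unfolding 2(4) by (rule conjunct1)
        ultimately show ?thesis using q by blast
      qed
    qed
    moreover have "(\<exists>c\<in>set (childB es e B P Q). S \<in> Gr c) \<longleftrightarrow> S \<in> Gr (True, e # B, P, Q)" for S
    proof
      assume "\<exists>c\<in>set (childB es e B P Q). S \<in> Gr c"
      then obtain c where c: "c \<in> set (childB es e B P Q)" "S \<in> Gr c" by blast
      from c(1)[unfolded mem] consider w where "w \<in> set Q" "inc w q" "c = n1 w" "okB es e B il y P Q c"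
        | wi wj where "wi \<in> set Q" "wj \<in> set Q" "ok2 B P q wi wj" "c = n2 wi wj" "okB es e B il y P Q c" by blast
      then show "S \<in> Gr (True, e # B, P, Q)"
      proof cases
        case 1
        have "insert w (set P) \<union> W1 (set Q) q \<subseteq> set P \<union> set Q" using 1(1) by (auto simp: W1_def)
        from Comp_mono[OF _ this, of X] show ?thesis using N1[OF 1(1,2)] 1(3,4) c(2) gG[of S] by blast
      next
        case 2
        have "insert wi (insert wj (set P)) \<union> W2 (set Q) q wi wj \<subseteq> set P \<union> set Q" using 2(1,2) by (auto simp: W2_def)
        from Comp_mono[OF _ this, of X] show ?thesis using N2[OF 2(1-3)] 2(4,5) c(2) gG[of S] by blast
      qed
    next
      assume "S \<in> Gr (True, e # B, P, Q)"
      then have S: "canon es S" "set S \<in> Comp X (set P) (set Q)" "\<not> tr EE eB (set S)" using gG by blast+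
      from Comp_branch[OF S(2) q(1,2) AE WE]
      consider w where "w\<in>set Q" "inc w q" "set S \<in> Comp X (insert w (set P)) (W1 (set Q) q)"
      | wi wj where "wi\<in>set Q" "wj\<in>set Q" "inc wi q" "inc wj q" "oth wi q < oth wj q" "oth wi q \<in> X" "oth wj q \<in> X"
       "\<not> cov (set P) (oth wi q)" "\<not> cov (set P) (oth wj q)" "set S \<in> Comp X (insert wi (insert wj (set P))) (W2 (set Q) q wi wj)"
        by blast
      then show "\<exists>c\<in>set (childB es e B P Q). S \<in> Gr c"
      proof cases
        case 1
        note s = s1[OF 1(1,2)]
        have ok: "okB es e B il y P Q (n1 w)" unfolding n1_def
          by (rule okI[where S = "set S"]) (use s 1 S in \<open>auto simp: W1_def\<close>)
        then have "n1 w \<in> set (childB es e B P Q)" unfolding mem using 1(1,2) by blast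
        moreover have "S \<in> Gr (n1 w)" using N1[OF 1(1,2) ok] 1(3) S by blast
        ultimately show ?thesis by blast
      next
        case 2
        have o2: "ok2 B P q wi wj" using 2 by (simp add: ok2_def)
        note s = s2[OF 2(1,2) o2]
        have ok: "okB es e B il y P Q (n2 wi wj)" unfolding n2_def
          by (rule okI[where S = "set S"]) (use s 2 S in \<open>auto simp: W2_def\<close>)
        then have "n2 wi wj \<in> set (childB es e B P Q)" unfolding mem using 2(1,2) o2 by blast
        moreover have "S \<in> Gr (n2 wi wj)" using N2[OF 2(1,2) o2 ok] 2(10) S by blast
        ultimately show ?thesis by blast
      qed
    qed
    moreover have "c = c'" if c: "c \<in> set (childB es e B P Q)" "c' \<in> set (childB es e B P Q)" and S: "S \<in> Gr c" "S \<in> Gr c'" for c c' S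
    proof -
      have *: "(\<exists>w. c = n1 w \<and> {g \<in> set S. inc g q} = {w}) \<or> (\<exists>wi wj. c = n2 wi wj \<and> wi \<in> set S \<and> wj \<in> set S \<and>
          inc wi q \<and> inc wj q \<and> oth wi q < oth wj q \<and> (\<forall>g\<in>set S. inc g q \<longrightarrow> g = wi \<or> g = wj \<or> oth wj q < oth g q))"
        if c: "c \<in> set (childB es e B P Q)" "S \<in> Gr c" for c
      proof -
        from c(1)[unfolded mem] consider w where "w \<in> set Q" "inc w q" "c = n1 w" "okB es e B il y P Q c"
        | wi wj where "wi \<in> set Q" "wj \<in> set Q" "ok2 B P q wi wj" "c = n2 wi wj" "okB es e B il y P Q c" by blast
        then show ?thesis
        proof cases
          case 1
          have "set S \<in> Comp X (insert w (set P)) (W1 (set Q) q)" using N1[OF 1(1,2)] 1(3,4) c(2) by blast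
          from Comp_W1[OF this q(2) 1(2)] show ?thesis using 1(3) by blast
        next
          case 2
          have "set S \<in> Comp X (insert wi (insert wj (set P))) (W2 (set Q) q wi wj)" using N2[OF 2(1-3)] 2(4,5) c(2) by blast
          note C = Comp_W2[OF this q(2)]
          have "inc wi q" "inc wj q" "oth wi q < oth wj q" using 2(3) by (simp_all add: ok2_def)
          then show ?thesis using C 2(4) by blast
        qed
      qed
      from *[OF c(1) S(1)] *[OF c(2) S(2)] show ?thesis
      proof (elim disjE exE conjE)
        fix w w' assume "c = n1 w" "{g \<in> set S. inc g q} = {w}" "c' = n1 w'" "{g \<in> set S. inc g q} = {w'}"
        then show ?thesis by simp
      next
        fix w wi wj assume h: "{g \<in> set S. inc g q} = {w}" "wi \<in> set S" "wj \<in> set S" "inc wi q" "inc wj q" "oth wi q < oth wj q"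
        then have "wi \<in> {w}" "wj \<in> {w}" by blast+
        then show ?thesis using h(6) by simp
      next
        fix w wi wj assume h: "{g \<in> set S. inc g q} = {w}" "wi \<in> set S" "wj \<in> set S" "inc wi q" "inc wj q" "oth wi q < oth wj q"
        then have "wi \<in> {w}" "wj \<in> {w}" by blast+
        then show ?thesis using h(6) by simp
      next
        fix wi wj vi vj
        assume "c = n2 wi wj" "wi \<in> set S" "wj \<in> set S" "inc wi q" "inc wj q" "oth wi q < oth wj q"
          "\<forall>g\<in>set S. inc g q \<longrightarrow> g = wi \<or> g = wj \<or> oth wj q < oth g q"
          "c' = n2 vi vj" "vi \<in> set S" "vj \<in> set S" "inc vi q" "inc vj q" "oth vi q < oth vj q"
          "\<forall>g\<in>set S. inc g q \<longrightarrow> g = vi \<or> g = vj \<or> oth vj q < oth g q"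
        \<comment> \<open>Both pairs consist of the two edges of \<open>S\<close> at
          \<open>q\<close> with the smallest far ends.\<close>
        then have "vi = wi \<and> vj = wj" by (metis less_asym less_trans)
        then show ?thesis using \<open>c = n2 wi wj\<close> \<open>c' = n2 vi vj\<close> by simp
      qed
    qed
    ultimately show ?thesis by blast
  qed
  then show "c \<in> set (childB es e B P Q) \<Longrightarrow> invN c \<and> (c = (False, B, P, []) \<or> (\<exists>P' Q' q. c = (True, e # B, P', Q') \<and>
      set P \<subseteq> set P' \<and> q \<in> set (vl es) \<and> \<not> cov (set P) q \<and> cov (set P') q))"
    and "(\<Union>c\<in>set (childB es e B P Q). Gr c) = Gr (True, e # B, P, Q)"
    and "c \<in> set (childB es e B P Q) \<Longrightarrow> c' \<in> set (childB es e B P Q) \<Longrightarrow> S \<in> Gr c \<Longrightarrow> S \<in> Gr c' \<Longrightarrow> c = c'"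
    by blast+
qed

section \<open>The outputs below a node, and a rank that bounds the depth below it\<close>

definition lev :: "node \<Rightarrow> edge list" where
  "lev nd = (if fst nd then tl (fst (snd nd)) else fst (snd nd))"

definition Sem :: "node \<Rightarrow> edge list set" where
  "Sem nd = {D \<in> sols []. anc es (lev nd) D \<in> Gr nd}"

text \<open>\<open>vl es\<close> has \<open>2 * length es\<close> entries, so \<open>M\<close>
  exceeds any count of uncovered entries by at least two. A node for a group at \<open>e # B\<close>
  thus ranks strictly between the solutions of \<open>B\<close> and those of \<open>e # B\<close>,
  and the rank falls whenever a vertex gets covered.\<close>

definition rank :: "node \<Rightarrow> nat" where
  "rank nd = (let M = 2 * length es + 2 in if fst nd then (length (fst (snd nd)) - 1) * M + 1 +
     length (filter (\<lambda>v. \<not> cov (set (fst (snd (snd nd)))) v) (vl es)) else length (fst (snd nd)) * M)"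

lemma anc_sols: "es = pre @ rest \<Longrightarrow> D \<in> sols [] \<Longrightarrow> anc es rest D \<in> sols rest"
proof (induction rest arbitrary: pre)
  case (Cons e B)
  have "e \<in> EE" "es = (pre @ [e]) @ B" using Cons.prems(1) by auto
  then show ?case using Cons.IH[OF _ Cons.prems(2)] parl_sols by simp
qed simp

text \<open>The child \<open>natl\<close> always exists, so every solution has a descendant at the
  empty level. With \<open>Gr_ne\<close> this excludes dead ends.\<close>

lemma anc_surj: "es = pre @ rest \<Longrightarrow> T \<in> sols rest \<Longrightarrow> \<exists>D\<in>sols []. anc es rest D = T"
proof (induction rest arbitrary: pre T)
  case (Cons e B)
  have e: "e \<in> EE" and p: "es = (pre @ [e]) @ B" using Cons.prems(1) by auto
  obtain D where "D \<in> sols []" "anc es B D = natl es e B T"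
    using Cons.IH[OF p natl_sols(1)[OF Cons.prems(2) e]] by blast
  then show ?case using natl_sols(3)[OF Cons.prems(2) e] by (intro bexI[of _ D]) simp_all
qed simp

lemma Gr_sols:
  assumes "invN nd" "S \<in> Gr nd"
  shows "S \<in> sols (lev nd)"
proof -
  obtain fl rest A V where nd: "nd = (fl, rest, A, V)" by (cases nd)
  show ?thesis
  proof (cases fl)
    case False
    then show ?thesis using assms by (simp add: nd lev_def)
  next
    case True
    then obtain e B where r: "rest = e # B" using assms(1) by (cases rest) (auto simp: nd invN_def)
    have iv: "invB e B A V" using assms(1) True by (simp add: nd r)
    obtain T y where k: "open_end_list es e B T y"
      and i: "set (Nl es e B (ul es (B @ T)) y T) \<subseteq> set A"
      "set A \<union> set V \<subseteq> set (Nl es e B (ul es (B @ T)) y T) \<union> set (Wl es e B (ul es (B @ T)) y (Nl es e B (ul es (B @ T)) y T))"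
      "Xs (set B) (set A \<union> set V) = {v. cov (set T) v \<and> \<not> cov (set B) v}"
      using iv unfolding invB_def by blast
    interpret open_end_list es e B T y by (rule k)
    have i1: "N \<subseteq> set A" "set A \<union> set V \<subseteq> N \<union> W" using i(1,2) by (simp_all only: set_NL set_WL)
    have "canon es S" "set S \<in> Comp X (set A) (set V)" using assms(2) i(3) True by (simp_all add: nd r)
    then show ?thesis using group_same(1)[of S] Comp_mono[OF i1, of X] True by (auto simp: nd r lev_def)
  qed
qed

lemma lev_suffix:
  assumes "invN nd"
  shows "\<exists>pre. es = pre @ lev nd"
proof -
  obtain fl rest A V where nd: "nd = (fl, rest, A, V)" by (cases nd)
  obtain pre where p: "es = pre @ rest" using assms by (auto simp: nd invN_def)
  show ?thesis
  proof (cases "fl \<and> rest \<noteq> []")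
    case True
    then have "es = (pre @ [hd rest]) @ lev nd" using p by (cases rest) (simp_all add: nd lev_def)
    then show ?thesis by blast
  next
    case False
    then show ?thesis using p assms by (auto simp: nd lev_def invN_def)
  qed
qed

lemma Gr_ne: "invN nd \<Longrightarrow> Gr nd \<noteq> {}"
  using invB_ne by (cases nd; cases "fst (snd nd)"; cases "fst nd") (auto simp: invN_def Gr_def)

lemma Sem_ne:
  assumes "invN nd"
  shows "Sem nd \<noteq> {}"
proof -
  obtain S where S: "S \<in> Gr nd" using Gr_ne[OF assms] by blast
  obtain pre where p: "es = pre @ lev nd" using lev_suffix[OF assms] by blast
  show ?thesis using anc_surj[OF p Gr_sols[OF assms S]] S by (auto simp: Sem_def)
qed

lemma children_Nil: "children es (fl, [], A, V) = []"
  by (simp add: children_def)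

lemma children_invA:
  assumes P: "P \<in> sols (e # B)" and pre: "\<exists>pre. es = pre @ e # B" and c: "c \<in> set (childA es e B P)"
  shows "invN c" "lev c = B" "rank c < rank (False, e # B, P, [])"
proof -
  have e: "e \<in> EE" using pre by auto
  have pB: "\<exists>pre. es = pre @ B" using pre by (metis append.assoc append_Cons append_Nil)
  consider T where "c = (False, B, T, [])" "T \<in> sols B" | "c \<in> set (candB es e B P)"
    using c natl_sols(1)[OF P e] by (auto simp: childA_def candA_iff sols_def trl_iff)
  then have "invN c \<and> lev c = B \<and> rank c < rank (False, e # B, P, [])"
  proof cases
    case 1
    then show ?thesis using pB by (simp add: lev_def rank_def Let_def)
  next
    case 2
    then obtain A V where c: "c = (True, e # B, A, V)" "invB e B A V" using candB_props(1)[OF 2 e] by blast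
    have "length (filter (\<lambda>v. \<not> cov (set A) v) (vl es)) \<le> length (vl es)" by (rule length_filter_le)
    then have "length (filter (\<lambda>v. \<not> cov (set A) v) (vl es)) \<le> 2 * length es" by (simp add: vl_def)
    then show ?thesis using c pre by (simp add: lev_def rank_def Let_def)
  qed
  then show "invN c" "lev c = B" "rank c < rank (False, e # B, P, [])" by blast+
qed

lemma length_filter_less:
  assumes "x \<in> set xs" "\<not> P x" "Q x" "\<And>z. P z \<Longrightarrow> Q z"
  shows "length (filter P xs) < length (filter Q xs)"
  using assms(1)
proof (induction xs)
  case (Cons a l)
  have "length (filter P l) \<le> length (filter Q l)" using assms(4) by (induction l) (auto simp: le_SucI)
  then show ?case using Cons assms(2-4) by auto
qed simp

lemma children_invB:
  assumes iv: "invB e B P Q" and pre: "\<exists>pre. es = pre @ e # B" and c: "c \<in> set (childB es e B P Q)"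
  shows "invN c" "lev c = B" "rank c < rank (True, e # B, P, Q)"
proof -
  note h = childB_props(1)[OF iv pre c]
  show "invN c" using h by blast
  have "lev c = B \<and> rank c < rank (True, e # B, P, Q)"
  proof (cases "c = (False, B, P, [])")
    case True
    then show ?thesis by (simp add: lev_def rank_def Let_def)
  next
    case False
    then obtain P' Q' q where c: "c = (True, e # B, P', Q')" "set P \<subseteq> set P'" "q \<in> set (vl es)" "\<not> cov (set P) q" "cov (set P') q"
      using h by blast
    have "length (filter (\<lambda>v. \<not> cov (set P') v) (vl es)) < length (filter (\<lambda>v. \<not> cov (set P) v) (vl es))"
      by (rule length_filter_less[OF c(3)]) (use c cov_mono[OF c(2)] in auto)
    then show ?thesis by (simp add: c(1) lev_def rank_def Let_def)
  qed
  then show "lev c = B" "rank c < rank (True, e # B, P, Q)" by blast+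
qed

lemma children_props:
  assumes iv: "invN (fl, e # B, A, V)"
  shows "c \<in> set (children es (fl, e # B, A, V)) \<Longrightarrow> invN c \<and> rank c < rank (fl, e # B, A, V)"
    "distinct (children es (fl, e # B, A, V))"
    "(\<Union>c\<in>set (children es (fl, e # B, A, V)). Sem c) = Sem (fl, e # B, A, V)"
    "c \<in> set (children es (fl, e # B, A, V)) \<Longrightarrow> c' \<in> set (children es (fl, e # B, A, V)) \<Longrightarrow> D \<in> Sem c \<Longrightarrow> D \<in> Sem c' \<Longrightarrow> c = c'"
proof -
  have pre: "\<exists>pre. es = pre @ e # B" using iv by (auto simp: invN_def)
  then have e: "e \<in> EE" by auto
  have pB: "\<exists>pre. es = pre @ B" using pre by (metis append.assoc append_Cons append_Nil)
  have ancB: "D \<in> sols [] \<Longrightarrow> anc es B D \<in> sols B" for D using anc_sols pB by blast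
  have "distinct (children es (fl, e # B, A, V)) \<and>
    (\<forall>c\<in>set (children es (fl, e # B, A, V)). invN c \<and> lev c = B \<and> rank c < rank (fl, e # B, A, V)) \<and>
    (\<Union>c\<in>set (children es (fl, e # B, A, V)). Sem c) = Sem (fl, e # B, A, V) \<and>
    (\<forall>c\<in>set (children es (fl, e # B, A, V)). \<forall>c'\<in>set (children es (fl, e # B, A, V)). \<forall>D. D \<in> Sem c \<longrightarrow> D \<in> Sem c' \<longrightarrow> c = c')"
  proof (cases fl)
    case True
    have ib: "invB e B A V" using iv True by simp
    have ch: "children es (fl, e # B, A, V) = dedup (childB es e B A V)" using True by (simp add: children_def)
    have st: "set (children es (fl, e # B, A, V)) = set (childB es e B A V)" by (simp add: ch dedup)
    note p = childB_props[OF ib pre] and q = children_invB[OF ib pre]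
    have "(\<Union>c\<in>set (childB es e B A V). Sem c) = {D \<in> sols []. anc es B D \<in> (\<Union>c\<in>set (childB es e B A V). Gr c)}"
      using q(2) by (auto simp: Sem_def)
    also have "\<dots> = Sem (fl, e # B, A, V)" unfolding p(2) by (simp add: Sem_def lev_def True)
    finally have U: "(\<Union>c\<in>set (childB es e B A V). Sem c) = Sem (fl, e # B, A, V)" .
    have X: "\<forall>c\<in>set (childB es e B A V). \<forall>c'\<in>set (childB es e B A V). \<forall>D. D \<in> Sem c \<longrightarrow> D \<in> Sem c' \<longrightarrow> c = c'"
    proof (intro ballI allI impI)
      fix c c' D assume that: "c \<in> set (childB es e B A V)" "c' \<in> set (childB es e B A V)" "D \<in> Sem c" "D \<in> Sem c'"
      show "c = c'" by (rule p(3)[OF that(1,2), of "anc es B D"]) (use that q(2) in \<open>auto simp: Sem_def\<close>)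
    qed
    moreover have "distinct (children es (fl, e # B, A, V))" by (simp add: ch dedup)
    moreover have "\<forall>c\<in>set (childB es e B A V). invN c \<and> lev c = B \<and> rank c < rank (fl, e # B, A, V)" using q True by simp
    ultimately show ?thesis unfolding st using U X by (intro conjI) simp_all
  next
    case False
    have P: "A \<in> sols (e # B)" and V: "V = []" using iv False by auto
    have ch: "children es (fl, e # B, A, V) = dedup (childA es e B A)" using False by (simp add: children_def)
    have st: "set (children es (fl, e # B, A, V)) = set (childA es e B A)" by (simp add: ch dedup)
    note q = children_invA[OF P pre]
    have "(\<Union>c\<in>set (childA es e B A). Sem c) = {D \<in> sols []. anc es B D \<in> (\<Union>c\<in>set (childA es e B A). Gr c)}"
      using q(2) by (auto simp: Sem_def)
    also have "\<dots> = Sem (fl, e # B, A, V)" unfolding childA_Gr[OF P e] using ancB False by (auto simp: Sem_def lev_def)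
    finally have U: "(\<Union>c\<in>set (childA es e B A). Sem c) = Sem (fl, e # B, A, V)" .
    have X: "\<forall>c\<in>set (childA es e B A). \<forall>c'\<in>set (childA es e B A). \<forall>D. D \<in> Sem c \<longrightarrow> D \<in> Sem c' \<longrightarrow> c = c'"
    proof (intro ballI allI impI)
      fix c c' D assume that: "c \<in> set (childA es e B A)" "c' \<in> set (childA es e B A)" "D \<in> Sem c" "D \<in> Sem c'"
      show "c = c'" by (rule childA_disj[OF P e that(1,2), of "anc es B D"]) (use that q(2) in \<open>auto simp: Sem_def\<close>)
    qed
    moreover have "distinct (children es (fl, e # B, A, V))" by (simp add: ch dedup)
    moreover have "\<forall>c\<in>set (childA es e B A). invN c \<and> lev c = B \<and> rank c < rank (fl, e # B, A, V)" using q False V by simp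
    ultimately show ?thesis unfolding st using U X by (intro conjI) simp_all
  qed
  then show "c \<in> set (children es (fl, e # B, A, V)) \<Longrightarrow> invN c \<and> rank c < rank (fl, e # B, A, V)"
    "distinct (children es (fl, e # B, A, V))"
    "(\<Union>c\<in>set (children es (fl, e # B, A, V)). Sem c) = Sem (fl, e # B, A, V)"
    "c \<in> set (children es (fl, e # B, A, V)) \<Longrightarrow> c' \<in> set (children es (fl, e # B, A, V)) \<Longrightarrow> D \<in> Sem c \<Longrightarrow> D \<in> Sem c' \<Longrightarrow> c = c'"
    by blast+
qed

lemma invN_root: "invN (False, es, [], [])" and Sem_root: "Sem (False, es, [], []) = sols []"
proof -
  have "eds EE EE" unfolding eds_iff by (auto simp: inc_def cov_def)
  then have "tr EE EE {}" by (simp add: tr_def)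
  then show "invN (False, es, [], [])" by (simp add: sols_def canon_Nil)
  have "T = []" if T: "T \<in> sols es" for T
  proof (rule ccontr)
    assume "T \<noteq> []"
    then obtain t where t: "t \<in> set T" by (cases T) auto
    have "eds EE (EE \<union> (set T - {t}))" using \<open>eds EE EE\<close> by (rule eds_mono[rotated]) auto
    then show False using T t unfolding sols_def tr_def by blast
  qed
  then show "Sem (False, es, [], []) = sols []" using anc_sols[of "[]" es] by (auto simp: Sem_def lev_def)
qed

end

subsection \<open>The search tree is computable in polynomial time\<close>

lemmas PT_rules = PT_id PT_const PT_pair PT_fst PT_snd PT_eq PT_Cons PT_if PT_case_list PT_not PT_conj PT_disj PT_imp
  PT_Bex PT_Ball PT_mem PT_rev PT_append PT_filter PT_concat_map PT_map PT_less PT_dedup PT_minz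

text \<open>Expresses the sets in \<open>bf\<close> through list functions, to which the rules for
  polynomial time apply.\<close>

lemma bf_list: "bf B eB S0 (set A) (set W) t t2 p \<longleftrightarrow> \<not> cov B p \<and> \<not> S0 p \<and> \<not> cov (set (remv t A)) p \<and>
     ((t2 = t \<and> \<not> S0 (oth t p) \<and> (cov eB p \<or> cov eB (oth t p)) \<and>
        covAW B (set A) (set W) (set (t # A @ filter (\<lambda>w. \<not> inc w p) W))) \<or>
      (t2 \<noteq> t \<and> inc t2 (oth t p) \<and> \<not> cov B (oth t2 (oth t p)) \<and> \<not> cov (set (remv t2 A)) (oth t2 (oth t p)) \<and>
        covAW B (set A) (set W) (set (t # t2 # A @ filter (\<lambda>w. \<not> inc w p \<and> \<not> inc w (oth t2 (oth t p))) W))))"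
  by (simp add: bf_def Un_insert_left)

text \<open>Arguments are polynomial-time functions of a common environment \<open>z\<close>. Under
  a bound variable the environment is enlarged to a pair, and \<open>assms[THEN PT_comp]\<close>
  carries the arguments over to it by composing them with a projection. All the rules below have
  this form.\<close>

lemma PT_inc:
  assumes "PT f" "PT v"
  shows "PT (\<lambda>z. inc (f z) (v z))"
  unfolding inc_def
  by (intro PT_rules assms[THEN PT_comp])

lemma PT_oth:
  assumes "PT f" "PT v"
  shows "PT (\<lambda>z. oth (f z) (v z))"
  unfolding oth_def
  by (intro PT_rules assms[THEN PT_comp])

lemma PT_cov:
  assumes "PT l" "PT v"
  shows "PT (\<lambda>z. cov (set (l z)) (v z))"
  unfolding cov_def
  by (intro PT_rules PT_inc assms[THEN PT_comp])

lemma PT_adj: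
  assumes "PT l" "PT u" "PT v"
  shows "PT (\<lambda>z. adj (set (l z)) (u z) (v z))"
  unfolding adj_def
  by (intro PT_rules assms[THEN PT_comp])

lemma PT_eds:
  assumes "PT l" "PT m"
  shows "PT (\<lambda>z. eds (set (l z)) (set (m z)))"
  unfolding eds_def
  by (intro PT_rules PT_cov assms[THEN PT_comp])

lemma PT_St:
  assumes "PT l" "PT e" "PT B" "PT y" "PT I" "PT v"
  shows "PT (\<lambda>z. St (set (l z)) (e z) (set (B z)) (y z) (set (I z)) (v z))"
  unfolding St_def
  by (intro PT_rules PT_inc PT_cov PT_adj assms[THEN PT_comp])

lemma PT_prc:
  assumes "PT l" "PT e" "PT B" "PT y" "PT I" "PT a" "PT b"
  shows "PT (\<lambda>z. prc (set (l z)) (e z) (set (B z)) (y z) (set (I z)) (a z) (b z))"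
  unfolding prc_def
  by (intro PT_rules PT_oth PT_St assms[THEN PT_comp])

lemma PT_Rv:
  assumes "PT l" "PT B" "PT I" "PT v"
  shows "PT (\<lambda>z. Rv (set (l z)) (set (B z)) (set (I z)) (v z))"
  unfolding Rv_def
  by (intro PT_rules PT_cov PT_adj assms[THEN PT_comp])

lemma PT_Lv:
  assumes "PT l" "PT B" "PT I" "PT v"
  shows "PT (\<lambda>z. Lv (set (l z)) (set (B z)) (set (I z)) (v z))"
  unfolding Lv_def
  by (intro PT_rules PT_cov PT_adj assms[THEN PT_comp])

lemma PT_rp:
  assumes "PT l" "PT e" "PT B" "PT y" "PT I" "PT T" "PT r" "PT f"
  shows "PT (\<lambda>z. rp (set (l z)) (set (B z)) (set (I z)) (prc (set (l z)) (e z) (set (B z)) (y z) (set (I z))) (set (T z)) (r z) (f z))"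
  unfolding rp_def
  by (intro PT_rules PT_inc PT_oth PT_prc PT_Rv assms[THEN PT_comp])

lemma PT_rc:
  assumes "PT l" "PT e" "PT B" "PT y" "PT I" "PT N" "PT v" "PT q"
  shows "PT (\<lambda>z. rc (set (l z)) (set (B z)) (set (I z)) (prc (set (l z)) (e z) (set (B z)) (y z) (set (I z))) (set (N z)) (v z) (q z))"
  unfolding rc_def
  by (intro PT_rules PT_inc PT_oth PT_prc PT_Rv assms[THEN PT_comp])

lemma PT_Fv:
  assumes "PT l" "PT B" "PT I" "PT N" "PT q"
  shows "PT (\<lambda>z. Fv (set (l z)) (set (B z)) (set (I z)) (set (N z)) (q z))"
  unfolding Fv_def
  by (intro PT_rules PT_cov PT_Lv assms[THEN PT_comp])

lemma PT_okw:
  assumes "PT l" "PT e" "PT B" "PT y" "PT I" "PT N" "PT q" "PT v"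
  shows "PT (\<lambda>z. okw (set (l z)) (set (B z)) (set (I z)) (prc (set (l z)) (e z) (set (B z)) (y z) (set (I z))) (set (N z)) (q z) (v z))"
  unfolding okw_def
  by (intro PT_rules PT_cov PT_prc PT_rc PT_Fv assms[THEN PT_comp])

lemma PT_okw0:
  assumes "PT l" "PT e" "PT B" "PT y" "PT I" "PT N" "PT q" "PT v"
  shows "PT (\<lambda>z. okw0 (set (l z)) (e z) (set (B z)) (y z) (set (I z)) (set (N z)) (q z) (v z))"
  unfolding okw0_def
  by (intro PT_rules PT_inc PT_cov PT_St PT_prc PT_rc PT_Fv assms[THEN PT_comp])

lemma PT_covAW:
  assumes "PT B" "PT A" "PT W" "PT S"
  shows "PT (\<lambda>z. covAW (set (B z)) (set (A z)) (set (W z)) (set (S z)))"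
  unfolding covAW_def set_append[symmetric]
  by (intro PT_rules PT_cov assms[THEN PT_comp])

lemma PT_vl:
  assumes "PT l"
  shows "PT (\<lambda>z. vl (l z))"
  unfolding vl_def
  by (intro PT_rules assms[THEN PT_comp])

lemma PT_ul:
  assumes "PT l" "PT S"
  shows "PT (\<lambda>z. ul (l z) (S z))"
  unfolding ul_def
  by (intro PT_rules PT_cov PT_vl assms[THEN PT_comp])

lemma PT_unionl:
  assumes "PT l" "PT A" "PT W"
  shows "PT (\<lambda>z. unionl (l z) (A z) (W z))"
  unfolding unionl_def
  by (intro PT_rules assms[THEN PT_comp])

lemma PT_remv:
  assumes "PT t" "PT T"
  shows "PT (\<lambda>z. remv (t z) (T z))"
  unfolding remv_def
  by (intro PT_rules assms[THEN PT_comp])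

lemma PT_trl:
  assumes "PT l" "PT B" "PT T"
  shows "PT (\<lambda>z. trl (l z) (B z) (T z))"
  unfolding trl_def
  by (intro PT_rules PT_eds PT_remv assms[THEN PT_comp])

lemma PT_natl:
  assumes "PT l" "PT e" "PT B" "PT T"
  shows "PT (\<lambda>z. natl (l z) (e z) (B z) (T z))"
  unfolding natl_def
  by (intro PT_rules PT_eds PT_unionl assms[THEN PT_comp])

lemma PT_redl:
  assumes "PT l" "PT B" "PT T"
  shows "PT (\<lambda>z. redl (l z) (B z) (T z))"
  unfolding redl_def
  by (intro PT_rules PT_eds assms[THEN PT_comp])

lemma PT_Nl:
  assumes "PT l" "PT e" "PT B" "PT I" "PT y" "PT T"
  shows "PT (\<lambda>z. Nl (l z) (e z) (B z) (I z) (y z) (T z))"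
  unfolding Nl_def
  by (intro PT_rules PT_prc PT_rp assms[THEN PT_comp])

lemma PT_Wl:
  assumes "PT l" "PT e" "PT B" "PT I" "PT y" "PT N"
  shows "PT (\<lambda>z. Wl (l z) (e z) (B z) (I z) (y z) (N z))"
  unfolding Wl_def
  by (intro PT_rules PT_prc PT_okw assms[THEN PT_comp])

lemma PT_W0l:
  assumes "PT l" "PT e" "PT B" "PT I" "PT y" "PT N"
  shows "PT (\<lambda>z. W0l (l z) (e z) (B z) (I z) (y z) (N z))"
  unfolding W0l_def
  by (intro PT_rules PT_okw0 assms[THEN PT_comp])

lemma PT_Xl:
  assumes "PT e" "PT y" "PT N"
  shows "PT (\<lambda>z. Xl (e z) (y z) (N z))"
  unfolding Xl_def
  by (intro PT_rules PT_inc PT_oth assms[THEN PT_comp])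

lemma PT_parb:
  assumes "PT l" "PT e" "PT B" "PT I" "PT y" "PT N"
  shows "PT (\<lambda>z. parb (l z) (e z) (B z) (I z) (y z) (N z))"
  unfolding parb_def
  by (intro PT_rules PT_inc PT_oth PT_eds PT_unionl PT_W0l assms[THEN PT_comp])

lemma PT_uy:
  assumes "PT e" "PT S"
  shows "PT (\<lambda>z. uy (e z) (S z))"
  unfolding uy_def
  by (intro PT_rules PT_cov assms[THEN PT_comp])

lemma PT_covd:
  assumes "PT e" "PT S"
  shows "PT (\<lambda>z. covd (e z) (S z))"
  unfolding covd_def
  by (intro PT_rules PT_cov assms[THEN PT_comp])

lemma PT_candA:
  assumes "PT l" "PT e" "PT B" "PT T"
  shows "PT (\<lambda>z. candA (l z) (e z) (B z) (T z))"
  unfolding candA_def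
  by (intro PT_rules PT_unionl PT_remv PT_trl PT_redl PT_covd assms[THEN PT_comp])

lemma PT_deci:
  assumes "PT l" "PT e" "PT B" "PT T" "PT y" "PT X"
  shows "PT (\<lambda>z. deci (l z) (e z) (B z) (T z) (y z) (X z))"
  unfolding deci_def
  by (intro PT_rules PT_cov PT_adj PT_vl assms[THEN PT_comp])

lemma PT_minX:
  assumes "PT l" "PT B" "PT I" "PT N" "PT W"
  shows "PT (\<lambda>z. minX (l z) (B z) (I z) (N z) (W z))"
  unfolding minX_def
  by (intro PT_rules PT_cov PT_vl PT_unionl assms[THEN PT_comp])

lemma PT_decl1:
  assumes "PT l" "PT e" "PT B" "PT I" "PT y" "PT N"
  shows "PT (\<lambda>z. decl1 (l z) (e z) (B z) (I z) (y z) (N z))"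
  unfolding decl1_def
  by (intro PT_rules PT_Wl PT_minX assms[THEN PT_comp])

lemma PT_decl:
  assumes "PT l" "PT e" "PT B" "PT T" "PT y" "PT X"
  shows "PT (\<lambda>z. decl (l z) (e z) (B z) (T z) (y z) (X z))"
  unfolding decl_def
  by (intro PT_rules PT_unionl PT_Nl PT_deci PT_decl1 assms[THEN PT_comp])

lemma PT_bornl:
  assumes "PT l" "PT e" "PT B" "PT I" "PT y" "PT A" "PT W"
  shows "PT (\<lambda>z. bornl (l z) (e z) (B z) (I z) (y z) (A z) (W z))"
  unfolding bornl_def bornf_def bf_list set_append[symmetric]
  by (intro PT_rules PT_inc PT_oth PT_cov PT_St PT_covAW PT_remv assms[THEN PT_comp])

lemma PT_gB2:
  assumes "PT l" "PT e" "PT B" "PT T" "PT y" "PT X" "PT S" "PT I" "PT N" "PT W"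
  shows "PT (\<lambda>z. gB2 (l z) (e z) (B z) (T z) (y z) (X z) (S z) (I z) (N z) (W z))"
  unfolding gB2_def
  by (intro PT_rules PT_cov PT_trl PT_Xl PT_parb PT_bornl assms[THEN PT_comp])

lemma PT_gB1:
  assumes "PT l" "PT e" "PT B" "PT T" "PT y" "PT X" "PT S" "PT I" "PT N"
  shows "PT (\<lambda>z. gB1 (l z) (e z) (B z) (T z) (y z) (X z) (S z) (I z) (N z))"
  unfolding gB1_def
  by (intro PT_rules PT_Wl PT_gB2 assms[THEN PT_comp])

lemma PT_gB:
  assumes "PT l" "PT e" "PT B" "PT T" "PT y" "PT X" "PT S"
  shows "PT (\<lambda>z. gB (l z) (e z) (B z) (T z) (y z) (X z) (S z))"
  unfolding gB_def
  by (intro PT_rules PT_ul PT_Nl PT_gB1 assms[THEN PT_comp])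

lemma PT_candB:
  assumes "PT l" "PT e" "PT B" "PT T"
  shows "PT (\<lambda>z. candB (l z) (e z) (B z) (T z))"
  unfolding candB_def
  by (intro PT_rules PT_decl PT_gB assms[THEN PT_comp])

lemma PT_childA:
  assumes "PT l" "PT e" "PT B" "PT T"
  shows "PT (\<lambda>z. childA (l z) (e z) (B z) (T z))"
  unfolding childA_def
  by (intro PT_rules PT_natl PT_candA PT_candB assms[THEN PT_comp])

lemma PT_W1l:
  assumes "PT W" "PT q"
  shows "PT (\<lambda>z. W1l (W z) (q z))"
  unfolding W1l_def
  by (intro PT_rules PT_inc assms[THEN PT_comp])

lemma PT_W2l:
  assumes "PT W" "PT q" "PT a" "PT b"
  shows "PT (\<lambda>z. W2l (W z) (q z) (a z) (b z))"
  unfolding W2l_def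
  by (intro PT_rules PT_inc PT_oth assms[THEN PT_comp])

lemma PT_ch1:
  assumes "PT l" "PT r" "PT A" "PT W" "PT q"
  shows "PT (\<lambda>z. ch1 (l z) (r z) (A z) (W z) (q z))"
  unfolding ch1_def
  by (intro PT_rules PT_inc PT_unionl PT_W1l assms[THEN PT_comp])

lemma PT_ok2:
  assumes "PT B" "PT A" "PT q" "PT a" "PT b"
  shows "PT (\<lambda>z. ok2 (B z) (A z) (q z) (a z) (b z))"
  unfolding ok2_def
  by (intro PT_rules PT_inc PT_oth PT_cov assms[THEN PT_comp])

lemma PT_ch2:
  assumes "PT l" "PT r" "PT B" "PT A" "PT W" "PT q"
  shows "PT (\<lambda>z. ch2 (l z) (r z) (B z) (A z) (W z) (q z))"
  unfolding ch2_def
  by (intro PT_rules PT_unionl PT_W2l PT_ok2 assms[THEN PT_comp])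

lemma PT_okB:
  assumes "PT l" "PT e" "PT B" "PT I" "PT y" "PT A" "PT W" "PT nd"
  shows "PT (\<lambda>z. okB (l z) (e z) (B z) (I z) (y z) (A z) (W z) (nd z))"
  unfolding okB_def
  by (intro PT_rules PT_covAW PT_bornl assms[THEN PT_comp])

lemma PT_qs:
  assumes "PT l" "PT B" "PT A" "PT W"
  shows "PT (\<lambda>z. qs (l z) (B z) (A z) (W z))"
  unfolding qs_def
  by (intro PT_rules PT_cov PT_vl assms[THEN PT_comp])

lemma PT_childB:
  assumes "PT l" "PT e" "PT B" "PT A" "PT W"
  shows "PT (\<lambda>z. childB (l z) (e z) (B z) (A z) (W z))"
  unfolding childB_def
  by (intro PT_rules PT_ul PT_uy PT_ch1 PT_ch2 PT_okB PT_qs assms[THEN PT_comp])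

lemma PT_children:
  assumes "PT l" "PT nd"
  shows "PT (\<lambda>z. children (l z) (nd z))"
  unfolding children_def
  by (intro PT_rules PT_childA PT_childB assms[THEN PT_comp])

section \<open>Delay and space of a run\<close>

lemma run_config:
  assumes "run c s ts c' s'" "i \<le> length ts"
  shows "\<exists>ci si. ((\<lambda>(c, s). step c s) ^^ i) (c, s) = (ci, si) \<and> run c s (take i ts) ci si \<and>
    (i < length ts \<longrightarrow> ts ! i = (step_cost ci si, step_output ci si)) \<and> (i = length ts \<longrightarrow> ci = c' \<and> si = s')"
  using assms
proof (induction arbitrary: i rule: run.induct)
  case (run_refl c s)
  then show ?case by (auto intro: run.run_refl)
next
  case (run_step c s c' s' ts c'' s'')
  show ?case
  proof (cases i)
    case 0
    then show ?thesis by (auto intro: run.run_refl)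
  next
    case (Suc j)
    then obtain ci si where j: "((\<lambda>(c, s). step c s) ^^ j) (c', s') = (ci, si)" "run c' s' (take j ts) ci si"
      "j < length ts \<longrightarrow> ts ! j = (step_cost ci si, step_output ci si)" "j = length ts \<longrightarrow> ci = c'' \<and> si = s''"
      using run_step.IH[of j] run_step.prems by auto
    have "((\<lambda>(c, s). step c s) ^^ i) (c, s) = (ci, si)"
      unfolding Suc funpow_Suc_right using j(1) run_step.hyps(2) by simp
    moreover have "run c s (take i ((step_cost c s, step_output c s) # ts)) ci si"
      using run.run_step[OF run_step.hyps(1,2) j(2)] Suc by simp
    ultimately show ?thesis using j(3,4) Suc by auto
  qed
qed

text \<open>\<open>gap d g ts\<close>: with \<open>g\<close> time units elapsed since the last output, no gap in \<open>ts\<close> exceeds \<open>d\<close>.\<close>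

fun gap :: "nat \<Rightarrow> nat \<Rightarrow> (nat \<times> tree option) list \<Rightarrow> bool" where
  "gap d g [] = (g \<le> d)"
| "gap d g ((k, None) # ts) = gap d (g + k) ts"
| "gap d g ((k, Some t) # ts) = (g + k \<le> d \<and> gap d 0 ts)"

lemma gap_le: "gap d g ts \<Longrightarrow> g \<le> d"
  by (induction d g ts rule: gap.induct) auto

lemma gap_cost: "gap d g ts \<Longrightarrow> z \<in> set ts \<Longrightarrow> fst z \<le> d"
  by (induction d g ts rule: gap.induct) (auto dest: gap_le)

lemma gap_silent: "\<forall>z\<in>set ts. snd z = None \<Longrightarrow> gap d g (ts @ ts') \<longleftrightarrow> gap d (g + sum_list (map fst ts)) ts'"
proof (induction ts arbitrary: g)
  case (Cons z ts)
  then show ?case by (cases z) (auto simp: add.assoc)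
qed simp

text \<open>The tail of \<open>milestones\<close>, computed along a trace that starts at time
  \<open>a\<close> (\<open>marks_eq\<close>).\<close>

fun marks :: "nat \<Rightarrow> (nat \<times> tree option) list \<Rightarrow> nat list" where
  "marks a [] = [a]"
| "marks a ((k, None) # ts) = marks (a + k) ts"
| "marks a ((k, Some t) # ts) = (a + k) # marks (a + k) ts"

lemma gap_marks: "gap d g ts \<Longrightarrow> successively (\<lambda>t t'. t' \<le> t + d) (a # marks (a + g) ts)"
proof (induction d g ts arbitrary: a rule: gap.induct)
  case (2 d g k ts)
  then show ?case using "2.IH"[of a] by (simp add: add.assoc)
next
  case (3 d g k t ts)
  then show ?case using "3.IH"[of "a + g + k"] by (simp add: add.assoc)
qed simp

lemma upt_0_Suc: "[0..<Suc n] = 0 # map Suc [0..<n]"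
  by (metis map_Suc_upt upt_conv_Cons zero_less_Suc)

lemma marks_eq: "marks a ts = map (\<lambda>i. a + sum_list (map fst (take (Suc i) ts)))
    (filter (\<lambda>i. snd (ts ! i) \<noteq> None) [0..<length ts]) @ [a + sum_list (map fst ts)]"
proof (induction a ts rule: marks.induct)
  case (2 a k ts)
  have u: "[0..<length ((k, None) # ts)] = 0 # map Suc [0..<length ts]" using upt_0_Suc[of "length ts"] by (simp del: upt_Suc)
  show ?case unfolding u by (simp add: "2.IH" filter_map comp_def add.assoc)
next
  case (3 a k t ts)
  have u: "[0..<length ((k, Some t) # ts)] = 0 # map Suc [0..<length ts]" using upt_0_Suc[of "length ts"] by (simp del: upt_Suc)
  show ?case unfolding u by (simp add: "3.IH" filter_map comp_def add.assoc)
qed simp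

lemma map_filter_upt: "List.map_filter f xs = List.map_filter (\<lambda>i. f (xs ! i)) [0..<length xs]"
proof -
  have "List.map_filter f xs = List.map_filter f (map ((!) xs) [0..<length xs])" by (simp add: map_nth)
  also have "\<dots> = List.map_filter (\<lambda>i. f (xs ! i)) [0..<length xs]"
    by (simp add: List.map_filter_def filter_map comp_def)
  finally show ?thesis .
qed

text \<open>If no gap exceeds \<open>d\<close>, then no single step does, so by
  \<open>run_size_max\<close> no variable grows beyond \<open>d\<close>. The space is therefore
  bounded by the delay times the number of variables.\<close>

lemma enumerates_within_run:
  assumes r: "run c ((\<lambda>_. Leaf)(0 := inp)) ts Skip s'" and g: "gap d 0 ts" and i: "size inp \<le> d"
    and o: "List.map_filter snd ts = outs"
  shows "enumerates_within c inp outs d (card (insert 0 (com_vars c)) * d)"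
proof -
  let ?s = "(\<lambda>_. Leaf)(0 := inp)"
  have cf: "config c inp k = ((\<lambda>(c, s). step c s) ^^ k) (c, ?s)" for k by (simp add: config_def)
  have cc: "(case config c inp k of (c', s) \<Rightarrow> step_cost c' s) = fst (ts ! k)"
    and co: "output_at c inp k = snd (ts ! k)" if "k < length ts" for k
    using run_config[OF r, of k] that by (auto simp: cf output_at_def)
  have el: "elapsed c inp k = sum_list (map fst (take k ts))" if "k \<le> length ts" for k
    using that
  proof (induction k)
    case (Suc k)
    then show ?case using cc[of k] by (simp add: elapsed_def take_Suc_conv_app_nth)
  qed (simp add: elapsed_def)
  have F: "filter (\<lambda>i. output_at c inp i \<noteq> None) [0..<length ts] = filter (\<lambda>i. snd (ts ! i) \<noteq> None) [0..<length ts]"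
    by (rule filter_cong) (auto simp: co)
  have "fst (config c inp (length ts)) = Skip" using run_config[OF r, of "length ts"] by (auto simp: cf)
  moreover have "outputs c inp (length ts) = outs"
  proof -
    have "List.map_filter (output_at c inp) [0..<length ts] = List.map_filter (\<lambda>i. snd (ts ! i)) [0..<length ts]"
      unfolding List.map_filter_def F by (rule map_cong[OF refl]) (auto simp: co)
    then show ?thesis unfolding outputs_def o[symmetric] using map_filter_upt[of snd ts] by simp
  qed
  moreover have "milestones c inp (length ts) = 0 # marks 0 ts"
  proof -
    have "map (\<lambda>i. elapsed c inp (Suc i)) (filter (\<lambda>i. output_at c inp i \<noteq> None) [0..<length ts]) =
      map (\<lambda>i. 0 + sum_list (map fst (take (Suc i) ts))) (filter (\<lambda>i. snd (ts ! i) \<noteq> None) [0..<length ts])"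
      unfolding F by (rule map_cong[OF refl]) (auto simp: el)
    then show ?thesis unfolding milestones_def marks_eq using el[of "length ts"] by simp
  qed
  moreover have "successively (\<lambda>t t'. t' \<le> t + d) (0 # marks 0 ts)" using gap_marks[OF g, of 0] by simp
  moreover have "space_at c inp k \<le> card (insert 0 (com_vars c)) * d" if k: "k \<le> length ts" for k
  proof -
    obtain ck sk where ck: "config c inp k = (ck, sk)" "run c ?s (take k ts) ck sk"
      using run_config[OF r k] by (auto simp: cf)
    have "\<forall>z\<in>set (take k ts). fst z \<le> d" using gap_cost[OF g] by (meson in_set_takeD)
    then have "size (sk x) \<le> d" for x by (rule run_size_max[OF ck(2)]) (use i in simp)
    then have "(\<Sum>x\<in>insert 0 (com_vars c). size (sk x)) \<le> of_nat (card (insert 0 (com_vars c))) * d"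
      by (intro sum_bounded_above)
    then show ?thesis by (simp add: space_at_def ck(1))
  qed
  ultimately show ?thesis unfolding enumerates_within_def by (intro exI[of _ "length ts"]) simp
qed

section \<open>Depth-first search\<close>

abbreviation silent :: "(nat \<times> tree option) list \<Rightarrow> bool" where
  "silent ts \<equiv> \<forall>z\<in>set ts. snd z = None"

abbreviation cost :: "(nat \<times> tree option) list \<Rightarrow> nat" where
  "cost ts \<equiv> sum_list (map fst ts)"

lemma map_filter_append: "List.map_filter f (xs @ ys) = List.map_filter f xs @ List.map_filter f ys"
  by (simp add: List.map_filter_def)

lemma map_filter_silent: "silent ts \<Longrightarrow> List.map_filter snd ts = []"
  by (induction ts) (auto simp: List.map_filter_def)

text \<open>The flag tells whether the top node is to be output. The state is passed along
  unchanged, because \<open>expand\<close> needs it after the output command.\<close>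

definition inspect :: "edge list \<times> node list \<Rightarrow> (edge list \<times> node list) \<times> (bool \<times> edge list)" where
  "inspect st = (st, case snd st of [] \<Rightarrow> (False, []) | nd # _ \<Rightarrow> (fst (snd nd) = [], fst (snd (snd nd))))"

definition expand :: "(edge list \<times> node list) \<times> (bool \<times> edge list) \<Rightarrow> edge list \<times> node list" where
  "expand z = (fst (fst z), case snd (fst z) of [] \<Rightarrow> [] | nd # ns \<Rightarrow> children (fst (fst z)) nd @ ns)"

lemma PT_inspect: "PT inspect"
proof -
  have "PT ((\<lambda>st. (st, case snd st of [] \<Rightarrow> (False, []) | nd # _ \<Rightarrow> (fst (snd nd) = [], fst (snd (snd nd)))))
    :: edge list \<times> node list \<Rightarrow> (edge list \<times> node list) \<times> (bool \<times> edge list))"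
    by (intro PT_rules)
  then show ?thesis unfolding inspect_def[abs_def] .
qed

lemma PT_expand: "PT expand"
proof -
  have "PT ((\<lambda>z. (fst (fst z), case snd (fst z) of [] \<Rightarrow> [] | nd # ns \<Rightarrow> children (fst (fst z)) nd @ ns))
    :: (edge list \<times> node list) \<times> (bool \<times> edge list) \<Rightarrow> edge list \<times> node list)"
    by (intro PT_rules PT_children)
  then show ?thesis unfolding expand_def[abs_def] .
qed

lemma run_cons:
  "c \<noteq> Skip \<Longrightarrow> step c s = (c', s') \<Longrightarrow> step_cost c s = k \<Longrightarrow> step_output c s = v \<Longrightarrow> run c' s' ts c'' s'' \<Longrightarrow>
    run c s ((k, v) # ts) c'' s''"
  using run_step by metis

text \<open>One pass of the loop makes at most one output and takes time polynomial in the size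
  \<open>S\<close> of the state. The trace is split at the output, so that the costs before and
  after it can be charged to different gaps.\<close>

lemma dfs_iteration:
  obtains W K where "pb K"
    "\<forall>es nd ns s S. s 0 = Node (enc (es, nd # ns)) Leaf \<longrightarrow> size (enc (es, nd # ns)) \<le> S \<longrightarrow>
      (\<exists>a k b s'. run W s (a @ (if fst (snd nd) = [] then [(k, Some (enc (fst (snd (snd nd)))))] else []) @ b) W s' \<and>
        s' 0 = Node (enc (es, children es nd @ ns)) Leaf \<and> silent a \<and> silent b \<and> cost a + k + cost b \<le> K S)"
    "\<forall>(es :: edge list) s S. s 0 = Node (enc (es, [] :: node list)) Leaf \<longrightarrow> size (enc (es, [] :: node list)) \<le> S \<longrightarrow>
      (\<exists>a s'. run W s a Skip s' \<and> silent a \<and> cost a \<le> K S)"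
proof -
  obtain c1 B1 where B1: "pb B1"
    "\<forall>a k. ex c1 (Node (enc a) k) (B1 (size (enc a) + size k)) (Node (enc (inspect a)) k)"
    using PT_inspect unfolding PT_def by blast
  obtain c2 B2 where B2: "pb B2"
    "\<forall>a k. ex c2 (Node (enc a) k) (B2 (size (enc a) + size k)) (Node (enc (expand a)) k)"
    using PT_expand unfolding PT_def by blast
  obtain q where q: "pb q" "\<forall>a. size (enc (inspect a)) \<le> q (size (enc a))"
    by (rule PT_size[OF PT_inspect])
  define tst where "tst = Right (Left (Var 0))"
  define fE where "fE = Left (Right (Left (Var 0)))"
  define oE where "oE = Right (Right (Left (Var 0)))"
  define body where "body = Seq c1 (Seq (Cond fE (Output oE) Skip) c2)"
  define W where "W = While tst body"
  define K where "K S = ec tst (S + 1) + B1 S + ec fE (q S + 1) + ec oE (q S + 1) + B2 (q S) + 4" for S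
  have e0: "exp0 tst" "exp0 fE" "exp0 oE" by (simp_all add: tst_def fE_def oE_def)
  have pK: "pb K" unfolding K_def[abs_def] by (intro pb_intros pb_comp[OF B2(1)] B1(1) q(1))
  show ?thesis
  proof (rule that[OF pK])
    show "\<forall>es nd ns s S. s 0 = Node (enc (es, nd # ns)) Leaf \<longrightarrow> size (enc (es, nd # ns)) \<le> S \<longrightarrow>
      (\<exists>a k b s'. run W s (a @ (if fst (snd nd) = [] then [(k, Some (enc (fst (snd (snd nd)))))] else []) @ b) W s' \<and>
        s' 0 = Node (enc (es, children es nd @ ns)) Leaf \<and> silent a \<and> silent b \<and> cost a + k + cost b \<le> K S)"
    proof (intro allI impI)
      fix es :: "edge list" and nd :: node and ns :: "node list" and s :: store and S
      assume s: "s 0 = Node (enc (es, nd # ns)) Leaf" and S: "size (enc (es, nd # ns)) \<le> S"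
      let ?st = "(es, nd # ns)"
      define st where "st = inspect ?st"
      have st: "st = ((es, nd # ns), (fst (snd nd) = [], fst (snd (snd nd))))" by (simp add: st_def inspect_def)
      have ex2: "expand st = (es, children es nd @ ns)" by (simp add: st expand_def)
      have sz: "size (enc st) \<le> q S" using q(2)[rule_format, of ?st] pb_mono[OF q(1) S] by (simp add: st_def del: enc_pair)
      obtain t1 s1 where 1: "run c1 s t1 Skip s1" "s1 0 = Node (enc st) Leaf" "silent t1" "cost t1 \<le> B1 (size (enc ?st) + size Leaf)"
        unfolding st_def by (rule exD[OF B1(2)[rule_format, of ?st Leaf], where s = s, OF s])
      obtain t2 s2 where 2: "run c2 s1 t2 Skip s2" "s2 0 = Node (enc (es, children es nd @ ns)) Leaf" "silent t2"
        "cost t2 \<le> B2 (size (enc st) + size Leaf)"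
        by (rule exD[OF B2(2)[rule_format, of st Leaf, unfolded ex2], where s = s1, OF 1(2)])
      have c1: "cost t1 \<le> B1 S" using 1(4) pb_mono[OF B1(1) S] by simp
      have c2: "cost t2 \<le> B2 (q S)" using 2(4) pb_mono[OF B2(1) sz] by simp
      have fin: "eval fE s1 \<noteq> Leaf \<longleftrightarrow> fst (snd nd) = []" by (simp add: fE_def 1(2) st enc_bool_def)
      have out: "eval oE s1 = enc (fst (snd (snd nd)))" by (simp add: oE_def 1(2) st)
      have kt: "1 + eval_cost tst s \<le> ec tst (S + 1)"
        using exp0_cost[OF e0(1), of s] ec_mono[of "size (s 0)" "S + 1" tst] S s by simp
      have kf: "1 + eval_cost fE s1 \<le> ec fE (q S + 1)"
        using exp0_cost[OF e0(2), of s1] ec_mono[of "size (s1 0)" "q S + 1" fE] sz 1(2) by simp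
      have ko: "1 + eval_cost oE s1 \<le> ec oE (q S + 1)"
        using exp0_cost[OF e0(3), of s1] ec_mono[of "size (s1 0)" "q S + 1" oE] sz 1(2) by simp
      let ?o = "if fst (snd nd) = [] then [(1 + eval_cost oE s1, Some (enc (fst (snd (snd nd)))))] else []"
      have "run (Cond fE (Output oE) Skip) s1 ((1 + eval_cost fE s1, None) # ?o) Skip s1"
      proof (cases "fst (snd nd) = []")
        case True
        have r: "run (Output oE) s1 [(1 + eval_cost oE s1, Some (enc (fst (snd (snd nd)))))] Skip s1"
          by (rule run_cons[OF _ _ _ _ run_refl]) (simp_all add: out)
        show ?thesis using True fin run_cons[OF _ _ _ _ r, of "Cond fE (Output oE) Skip" s1] by simp
      next
        case False
        then show ?thesis using fin run_cons[OF _ _ _ _ run_refl, of "Cond fE (Output oE) Skip" s1 Skip s1] by simp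
      qed
      from run_trans[OF run_Seq_Skip[OF this] 2(1)]
      have "run (Seq (Cond fE (Output oE) Skip) c2) s1 ((((1 + eval_cost fE s1, None) # ?o) @ [(1, None)]) @ t2) Skip s2" .
      from run_trans[OF run_Seq_Skip[OF 1(1)] this]
      have "run body s ((t1 @ [(1, None)]) @ (((1 + eval_cost fE s1, None) # ?o) @ [(1, None)]) @ t2) Skip s2"
        by (simp add: body_def)
      from run_Seq_Skip[OF this]
      have b: "run (Seq body W) s (((t1 @ [(1, None)]) @ (((1 + eval_cost fE s1, None) # ?o) @ [(1, None)]) @ t2) @ [(1, None)]) W s2" .
      have "eval tst s \<noteq> Leaf" using s by (simp add: tst_def)
      then have r: "run (Cond tst (Seq body W) Skip) s ((1 + eval_cost tst s, None) #
         ((t1 @ [(1, None)]) @ (((1 + eval_cost fE s1, None) # ?o) @ [(1, None)]) @ t2) @ [(1, None)]) W s2"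
        by (intro run_cons[OF _ _ _ _ b]) simp_all
      have "run W s ((1, None) # (1 + eval_cost tst s, None) #
         ((t1 @ [(1, None)]) @ (((1 + eval_cost fE s1, None) # ?o) @ [(1, None)]) @ t2) @ [(1, None)]) W s2"
        by (rule run_cons[OF _ _ _ _ r]) (simp_all add: W_def)
      then have "run W s (((1, None) # (1 + eval_cost tst s, None) # t1 @ [(1, None), (1 + eval_cost fE s1, None)]) @
          ?o @ ((1, None) # t2 @ [(1, None)])) W s2" by simp
      then show "\<exists>a k b s'. run W s (a @ (if fst (snd nd) = [] then [(k, Some (enc (fst (snd (snd nd)))))] else []) @ b) W s' \<and>
        s' 0 = Node (enc (es, children es nd @ ns)) Leaf \<and> silent a \<and> silent b \<and> cost a + k + cost b \<le> K S"
        using 1(3) 2(2,3) c1 c2 kt kf ko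
        by (intro exI[of _ "(1, None) # (1 + eval_cost tst s, None) # t1 @ [(1, None), (1 + eval_cost fE s1, None)]"]
          exI[of _ "1 + eval_cost oE s1"] exI[of _ "(1, None) # t2 @ [(1, None)]"] exI[of _ s2]) (auto simp: K_def)
    qed
    show "\<forall>(es :: edge list) s S. s 0 = Node (enc (es, [] :: node list)) Leaf \<longrightarrow> size (enc (es, [] :: node list)) \<le> S \<longrightarrow>
      (\<exists>a s'. run W s a Skip s' \<and> silent a \<and> cost a \<le> K S)"
    proof (intro allI impI)
      fix es :: "edge list" and s :: store and S
      assume s: "s 0 = Node (enc (es, [] :: node list)) Leaf" and S: "size (enc (es, [] :: node list)) \<le> S"
      have kt: "1 + eval_cost tst s \<le> ec tst (S + 1)"
        using exp0_cost[OF e0(1), of s] ec_mono[of "size (s 0)" "S + 1" tst] S s by simp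
      have "eval tst s = Leaf" using s by (simp add: tst_def)
      then have r: "run (Cond tst (Seq body W) Skip) s [(1 + eval_cost tst s, None)] Skip s"
        by (intro run_cons[OF _ _ _ _ run_refl]) simp_all
      have "run W s [(1, None), (1 + eval_cost tst s, None)] Skip s"
        by (rule run_cons[OF _ _ _ _ r]) (simp_all add: W_def)
      then show "\<exists>a s'. run W s a Skip s' \<and> silent a \<and> cost a \<le> K S"
        using kt by (intro exI[of _ "[(1, None), (1 + eval_cost tst s, None)]"] exI[of _ s]) (auto simp: K_def)
    qed
  qed
qed

text \<open>\<open>G\<close> says which waiting times \<open>g\<close> since the last output are
  acceptable on entry. Gaps are judged for all continuations \<open>ts'\<close> that tolerate a
  waiting time of up to \<open>K\<close>; in effect, at most \<open>K\<close> has elapsed since the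
  last output when the nodes are done.\<close>

definition processes :: "com \<Rightarrow> edge list \<Rightarrow> nat \<Rightarrow> nat \<Rightarrow> store \<Rightarrow> node list \<Rightarrow> edge list list \<Rightarrow> (nat \<Rightarrow> bool) \<Rightarrow> bool" where
  "processes W es K d s ns L G \<longleftrightarrow> (\<exists>ts s'. run W s ts W s' \<and> s' 0 = Node (enc (es, ns)) Leaf \<and>
     List.map_filter snd ts = map enc L \<and> (\<forall>g ts'. G g \<longrightarrow> (\<forall>g'\<le>K. gap d g' ts') \<longrightarrow> gap d g (ts @ ts')))"

lemma processes_seq:
  assumes 1: "processes W es K d s ns1 L1 G" and 2: "\<forall>s. s 0 = Node (enc (es, ns1)) Leaf \<longrightarrow> processes W es K d s ns L2 G2"
    and G: "\<forall>g\<le>K. G2 g"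
  shows "processes W es K d s ns (L1 @ L2) G"
proof -
  obtain t1 s1 where a: "run W s t1 W s1" "s1 0 = Node (enc (es, ns1)) Leaf" "List.map_filter snd t1 = map enc L1"
    "\<forall>g ts'. G g \<longrightarrow> (\<forall>g'\<le>K. gap d g' ts') \<longrightarrow> gap d g (t1 @ ts')" using 1 unfolding processes_def by blast
  obtain t2 s2 where b: "run W s1 t2 W s2" "s2 0 = Node (enc (es, ns)) Leaf" "List.map_filter snd t2 = map enc L2"
    "\<forall>g ts'. G2 g \<longrightarrow> (\<forall>g'\<le>K. gap d g' ts') \<longrightarrow> gap d g (t2 @ ts')" using mp[OF spec[OF 2, of s1] a(2)] unfolding processes_def by blast
  have "\<forall>g ts'. G g \<longrightarrow> (\<forall>g'\<le>K. gap d g' ts') \<longrightarrow> gap d g ((t1 @ t2) @ ts')"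
  proof (intro allI impI)
    fix g ts' assume g: "G g" "\<forall>g'\<le>K. gap d g' ts'"
    have "\<forall>g'\<le>K. gap d g' (t2 @ ts')" using b(4) G g(2) by blast
    then show "gap d g ((t1 @ t2) @ ts')" using a(4) g(1) by simp
  qed
  then show ?thesis unfolding processes_def using run_trans[OF a(1) b(1)] a(3) b(2,3) by (intro exI[of _ "t1 @ t2"] exI[of _ s2]) (simp add: map_filter_append)
qed

lemma processes_pre:
  assumes "run W s a W s1" "silent a" "processes W es K d s1 ns L G"
  shows "processes W es K d s ns L (\<lambda>g. G (g + cost a))"
proof -
  obtain t2 s2 where b: "run W s1 t2 W s2" "s2 0 = Node (enc (es, ns)) Leaf" "List.map_filter snd t2 = map enc L"
    "\<forall>g ts'. G g \<longrightarrow> (\<forall>g'\<le>K. gap d g' ts') \<longrightarrow> gap d g (t2 @ ts')" using assms(3) unfolding processes_def by blast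
  show ?thesis unfolding processes_def
    using run_trans[OF assms(1) b(1)] b(2-4) map_filter_silent[OF assms(2)] gap_silent[OF assms(2)]
    by (intro exI[of _ "a @ t2"] exI[of _ s2]) (simp add: map_filter_append)
qed

lemma processes_mono: "processes W es K d s ns L G \<Longrightarrow> (\<And>g. G' g \<Longrightarrow> G g) \<Longrightarrow> processes W es K d s ns L G'"
  unfolding processes_def by blast

context graph_list
begin

text \<open>On entry there must be room for a descent of \<open>rank nd + 1\<close> passes. The
  first child inherits what is left of it; the next ones start with a waiting time of at most
  \<open>K\<close>, as every subtree ends within one pass after an output. Each unit of rank lost
  adds at most \<open>C\<close> cells to the stack, hence the bound \<open>S\<close>.\<close>

lemma process_node:
  fixes W :: com and K S C R d :: nat
  assumes step: "\<forall>nd ns s. s 0 = Node (enc (es, nd # ns)) Leaf \<longrightarrow> size (enc (nd # ns)) \<le> S \<longrightarrow>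
      (\<exists>a k b s'. run W s (a @ (if fst (snd nd) = [] then [(k, Some (enc (fst (snd (snd nd)))))] else []) @ b) W s' \<and>
        s' 0 = Node (enc (es, children es nd @ ns)) Leaf \<and> silent a \<and> silent b \<and> cost a + k + cost b \<le> K)"
    and C: "\<forall>nd. invN nd \<longrightarrow> size (enc (children es nd)) \<le> C"
    and d: "(R + 2) * K \<le> d"
  shows "invN nd \<Longrightarrow> rank nd \<le> R \<Longrightarrow> size (enc (nd # ns)) + rank nd * C \<le> S \<Longrightarrow>
    \<exists>L. distinct L \<and> set L = Sem nd \<and> (\<forall>s. s 0 = Node (enc (es, nd # ns)) Leaf \<longrightarrow>
      processes W es K d s ns L (\<lambda>g. g + (rank nd + 1) * K \<le> d))"
proof (induction "rank nd" arbitrary: nd ns rule: less_induct)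
  case less
  have sz: "size (enc (nd # ns)) \<le> S" using less.prems(3) by simp
  obtain fl rest A V where nd: "nd = (fl, rest, A, V)" by (cases nd)
  show ?case
  proof (cases rest)
    case Nil
    have nd': "nd = (False, [], A, [])" "A \<in> sols []" using less.prems(1) Nil by (auto simp: nd invN_def split: if_splits)
    have Sem: "Sem nd = {A}" using nd'(2) by (auto simp: nd'(1) Sem_def lev_def)
    have "processes W es K d s ns [A] (\<lambda>g. g + (rank nd + 1) * K \<le> d)" if s: "s 0 = Node (enc (es, nd # ns)) Leaf" for s
    proof -
      obtain a k b s' where h: "run W s (a @ (if fst (snd nd) = [] then [(k, Some (enc (fst (snd (snd nd)))))] else []) @ b) W s'"
        "s' 0 = Node (enc (es, children es nd @ ns)) Leaf" "silent a" "silent b" "cost a + k + cost b \<le> K"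
        using step[rule_format, of s nd ns] s sz by blast
      have r: "run W s (a @ [(k, Some (enc A))] @ b) W s'" using h(1) by (simp add: nd'(1))
      have z: "s' 0 = Node (enc (es, ns)) Leaf" using h(2) by (simp add: nd'(1) children_Nil)
      have "gap d g ((a @ [(k, Some (enc A))] @ b) @ ts')" if g: "g + (rank nd + 1) * K \<le> d" "\<forall>g'\<le>K. gap d g' ts'" for g ts'
      proof -
        have "gap d (cost b) ts'" using g(2) h(5) by simp
        then have "gap d 0 (b @ ts')" using gap_silent[OF h(4), of d 0 ts'] by simp
        moreover have "g + cost a + k \<le> d" using g(1) h(5) by simp
        ultimately show ?thesis using gap_silent[OF h(3)] by simp
      qed
      moreover have "List.map_filter snd (a @ [(k, Some (enc A))] @ b) = map enc [A]"
        by (simp only: map_filter_append map_filter_silent[OF h(3)] map_filter_silent[OF h(4)]) (simp add: List.map_filter_def)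
      ultimately show ?thesis unfolding processes_def using r z
        by (intro exI[of _ "a @ [(k, Some (enc A))] @ b"] exI[of _ s']) blast
    qed
    then show ?thesis using Sem by (intro exI[of _ "[A]"]) simp
  next
    case (Cons e B)
    let ?cs = "children es nd" and ?r = "rank nd"
    have iv: "invN (fl, e # B, A, V)" using less.prems(1) by (simp add: nd Cons)
    note ch = children_props[OF iv, folded Cons, folded nd]
    \<comment> \<open>No dead ends: outputs are expected below the node, so it has a child.\<close>
    have ne: "?cs \<noteq> []" using Sem_ne[OF less.prems(1)] ch(3) by auto
    have list: "set cs \<subseteq> set ?cs \<Longrightarrow> distinct cs \<Longrightarrow> size (enc (cs @ ns)) + (?r - 1) * C \<le> S \<Longrightarrow>
      \<exists>L. distinct L \<and> set L = (\<Union>c\<in>set cs. Sem c) \<and> (\<forall>s. s 0 = Node (enc (es, cs @ ns)) Leaf \<longrightarrow>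
        processes W es K d s ns L (\<lambda>g. if cs = [] then g \<le> K else g + ?r * K \<le> d))" for cs
    proof (induction cs)
      case Nil
      have "processes W es K d s ns [] (\<lambda>g. g \<le> K)" if "s 0 = Node (enc (es, ns)) Leaf" for s
        unfolding processes_def using that by (intro exI[of _ "[]"] exI[of _ s]) (auto intro: run_refl simp: List.map_filter_def)
      then show ?case by (intro exI[of _ "[]"]) simp
    next
      case (Cons c cs)
      have c: "c \<in> set ?cs" using Cons.prems(1) by simp
      have ci: "invN c" and cr: "rank c < ?r" using ch(1)[OF c] by blast+
      have "rank c * C \<le> (?r - 1) * C" using cr by (intro mult_le_mono1) simp
      moreover have "size (enc (c # cs @ ns)) + (?r - 1) * C \<le> S" using Cons.prems(3) by simp
      ultimately have "size (enc (c # cs @ ns)) + rank c * C \<le> S" by linarith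
      from less.hyps[OF cr ci _ this] cr less.prems(2)
      obtain L1 where L1: "distinct L1" "set L1 = Sem c" "\<forall>s. s 0 = Node (enc (es, c # cs @ ns)) Leaf \<longrightarrow>
        processes W es K d s (cs @ ns) L1 (\<lambda>g. g + (rank c + 1) * K \<le> d)" by auto
      obtain L2 where L2: "distinct L2" "set L2 = (\<Union>c\<in>set cs. Sem c)" "\<forall>s. s 0 = Node (enc (es, cs @ ns)) Leaf \<longrightarrow>
        processes W es K d s ns L2 (\<lambda>g. if cs = [] then g \<le> K else g + ?r * K \<le> d)"
        using Cons.IH Cons.prems by auto
      have "Sem c \<inter> (\<Union>c\<in>set cs. Sem c) = {}"
      proof (rule ccontr)
        assume "Sem c \<inter> (\<Union>c\<in>set cs. Sem c) \<noteq> {}"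
        then obtain D c' where D: "D \<in> Sem c" "c' \<in> set cs" "D \<in> Sem c'" by blast
        then have "c = c'" using ch(4)[OF c _ D(1,3)] Cons.prems(1) by auto
        then show False using D(2) Cons.prems(2) by simp
      qed
      then have dL: "distinct (L1 @ L2)" "set (L1 @ L2) = (\<Union>c\<in>set (c # cs). Sem c)" using L1 L2 by auto
      have rK: "(rank c + 1) * K \<le> ?r * K" using cr by (intro mult_le_mono1) simp
      have rd: "?r * K + K \<le> d"
      proof -
        have "(?r + 1) * K \<le> (R + 2) * K" using less.prems(2) by (intro mult_le_mono1) simp
        then show ?thesis using d by simp
      qed
      have "processes W es K d s ns (L1 @ L2) (\<lambda>g. g + ?r * K \<le> d)" if s: "s 0 = Node (enc (es, (c # cs) @ ns)) Leaf" for s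
      proof -
        have "processes W es K d s (cs @ ns) L1 (\<lambda>g. g + (rank c + 1) * K \<le> d)" using L1(3) s by simp
        then have "processes W es K d s (cs @ ns) L1 (\<lambda>g. g + ?r * K \<le> d)" by (rule processes_mono) (use rK in linarith)
        then show ?thesis by (rule processes_seq[OF _ L2(3)]) (use rd in auto)
      qed
      then show ?case using dL by (intro exI[of _ "L1 @ L2"]) simp
    qed
    have r0: "0 < ?r" using ch(1)[of "hd ?cs"] ne by auto
    \<comment> \<open>The children take at most \<open>C\<close> cells, which the loss of one unit
      of rank pays for.\<close>
    have "size (enc (?cs @ ns)) + (?r - 1) * C \<le> S"
    proof -
      have "C + (?r - 1) * C = ?r * C" using r0 by (metis Suc_diff_1 mult_Suc)
      moreover have "size (enc ?cs) \<le> C" using C less.prems(1) by blast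
      moreover have "size (enc ns) + ?r * C \<le> S" using less.prems(3) by simp
      ultimately show ?thesis unfolding size_enc_append by linarith
    qed
    from list[OF subset_refl ch(2) this] obtain L where L: "distinct L" "set L = (\<Union>c\<in>set ?cs. Sem c)"
      "\<forall>s. s 0 = Node (enc (es, ?cs @ ns)) Leaf \<longrightarrow> processes W es K d s ns L (\<lambda>g. if ?cs = [] then g \<le> K else g + ?r * K \<le> d)"
      by blast
    have "processes W es K d s ns L (\<lambda>g. g + (rank nd + 1) * K \<le> d)" if s: "s 0 = Node (enc (es, nd # ns)) Leaf" for s
    proof -
      obtain a k b s' where h: "run W s (a @ (if fst (snd nd) = [] then [(k, Some (enc (fst (snd (snd nd)))))] else []) @ b) W s'"
        "s' 0 = Node (enc (es, children es nd @ ns)) Leaf" "silent a" "silent b" "cost a + k + cost b \<le> K"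
        using step[rule_format, of s nd ns] s sz by blast
      have r: "run W s (a @ b) W s'" using h(1) Cons by (simp add: nd)
      have "silent (a @ b)" using h(3,4) by auto
      from processes_pre[OF r this mp[OF spec[OF L(3), of s'] h(2)]]
      show ?thesis
      proof (rule processes_mono)
        fix g assume "g + (rank nd + 1) * K \<le> d"
        moreover have "cost (a @ b) \<le> K" using h(5) by simp
        ultimately have "g + cost (a @ b) + rank nd * K \<le> d" by simp
        then show "if ?cs = [] then g + cost (a @ b) \<le> K else g + cost (a @ b) + ?r * K \<le> d" using ne by simp
      qed
    qed
    then show ?thesis using L(1,2) ch(3) by (intro exI[of _ L]) simp
  qed
qed

text \<open>A node consists of a flag, a suffix of \<open>es\<close> and two sublists of
  \<open>es\<close>.\<close>

lemma size_invN:
  assumes "invN nd"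
  shows "size (enc nd) \<le> 3 * size (enc es) + 4"
proof -
  obtain fl rest A V where nd: "nd = (fl, rest, A, V)" by (cases nd)
  obtain pre where p: "es = pre @ rest" using assms by (auto simp: nd invN_def)
  have 1: "size (enc rest) \<le> size (enc es)" using size_enc_append[of pre rest] p by simp
  have "canon es A \<and> canon es V"
    using assms canon_Nil by (auto simp: nd invN_def invB_def sols_def split: if_splits)
  then have "A = filter (\<lambda>f. f \<in> set A) es" "V = filter (\<lambda>f. f \<in> set V) es" unfolding canon_def by blast+
  then have 2: "size (enc A) \<le> size (enc es)" "size (enc V) \<le> size (enc es)" using size_enc_filter by metis+
  have "size (enc fl) \<le> 1" by (rule size_enc_bool)
  then show ?thesis using 1 2 by (simp add: nd)
qed

end

context graph_list
begin

lemma rank_root: "rank (False, es, [], []) \<le> size (enc es) * (2 * size (enc es) + 2)"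
  unfolding rank_def Let_def fst_conv snd_conv if_False
  by (intro mult_le_mono add_mono length_le_enc order_refl)

text \<open>\<open>4 * x + 5\<close> bounds the code of the edge list paired with a node, and
  \<open>S\<close> that of the edge list paired with the stack. In the delay, \<open>I x + 1\<close>
  is spent on initialization before the first output, and the summand \<open>x\<close> makes room
  for the input, as \<open>enumerates_within_run\<close> demands.\<close>

lemma enumerate_sols:
  fixes W J :: com and K I q :: "nat \<Rightarrow> nat" and n :: nat
  defines "x \<equiv> size (enc (n, es))"
  defines "R \<equiv> x * (2 * x + 2)" and "C \<equiv> q (4 * x + 5)"
  defines "S \<equiv> 4 * x + 6 + R * C"
  assumes pq: "pb q" and q: "\<forall>z. size (enc (children (fst z) (snd z))) \<le> q (size (enc z))"
    and W: "\<forall>es nd ns s S. s 0 = Node (enc (es, nd # ns)) Leaf \<longrightarrow> size (enc (es, nd # ns)) \<le> S \<longrightarrow>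
      (\<exists>a k b s'. run W s (a @ (if fst (snd nd) = [] then [(k, Some (enc (fst (snd (snd nd)))))] else []) @ b) W s' \<and>
        s' 0 = Node (enc (es, children es nd @ ns)) Leaf \<and> silent a \<and> silent b \<and> cost a + k + cost b \<le> K S)"
    and Wend: "\<forall>(es :: edge list) s S. s 0 = Node (enc (es, [] :: node list)) Leaf \<longrightarrow> size (enc (es, [] :: node list)) \<le> S \<longrightarrow>
      (\<exists>a s'. run W s a Skip s' \<and> silent a \<and> cost a \<le> K S)"
    and J: "ex J (enc (n, es)) (I x) (Node (enc (es, [(False, es, [] :: edge list, [] :: edge list)])) Leaf)"
  shows "\<exists>L. distinct L \<and> set L = sols [] \<and> enumerates_within (Seq J W) (enc (n, es)) (map enc L)
    (I x + 1 + (R + 3) * K S + x) (card (insert 0 (com_vars (Seq J W))) * (I x + 1 + (R + 3) * K S + x))"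
proof -
  define root :: node where "root = (False, es, [], [])"
  let ?d = "I x + 1 + (R + 3) * K S + x"
  have ex: "size (enc es) \<le> x" by (simp add: x_def)
  have C: "\<forall>nd. invN nd \<longrightarrow> size (enc (children es nd)) \<le> C"
  proof (intro allI impI)
    fix nd assume "invN nd"
    then have "size (enc (es, nd)) \<le> 4 * x + 5" using size_invN[of nd] ex by simp
    then show "size (enc (children es nd)) \<le> C"
      using q[rule_format, of "(es, nd)"] pb_mono[OF pq, of "size (enc (es, nd))" "4 * x + 5"] by (simp add: C_def)
  qed
  have step: "\<forall>nd ns s. s 0 = Node (enc (es, nd # ns)) Leaf \<longrightarrow> size (enc (nd # ns)) \<le> 3 * x + 5 + R * C \<longrightarrow>
      (\<exists>a k b s'. run W s (a @ (if fst (snd nd) = [] then [(k, Some (enc (fst (snd (snd nd)))))] else []) @ b) W s' \<and>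
        s' 0 = Node (enc (es, children es nd @ ns)) Leaf \<and> silent a \<and> silent b \<and> cost a + k + cost b \<le> K S)"
  proof (intro allI impI)
    fix nd :: node and ns :: "node list" and s :: store
    assume s: "s 0 = Node (enc (es, nd # ns)) Leaf" and z: "size (enc (nd # ns)) \<le> 3 * x + 5 + R * C"
    have "size (enc (es, nd # ns)) = size (enc es) + size (enc (nd # ns)) + 1" by (simp only: enc_pair tree.size)
    then have "size (enc (es, nd # ns)) \<le> S" unfolding S_def using ex z by linarith
    then show "\<exists>a k b s'. run W s (a @ (if fst (snd nd) = [] then [(k, Some (enc (fst (snd (snd nd)))))] else []) @ b) W s' \<and>
        s' 0 = Node (enc (es, children es nd @ ns)) Leaf \<and> silent a \<and> silent b \<and> cost a + k + cost b \<le> K S"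
      using W s by blast
  qed
  have rR: "rank root \<le> R"
  proof -
    have "size (enc es) * (2 * size (enc es) + 2) \<le> x * (2 * x + 2)" using ex by (intro mult_le_mono) simp_all
    then show ?thesis using rank_root by (simp add: root_def R_def)
  qed
  have iv: "invN root" unfolding root_def by (rule invN_root)
  have "rank root * C \<le> R * C" using rR by (rule mult_le_mono1)
  moreover have "size (enc [root]) \<le> 3 * x + 5" using size_invN[OF iv] ex by simp
  ultimately have "size (enc [root]) + rank root * C \<le> 3 * x + 5 + R * C" by linarith
  moreover have d: "(R + 2) * K S \<le> ?d" by (simp add: algebra_simps)
  ultimately obtain L where L: "distinct L" "set L = sols []"
    "\<forall>s. s 0 = Node (enc (es, [root])) Leaf \<longrightarrow> processes W es (K S) ?d s [] L (\<lambda>g. g + (rank root + 1) * K S \<le> ?d)"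
    using process_node[OF step C d iv rR, of "[]"] Sem_root unfolding root_def by blast
  let ?s = "(\<lambda>_. Leaf)(0 := enc (n, es))"
  have "?s 0 = enc (n, es)" by simp
  from exD[OF J, where s = ?s, OF this]
  obtain t0 s1 where 0: "run J ?s t0 Skip s1" "s1 0 = Node (enc (es, [root])) Leaf" "silent t0" "cost t0 \<le> I x"
    unfolding root_def by blast
  obtain ts s2 where 1: "run W s1 ts W s2" "s2 0 = Node (enc (es, [] :: node list)) Leaf" "List.map_filter snd ts = map enc L"
    "\<forall>g ts'. g + (rank root + 1) * K S \<le> ?d \<longrightarrow> (\<forall>g'\<le>K S. gap ?d g' ts') \<longrightarrow> gap ?d g (ts @ ts')"
    using mp[OF spec[OF L(3), of s1] 0(2)] unfolding processes_def by blast
  have "size (enc (es, [] :: node list)) \<le> S" using ex by (simp add: S_def)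
  then obtain a s3 where 2: "run W s2 a Skip s3" "silent a" "cost a \<le> K S" using Wend 1(2) by blast
  have r: "run (Seq J W) ?s ((t0 @ [(1, None)]) @ (ts @ a)) Skip s3"
    by (rule run_trans[OF run_Seq_Skip[OF 0(1)] run_trans[OF 1(1) 2(1)]])
  have st: "silent (t0 @ [(1, None)])" using 0(3) by auto
  have "gap ?d g' (a @ [])" if "g' \<le> K S" for g'
    unfolding gap_silent[OF 2(2)] using that 2(3) by (simp add: algebra_simps)
  moreover have "cost (t0 @ [(1, None)]) + (rank root + 1) * K S \<le> ?d"
  proof -
    have "(rank root + 1) * K S \<le> (R + 3) * K S" using rR by (intro mult_le_mono1) simp
    then show ?thesis using 0(4) by simp
  qed
  ultimately have "gap ?d (cost (t0 @ [(1, None)])) (ts @ a)" using 1(4) by simp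
  then have g: "gap ?d 0 ((t0 @ [(1, None)]) @ (ts @ a))" unfolding gap_silent[OF st] by simp
  have o: "List.map_filter snd ((t0 @ [(1, None)]) @ (ts @ a)) = map enc L"
    unfolding map_filter_append[of snd _ "ts @ a"] map_filter_silent[OF st] by (simp add: map_filter_append 1(3) map_filter_silent[OF 2(2)])
  have "size (enc (n, es)) \<le> ?d" by (simp add: x_def)
  from enumerates_within_run[OF r g this o] L(1,2) show ?thesis by blast
qed

end

lemma enumeration_program:
  obtains alg D where "pb D"
    "\<forall>n es. graph_list es \<longrightarrow> (\<exists>L. distinct L \<and> set L = graph_list.sols es [] \<and> enumerates_within alg (enc (n :: nat, es)) (map enc L)
      (D (size (enc (n, es)))) (card (insert 0 (com_vars alg)) * D (size (enc (n, es)))))"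
proof -
  obtain W K where K: "pb K"
    "\<forall>es nd ns s S. s 0 = Node (enc (es, nd # ns)) Leaf \<longrightarrow> size (enc (es, nd # ns)) \<le> S \<longrightarrow>
      (\<exists>a k b s'. run W s (a @ (if fst (snd nd) = [] then [(k, Some (enc (fst (snd (snd nd)))))] else []) @ b) W s' \<and>
        s' 0 = Node (enc (es, children es nd @ ns)) Leaf \<and> silent a \<and> silent b \<and> cost a + k + cost b \<le> K S)"
    "\<forall>(es :: edge list) s S. s 0 = Node (enc (es, [] :: node list)) Leaf \<longrightarrow> size (enc (es, [] :: node list)) \<le> S \<longrightarrow>
      (\<exists>a s'. run W s a Skip s' \<and> silent a \<and> cost a \<le> K S)"
    by (rule dfs_iteration)
  have "PT (\<lambda>z :: edge list \<times> node. children (fst z) (snd z))" by (intro PT_rules PT_children)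
  then obtain q where q: "pb q" "\<forall>z. size (enc (children (fst z) (snd z))) \<le> q (size (enc z))" by (rule PT_size)
  have "PT ((\<lambda>z. (snd z, [(False, snd z, [], [])])) :: nat \<times> edge list \<Rightarrow> edge list \<times> node list)" by (intro PT_rules)
  then obtain c1 B where c1: "pb B"
    "\<forall>(z :: nat \<times> edge list) k. ex c1 (Node (enc z) k) (B (size (enc z) + size k)) (Node (enc (snd z, [(False, snd z, [] :: edge list, [] :: edge list)])) k)"
    unfolding PT_def by blast
  let ?e = "NodeE (Var 0) LeafE"
  define c0 where "c0 = Seq (Assign 0 ?e) c1"
  define I where "I x = ec ?e x + B x + 1" for x
  have c0: "ex c0 (enc (n, es)) (I (size (enc (n, es)))) (Node (enc (es, [(False, es, [] :: edge list, [] :: edge list)])) Leaf)"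
    for n :: nat and es :: "edge list"
  proof -
    have "ex (Assign 0 ?e) (enc (n, es)) (ec ?e (size (enc (n, es)))) (Node (enc (n, es)) Leaf)"
      using ex_Assign[of ?e "enc (n, es)"] by simp
    from ex_Seq[OF this, of c1] c1(2)[rule_format, of "(n, es)" Leaf] show ?thesis by (simp add: c0_def I_def)
  qed
  define R where "R x = x * (2 * x + 2)" for x :: nat
  define S where "S x = 4 * x + 6 + R x * q (4 * x + 5)" for x
  define D where "D x = I x + 1 + (R x + 3) * K (S x) + x" for x
  have pR: "pb R" unfolding R_def[abs_def] by (intro pb_intros)
  have pS: "pb S" unfolding S_def[abs_def] by (intro pb_intros pR pb_comp[OF q(1)])
  have pD: "pb D" unfolding D_def[abs_def] I_def by (intro pb_intros pR c1(1) pb_comp[OF K(1)] pS)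
  have "\<exists>L. distinct L \<and> set L = graph_list.sols es [] \<and> enumerates_within (Seq c0 W) (enc (n, es)) (map enc L)
      (D (size (enc (n, es)))) (card (insert 0 (com_vars (Seq c0 W))) * D (size (enc (n, es))))"
    if g: "graph_list es" for n :: nat and es
    unfolding D_def S_def R_def
    by (rule graph_list.enumerate_sols[where q = q and K = K and W = W and J = c0 and I = I and n = n, OF g q K(2,3) c0])
  then show ?thesis by (intro that[OF pD, of "Seq c0 W"] allI impI)
qed

lemma enumerates_within_mono:
  assumes "enumerates_within c inp outs d m" "d \<le> d'" "m \<le> m'"
  shows "enumerates_within c inp outs d' m'"
proof -
  obtain N where N: "fst (config c inp N) = Skip" "outputs c inp N = outs"
    "successively (\<lambda>t t'. t' \<le> t + d) (milestones c inp N)" "\<forall>i\<le>N. space_at c inp i \<le> m"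
    using assms(1) unfolding enumerates_within_def by blast
  have "successively (\<lambda>t t'. t' \<le> t + d') (milestones c inp N)"
    using N(3) by (rule successively_mono) (use assms(2) in auto)
  then show ?thesis using N assms(3) unfolding enumerates_within_def by (intro exI[of _ N]) auto
qed

section \<open>Edge sets of graphs\<close>

locale represented =
  fixes vs :: "'a list" and V :: "'a set" and E :: "'a set set" and es :: "edge list"
  assumes G: "fin_simple_graph V E" and vs: "distinct vs" and le: "lists_edges vs E es"
begin

definition ed :: "edge \<Rightarrow> 'a set" where "ed = (\<lambda>(i, j). {vs ! i, vs ! j})"

lemma idx: "f \<in> set es \<Longrightarrow> fst f < length vs \<and> snd f < length vs"
  and ed_E: "ed ` set es = E" and dist_map: "distinct (map ed es)"
  using le by (auto simp: lists_edges_def ed_def)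

lemma inj_ed: "inj_on ed (set es)"
  using dist_map by (simp add: distinct_map)

lemma graph_list: "graph_list es"
proof
  show "distinct es" using dist_map by (simp add: distinct_map)
  show "finite (set es)" by simp
  show "fst f \<noteq> snd f" if "f \<in> set es" for f
  proof
    assume "fst f = snd f"
    then have "card (ed f) = 1" by (cases f) (simp add: ed_def)
    moreover have "card (ed f) = 2" using that ed_E G by (auto simp: fin_simple_graph_def)
    ultimately show False by simp
  qed
  show "f = g" if "f \<in> set es" "g \<in> set es" "{fst f, snd f} = {fst g, snd g}" for f g
  proof (rule inj_onD[OF inj_ed _ that(1,2)])
    have "ed h = (!) vs ` {fst h, snd h}" for h by (cases h) (simp add: ed_def)
    then show "ed f = ed g" using that(3) by metis
  qed
qed

lemma ed_meet:
  assumes "f \<in> set es" "g \<in> set es"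
  shows "ed f \<inter> ed g \<noteq> {} \<longleftrightarrow> inc f (fst g) \<or> inc f (snd g)"
  using idx[OF assms(1)] idx[OF assms(2)] vs
  by (cases f; cases g) (auto simp: ed_def inc_def nth_eq_iff_index_eq)

lemma edge_dominating_iff:
  assumes "S \<subseteq> set es"
  shows "edge_dominating E (ed ` S) \<longleftrightarrow> eds (set es) S"
proof -
  have "closed_edge_nbhd E (ed g) \<inter> ed ` S \<noteq> {} \<longleftrightarrow> cov S (fst g) \<or> cov S (snd g)" if g: "g \<in> set es" for g
  proof -
    have "closed_edge_nbhd E (ed g) \<inter> ed ` S \<noteq> {} \<longleftrightarrow> (\<exists>f\<in>S. ed f \<inter> ed g \<noteq> {})"
      using assms ed_E by (auto simp: closed_edge_nbhd_def)
    also have "\<dots> \<longleftrightarrow> (\<exists>f\<in>S. inc f (fst g) \<or> inc f (snd g))" using ed_meet[OF _ g] assms by (metis subsetD)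
    finally show ?thesis by (auto simp: cov_def)
  qed
  moreover have "ed ` S \<subseteq> E" using assms ed_E by blast
  ultimately show ?thesis unfolding edge_dominating_def eds_def ed_E[symmetric] by auto
qed

text \<open>Domination is inherited by larger sets, so it suffices to test the deletion of single
  edges.\<close>

lemma minimal_iff:
  assumes "S \<subseteq> set es"
  shows "minimal_edge_dominating E (ed ` S) \<longleftrightarrow> tr (set es) {} S"
proof -
  have "(\<forall>D. D \<subset> ed ` S \<longrightarrow> \<not> edge_dominating E D) \<longleftrightarrow> (\<forall>t\<in>S. \<not> eds (set es) (S - {t}))"
  proof (intro iffI ballI allI impI)
    fix t assume h: "\<forall>D. D \<subset> ed ` S \<longrightarrow> \<not> edge_dominating E D" and t: "t \<in> S"
    have "ed t \<notin> ed ` (S - {t})" using inj_on_image_mem_iff[OF inj_ed, of t "S - {t}"] t assms by auto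
    then have "ed ` (S - {t}) \<subset> ed ` S" using t by blast
    from mp[OF spec[OF h] this] have "\<not> edge_dominating E (ed ` (S - {t}))" .
    moreover have "S - {t} \<subseteq> set es" using assms by blast
    ultimately show "\<not> eds (set es) (S - {t})" using edge_dominating_iff[of "S - {t}"] by simp
  next
    fix D assume h: "\<forall>t\<in>S. \<not> eds (set es) (S - {t})" and D: "D \<subset> ed ` S"
    then have "\<not> ed ` S \<subseteq> D" by blast
    then obtain t where t: "t \<in> S" "ed t \<notin> D" by blast
    define S' where "S' = {f \<in> S. ed f \<in> D}"
    have D': "D = ed ` S'" using D by (auto simp: S'_def)
    have S': "S' \<subseteq> S - {t}" using t by (auto simp: S'_def)
    have e: "S' \<subseteq> set es" using S' assms by blast
    have "\<not> eds (set es) S'" using bspec[OF h t(1)] eds_mono[OF S'] by blast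
    then show "\<not> edge_dominating E D" unfolding D' edge_dominating_iff[OF e] .
  qed
  then show ?thesis using edge_dominating_iff[OF assms] assms unfolding minimal_edge_dominating_def tr_def by simp
qed

lemma canon_iff: "T \<in> graph_list.sols es [] \<longleftrightarrow> canon es T \<and> tr (set es) {} (set T)"
  using graph_list.sols_def[OF graph_list, of "[]"] by simp

text \<open>Normal forms are determined by their sets; this is why distinct lists never give the
  same output set.\<close>

lemma sols_inj: "inj_on (\<lambda>T. ed ` set T) (graph_list.sols es [])"
proof (rule inj_onI)
  fix T T' assume T: "T \<in> graph_list.sols es []" "T' \<in> graph_list.sols es []" "ed ` set T = ed ` set T'"
  then have c: "canon es T" "canon es T'" by (simp_all add: canon_iff)
  then have "set T = set T'" using T(3) inj_on_image_eq_iff[OF inj_ed] canon_sub by metis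
  then show "T = T'" by (rule canon_eq[OF c])
qed

lemma sols_image: "(\<lambda>T. ed ` set T) ` graph_list.sols es [] = {D. minimal_edge_dominating E D}"
proof (intro equalityI subsetI)
  fix D assume "D \<in> (\<lambda>T. ed ` set T) ` graph_list.sols es []"
  then obtain T where "canon es T" "tr (set es) {} (set T)" "D = ed ` set T" by (auto simp: canon_iff)
  then show "D \<in> {D. minimal_edge_dominating E D}" using minimal_iff[of "set T"] canon_sub by simp
next
  fix D assume "D \<in> {D. minimal_edge_dominating E D}"
  then have D: "minimal_edge_dominating E D" by simp
  define T where "T = filter (\<lambda>f. ed f \<in> D) es"
  have "D \<subseteq> ed ` set es" using D ed_E by (simp add: minimal_edge_dominating_def edge_dominating_def)
  then have "D = ed ` set T" by (auto simp: T_def)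
  moreover have "canon es T" unfolding T_def by (rule canon_filter_es)
  ultimately show "D \<in> (\<lambda>T. ed ` set T) ` graph_list.sols es []"
    using D minimal_iff[of "set T"] canon_sub by (intro image_eqI[of _ _ T]) (simp_all add: canon_iff)
qed

lemma sols_rep:
  assumes "T \<in> graph_list.sols es []"
  shows "represents_edges vs (ed ` set T) (enc T)"
proof -
  have c: "canon es T" using assms by (simp add: canon_iff)
  have "distinct T" using canon_distinct[OF c] graph_list by (simp add: graph_list_def)
  moreover have "inj_on ed (set T)" using inj_on_subset[OF inj_ed canon_sub[OF c]] .
  ultimately have "lists_edges vs (ed ` set T) T"
    using idx canon_sub[OF c] unfolding lists_edges_def by (fastforce simp: distinct_map ed_def)
  then show ?thesis unfolding represents_edges_def by (auto simp: enc_edges_eq)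
qed

text \<open>Indices are written in unary and stay below the number of vertices, so each edge takes
  at most \<open>2 * length vs + 2\<close> cells.\<close>

lemma size_input: "size (enc (length vs, es)) \<le> length vs + length es * (2 * length vs + 2) + 1"
proof -
  have n: "size (enc m) = m" for m :: nat by (induction m) (auto simp: enc_nat_def)
  have "size (enc l) \<le> length l * (2 * length vs + 2)" if "\<forall>f\<in>set l. fst f < length vs \<and> snd f < length vs" for l :: "edge list"
    using that by (induction l) (auto simp: n)
  then show ?thesis using idx by (simp add: n)
qed

lemma card_E: "card E = length es"
  using dist_map distinct_card[of "map ed es"] ed_E by simp

end

theorem theorem18:
  "\<exists>(alg :: com) (p :: nat poly) (q :: nat poly).
     \<forall>(V :: 'a set) E vs inp.
       fin_simple_graph V E \<longrightarrow> represents_graph vs V E inp \<longrightarrow>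
       (\<exists>Ds outs.
          distinct Ds \<and>
          set Ds = {D. minimal_edge_dominating E D} \<and>
          list_all2 (represents_edges vs) Ds outs \<and>
          enumerates_within alg inp outs
            (poly p (card V + card E)) (poly q (card V + card E)))"
proof -
  obtain alg D where D: "pb D"
    "\<forall>n es. graph_list es \<longrightarrow> (\<exists>L. distinct L \<and> set L = graph_list.sols es [] \<and> enumerates_within alg (enc (n :: nat, es)) (map enc L)
      (D (size (enc (n, es)))) (card (insert 0 (com_vars alg)) * D (size (enc (n, es)))))"
    by (rule enumeration_program)
  \<comment> \<open>The argument \<open>x\<close> stands for \<open>card V + card E\<close>, which
    bounds both numbers that occur in \<open>size_input\<close>.\<close>
  have "pb (\<lambda>x. D (x + x * (2 * x + 2) + 1))" by (intro pb_intros pb_comp[OF D(1)])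
  moreover from this have "pb (\<lambda>x. card (insert 0 (com_vars alg)) * D (x + x * (2 * x + 2) + 1))" by (intro pb_intros)
  ultimately obtain p q where p: "(\<lambda>x. D (x + x * (2 * x + 2) + 1)) = poly p"
    and q: "(\<lambda>x. card (insert 0 (com_vars alg)) * D (x + x * (2 * x + 2) + 1)) = poly q" unfolding pb_def by blast
  show ?thesis
  proof (rule exI[of _ alg], rule exI[of _ p], rule exI[of _ q], intro allI impI)
    fix V :: "'a set" and E vs inp
    assume G: "fin_simple_graph V E" and r: "represents_graph vs V E inp"
    obtain es where v: "distinct vs" "set vs = V" "lists_edges vs E es" "inp = enc_graph (length vs) es"
      using r unfolding represents_graph_def by blast
    interpret represented vs V E es using G v by unfold_locales
    have inp: "inp = enc (length vs, es)" by (simp add: v(4) enc_graph_def enc_edges_eq enc_nat_def)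
    obtain L where L: "distinct L" "set L = graph_list.sols es []" "enumerates_within alg inp (map enc L)
      (D (size inp)) (card (insert 0 (com_vars alg)) * D (size inp))" using D(2) graph_list unfolding inp by blast
    let ?x = "card V + card E"
    have "length vs = card V" using distinct_card[OF v(1)] v(2) by simp
    then have "size inp \<le> card V + card E * (2 * card V + 2) + 1" using size_input card_E by (simp add: inp)
    also have "\<dots> \<le> ?x + ?x * (2 * ?x + 2) + 1" by (intro add_mono mult_le_mono) simp_all
    finally have m: "D (size inp) \<le> D (?x + ?x * (2 * ?x + 2) + 1)" by (rule pb_mono[OF D(1)])
    then have m2: "card (insert 0 (com_vars alg)) * D (size inp) \<le> card (insert 0 (com_vars alg)) * D (?x + ?x * (2 * ?x + 2) + 1)"
      by (rule mult_le_mono2)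
    have "enumerates_within alg inp (map enc L) (poly p ?x) (poly q ?x)"
      using L(3) m m2 unfolding p[symmetric] q[symmetric] by (rule enumerates_within_mono)
    moreover have "distinct (map (\<lambda>T. ed ` set T) L)" using L(1,2) sols_inj by (simp add: distinct_map)
    moreover have "set (map (\<lambda>T. ed ` set T) L) = {D. minimal_edge_dominating E D}" using sols_image L(2) by simp
    moreover have "list_all2 (represents_edges vs) (map (\<lambda>T. ed ` set T) L) (map enc L)"
      unfolding list_all2_map1 list_all2_map2 by (rule list.rel_refl_strong) (use sols_rep L(2) in simp)
    ultimately show "\<exists>Ds outs. distinct Ds \<and> set Ds = {D. minimal_edge_dominating E D} \<and>
          list_all2 (represents_edges vs) Ds outs \<and>
          enumerates_within alg inp outs (poly p (card V + card E)) (poly q (card V + card E))" by blast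
  qed
qed

end
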